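(* Let $m\geq 1$. There exist sets $A,B\subseteq\mathbb{R}^m$ such that for every operation $\circ\in\{+,-,\cdot,/\}$, \[ A\circ A=B\circ B=\mathbb{R}^m,\qquad \dim_H(A\circ B)<m . \] Moreover, for $m\geq 5$ and $\circ\in\{+,-\}$, this holds in particular for $A=\mathcal{W}_m(\infty)$ and $B=\mathcal{S}_m$.
   Context: For $A,B\subseteq\mathbb{R}^m$ and $\circ\in\{+,-,\cdot,/\}$, $A\circ B=\{(a_1\circ b_1,\ldots,a_m\circ b_m):(a_1,\ldots,a_m)\in A,(b_1,\ldots,b_m)\in B\}$ (coordinatewise), where for $\circ=/$ one restricts to $b_i\neq 0$. Fix an arbitrary norm $\Vert\cdot\Vert$ on $\mathbb{R}^m$. $\omega_m(\underline{x})$ is the supremum of $w$ such that $1\leq q\leq Q$, $\Vert q\underline{x}-\underline{p}\Vert\leq Q^{-w}$ has an integer solution $(q,\underline{p})$ for arbitrarily large $Q$, and $\mathcal{W}_m(\infty)=\{\underline{x}\in\mathbb{R}^m:\omega_m(\underline{x})=\infty\}$. $\mathcal{S}_m$ is the set of $\underline{x}\in\mathbb{R}^m$ such that for every $c>0$ and all sufficiently large $Q$ the system $1\leq q\leq Q$, $\Vert q\underline{x}-\underline{p}\Vert\leq cQ^{-1/m}$ has an integer solution. $\dim_H$ is Hausdorff dimension. *)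

theory Defs
  imports "HOL-Analysis.Analysis"
begin

(* The gauge diam(U)^s, with diam(U)^0 = 1 for nonempty U; note that 0 powr 0 = 0. *)
definition diam_pow :: "real \<Rightarrow> 'a::metric_space set \<Rightarrow> ennreal" where
  "diam_pow s U = (if U = {} then 0 else if s = 0 then 1 else ennreal (diameter U powr s))"

(* The covers consist of bounded sets because diameter is only meaningful for these. *)
definition hausdorff_premeasure :: "real \<Rightarrow> real \<Rightarrow> 'a::metric_space set \<Rightarrow> ennreal" where
  "hausdorff_premeasure s \<delta> E =
     (INF U \<in> {U :: nat \<Rightarrow> 'a set. E \<subseteq> (\<Union>i. U i) \<and> (\<forall>i. bounded (U i) \<and> diameter (U i) \<le> \<delta>)}.
        \<Sum>i. diam_pow s (U i))"

definition hausdorff_measure :: "real \<Rightarrow> 'a::metric_space set \<Rightarrow> ennreal" where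
  "hausdorff_measure s E = (SUP \<delta> \<in> {0<..}. hausdorff_premeasure s \<delta> E)"

definition hausdorff_dim :: "'a::metric_space set \<Rightarrow> ereal" where
  "hausdorff_dim E = Inf (ereal ` {s. 0 \<le> s \<and> hausdorff_measure s E = 0})"

datatype arith_op = Op_Add | Op_Sub | Op_Mul | Op_Div

fun set_op :: "arith_op \<Rightarrow> (real ^ 'n) set \<Rightarrow> (real ^ 'n) set \<Rightarrow> (real ^ 'n) set" where
  "set_op Op_Add A B = {(\<chi> i. a $ i + b $ i) | a b. a \<in> A \<and> b \<in> B}"
| "set_op Op_Sub A B = {(\<chi> i. a $ i - b $ i) | a b. a \<in> A \<and> b \<in> B}"
| "set_op Op_Mul A B = {(\<chi> i. a $ i * b $ i) | a b. a \<in> A \<and> b \<in> B}"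
| "set_op Op_Div A B = {(\<chi> i. a $ i / b $ i) | a b. a \<in> A \<and> b \<in> B \<and> (\<forall>i. b $ i \<noteq> 0)}"

definition is_norm :: "('a::real_vector \<Rightarrow> real) \<Rightarrow> bool" where
  "is_norm N \<longleftrightarrow>
     (\<forall>x. 0 \<le> N x) \<and> (\<forall>x. N x = 0 \<longleftrightarrow> x = 0) \<and>
     (\<forall>c x. N (c *\<^sub>R x) = \<bar>c\<bar> * N x) \<and> (\<forall>x y. N (x + y) \<le> N x + N y)"

definition approximable :: "(real ^ 'n \<Rightarrow> real) \<Rightarrow> real ^ 'n \<Rightarrow> real \<Rightarrow> real \<Rightarrow> bool" where
  "approximable N x Q \<epsilon> \<longleftrightarrow>
     (\<exists>(q::int) (p :: int ^ 'n). 1 \<le> q \<and> real_of_int q \<le> Q \<and>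
        N (real_of_int q *\<^sub>R x - (\<chi> i. real_of_int (p $ i))) \<le> \<epsilon>)"

definition omega :: "(real ^ 'n \<Rightarrow> real) \<Rightarrow> real ^ 'n \<Rightarrow> ereal" where
  "omega N x = Sup (ereal ` {w. \<exists>\<^sub>F Q in at_top. approximable N x Q (Q powr (- w))})"

definition W_infty :: "(real ^ 'n \<Rightarrow> real) \<Rightarrow> (real ^ 'n) set" where
  "W_infty N = {x. omega N x = \<infinity>}"

definition singular_set :: "(real ^ 'n \<Rightarrow> real) \<Rightarrow> (real ^ 'n) set" where
  "singular_set N =
     {x. \<forall>c>0. \<forall>\<^sub>F Q in at_top. approximable N x Q (c * Q powr (- 1 / real CARD('n)))}"

end

theory Submission
  imports Defs
begin

text \<open>
  Both parts combine a set \<open>A\<close> which is a limsup of very small balls around few rational points with a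
  set \<open>B\<close> of upper box dimension \<open>s\<close> less than the dimension of the space: at scale \<open>r\<close> the set \<open>A \<circ> B\<close>
  is covered by about \<open>r powr - s\<close> balls per rational point, so its Hausdorff dimension stays close to \<open>s\<close>. In the first part one
  coordinate suffices for this.

  That \<open>A \<circ> A\<close> is everything is Baire's theorem. For \<open>B\<close>, the first part uses base 4 expansions with
  two digits, and exponentials to pass from sums to products; in the second part every vector with a
  vanishing coordinate is singular by Dirichlet's theorem.

  The singular vectors have small box dimension because the number of lattice points in a unit box
  contracts on average along the diagonal flow: lattice points in a hyperplane gain at most a factor
  \<open>R ^ m\<close> when the box grows by \<open>R\<close>, whereas a fixed lattice point stays in the contracted box
  only for few of the translations that the refined cells induce. For a singular vector the count
  stays large forever, so only \<open>(D ^ m / 2) ^ n\<close> of the \<open>D ^ (m * n)\<close> cells of side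
  \<open>1 / D ^ n\<close> can meet the set.
\<close>

section \<open>Hausdorff null sets\<close>

text \<open>The quantity that contracts is a number of lattice points and not the length of a
  shortest vector: it is a sum over integer pairs \<open>(q, p)\<close>, so its mean over the
  refined cells is a double count. The obstacle is that a point of a refined box with
  \<open>q\<close> of size \<open>\<alpha> * e ^ l\<close> is seen from the original box only after
  enlarging that box by about \<open>e ^ l\<close>. It survives in a fraction
  \<open>(3 / e ^ (l + 1)) ^ m\<close> of the cells, so growth at the volume rate
  \<open>R ^ (m + 1)\<close> would eat the gain for large \<open>l\<close>, while growth at the rate
  \<open>R ^ m\<close> leaves a factor of order \<open>1 / e ^ m\<close>. Points that span do grow
  at the volume rate, but then unimodularity bounds their number outright; this goes into an
  additive constant, which is absorbed where the count is large.

  For the sum with very well approximable vectors, infinite order leaves an exponent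
  \<open>w\<close> free: about \<open>D ^ ((m + 1) * i)\<close> rational points serve at scale
  \<open>1 / D ^ (i * w)\<close>, where the singular part needs \<open>(D ^ m / 2) ^ (i * w)\<close>
  cells. A large \<open>w\<close> makes the number of rational points negligible.\<close>

lemma hausdorff_premeasure_le_suminf:
  assumes "E \<subseteq> (\<Union>i. U i)" "\<And>i. bounded (U i)" "\<And>i. diameter (U i) \<le> \<delta>"
  shows "hausdorff_premeasure s \<delta> E \<le> (\<Sum>i. diam_pow s (U i))"
  unfolding hausdorff_premeasure_def by (rule INF_lower) (use assms in auto)

lemma hausdorff_measure_eq_0I:
  assumes "\<And>\<delta> \<epsilon>. \<delta> > 0 \<Longrightarrow> \<epsilon> > 0 \<Longrightarrow> hausdorff_premeasure s \<delta> E \<le> ennreal \<epsilon>"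
  shows "hausdorff_measure s E = 0"
proof -
  have "hausdorff_premeasure s \<delta> E \<le> 0" if "\<delta> > 0" for \<delta>
    by (rule ennreal_le_epsilon) (use assms[OF that] in auto)
  then show ?thesis
    unfolding hausdorff_measure_def by (metis SUP_least greaterThan_iff le_zero_eq)
qed

lemma hausdorff_measure_Union_null:
  fixes E :: "nat \<Rightarrow> 'a::metric_space set"
  assumes "\<And>k. hausdorff_measure s (E k) = 0"
  shows "hausdorff_measure s (\<Union>k. E k) = 0"
proof (rule hausdorff_measure_eq_0I)
  fix \<delta> \<epsilon> :: real assume "\<delta> > 0" "\<epsilon> > 0"
  have "\<exists>U::nat \<Rightarrow> 'a set. E k \<subseteq> (\<Union>i. U i) \<and> (\<forall>i. bounded (U i) \<and> diameter (U i) \<le> \<delta>) \<and>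
      (\<Sum>i. diam_pow s (U i)) < ennreal (\<epsilon> * (1/2) ^ Suc k)" for k
  proof -
    have "hausdorff_premeasure s \<delta> (E k) \<le> hausdorff_measure s (E k)"
      unfolding hausdorff_measure_def by (rule SUP_upper) (use \<open>\<delta> > 0\<close> in auto)
    then have "hausdorff_premeasure s \<delta> (E k) < ennreal (\<epsilon> * (1/2) ^ Suc k)"
      using assms \<open>\<epsilon> > 0\<close> by simp
    then show ?thesis
      unfolding hausdorff_premeasure_def INF_less_iff by auto
  qed
  then obtain U :: "nat \<Rightarrow> nat \<Rightarrow> 'a set" where U: "\<And>k. E k \<subseteq> (\<Union>i. U k i)"
      "\<And>k i. bounded (U k i)" "\<And>k i. diameter (U k i) \<le> \<delta>"
      "\<And>k. (\<Sum>i. diam_pow s (U k i)) < ennreal (\<epsilon> * (1/2) ^ Suc k)"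
    by metis
  define V where "V i = (case prod_decode i of (k, j) \<Rightarrow> U k j)" for i
  have "hausdorff_premeasure s \<delta> (\<Union>k. E k) \<le> (\<Sum>i. diam_pow s (V i))"
  proof (rule hausdorff_premeasure_le_suminf)
    show "(\<Union>k. E k) \<subseteq> (\<Union>i. V i)"
    proof
      fix x assume "x \<in> (\<Union>k. E k)"
      then obtain k j where "x \<in> U k j" using U(1) by blast
      then have "x \<in> V (prod_encode (k, j))" by (simp add: V_def)
      then show "x \<in> (\<Union>i. V i)" by blast
    qed
  qed (auto simp: V_def U split: prod.split)
  also have "\<dots> = (\<Sum>k. \<Sum>j. diam_pow s (U k j))"
    using suminf_ennreal_2dimen[of "\<lambda>k. \<Sum>j. diam_pow s (U k j)" "\<lambda>(k,j). diam_pow s (U k j)"]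
    by (simp add: V_def case_prod_beta)
  also have "\<dots> \<le> (\<Sum>k. ennreal (\<epsilon> * (1/2) ^ Suc k))"
    by (intro suminf_le less_imp_le[OF U(4)]) auto
  also have "\<dots> = ennreal (\<Sum>k. \<epsilon> * (1/2) ^ Suc k)"
    using \<open>\<epsilon> > 0\<close> by (intro suminf_ennreal2 summable_mult) (auto intro: sums_summable power_half_series)
  also have "(\<Sum>k. \<epsilon> * (1/2) ^ Suc k) = \<epsilon>"
    using sums_mult[OF power_half_series, of \<epsilon>] by (simp add: sums_iff)
  finally show "hausdorff_premeasure s \<delta> (\<Union>k. E k) \<le> ennreal \<epsilon>" .
qed

lemma hausdorff_measure_mono_null:
  assumes "E \<subseteq> E'" "hausdorff_measure s E' = 0"
  shows "hausdorff_measure s E = 0"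
proof -
  have "hausdorff_premeasure s \<delta> E \<le> hausdorff_premeasure s \<delta> E'" for \<delta>
    unfolding hausdorff_premeasure_def by (rule INF_superset_mono) (use assms(1) in auto)
  then have "hausdorff_measure s E \<le> hausdorff_measure s E'"
    unfolding hausdorff_measure_def by (intro SUP_mono) auto
  then show ?thesis using assms(2) by simp
qed

lemma hausdorff_measure_countable_Union_null:
  assumes "countable I" "\<And>k. k \<in> I \<Longrightarrow> hausdorff_measure s (E k) = 0" "X \<subseteq> (\<Union>k\<in>I. E k)"
  shows "hausdorff_measure s X = 0"
proof (cases "I = {}")
  case True
  have "hausdorff_premeasure s \<delta> ({} :: 'b set) \<le> ennreal \<epsilon>" if "\<delta> > 0" for \<delta> \<epsilon>
    using hausdorff_premeasure_le_suminf[of "{}" "\<lambda>_. {} :: 'b set" \<delta> s] that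
    by (simp add: diam_pow_def)
  then show ?thesis using True assms(3) by (auto intro: hausdorff_measure_eq_0I)
next
  case False
  then have "(\<Union>k\<in>I. E k) = (\<Union>i. E (from_nat_into I i))"
    using assms(1) by (metis image_image range_from_nat_into)
  then show ?thesis
    using hausdorff_measure_Union_null[of s "\<lambda>i. E (from_nat_into I i)"] False
      assms(2) assms(3) from_nat_into hausdorff_measure_mono_null by metis
qed

lemma hausdorff_dim_le:
  assumes "0 \<le> s" "hausdorff_measure s E = 0"
  shows "hausdorff_dim E \<le> ereal s"
  unfolding hausdorff_dim_def by (rule Inf_lower) (use assms in auto)

text \<open>The convergence half of Borel-Cantelli: every point of \<open>E\<close> lies in a ball
  of index at least \<open>n\<close>, for each \<open>n\<close>, so the tail of the series bounds
  the cost of a cover.\<close>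

lemma hausdorff_measure_limsup_null:
  fixes P :: "nat \<Rightarrow> 'a::metric_space set"
  assumes "t > 0" and fin: "\<And>i. finite (P i)" and r: "\<And>i. r i > 0" "r \<longlonglongrightarrow> 0"
    and summ: "summable (\<lambda>i. real (card (P i)) * (2 * r i) powr t)"
    and E: "\<And>x. x \<in> E \<Longrightarrow> \<exists>\<^sub>\<infinity>i. \<exists>p\<in>P i. dist x p \<le> r i"
  shows "hausdorff_measure t E = 0"
proof (rule hausdorff_measure_eq_0I)
  fix \<delta> \<epsilon> :: real assume pos: "\<delta> > 0" "\<epsilon> > 0"
  define a where "a i = real (card (P i)) * (2 * r i) powr t" for i
  have a0: "a i \<ge> 0" for i by (simp add: a_def)
  have summ_a: "summable a"
    using summ unfolding a_def[abs_def] .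
  then have "(\<lambda>n. \<Sum>i. a (i + n)) \<longlonglongrightarrow> 0"
    by (rule suminf_exist_split2)
  moreover have "eventually (\<lambda>n. \<forall>i\<ge>n. r i < \<delta> / 2) sequentially"
    using order_tendstoD(2)[OF r(2), of "\<delta>/2"] pos by (simp add: eventually_all_ge_at_top)
  ultimately have "eventually (\<lambda>n. (\<Sum>i. a (i + n)) < \<epsilon> \<and> (\<forall>i\<ge>n. r i < \<delta> / 2)) sequentially"
    using pos by (auto intro: eventually_conj order_tendstoD(2))
  then obtain n where n: "(\<Sum>i. a (i + n)) < \<epsilon>" "\<And>i. i \<ge> n \<Longrightarrow> r i < \<delta> / 2"
    by (auto simp: eventually_sequentially)
  have "\<exists>f. P i = f ` {..<card (P i)}" for i
    using ex_bij_betw_nat_finite[OF fin[of i]] by (auto simp: bij_betw_def atLeast0LessThan)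
  then obtain f where f: "\<And>i. P i = f i ` {..<card (P i)}" by metis
  \<comment> \<open>Each finite family is padded by empty sets, which \<open>diam_pow\<close> counts
    as 0, so that the cover is a double sequence.\<close>
  define U where "U i j = (if j < card (P (i + n)) then cball (f (i + n) j) (r (i + n)) else {})" for i j
  define V where "V k = (case prod_decode k of (i, j) \<Rightarrow> U i j)" for k
  have dU: "diameter (U i j) \<le> 2 * r (i + n)" for i j
  proof -
    have "dist x y \<le> 2 * r (i + n)" if "x \<in> U i j" "y \<in> U i j" for x y
      using that dist_triangle3[of x y "f (i + n) j"]
      by (auto simp: U_def split: if_splits)
    then show ?thesis
      using r(1)[of "i + n"] by (auto simp: diameter_def less_imp_le intro!: cSUP_least)
  qed
  have "hausdorff_premeasure t \<delta> E \<le> (\<Sum>i. diam_pow t (V i))"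
  proof (rule hausdorff_premeasure_le_suminf)
    show "E \<subseteq> (\<Union>i. V i)"
    proof
      fix x assume "x \<in> E"
      then obtain i p where i: "i \<ge> n" "p \<in> P i" "dist x p \<le> r i"
        using E[of x] unfolding INFM_nat_le by blast
      then obtain j where "j < card (P i)" "p = f i j" using f by blast
      then have "x \<in> V (prod_encode (i - n, j))" using i by (simp add: V_def U_def dist_commute)
      then show "x \<in> (\<Union>i. V i)" by blast
    qed
    show "bounded (V i)" for i by (simp add: V_def U_def split: prod.split)
    show "diameter (V i) \<le> \<delta>" for i
    proof -
      obtain k j where kj: "prod_decode i = (k, j)" by fastforce
      then show ?thesis using dU[of k j] n(2)[of "k + n"] by (simp add: V_def)
    qed
  qed
  also have "\<dots> = (\<Sum>k. \<Sum>j. diam_pow t (U k j))"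
    using suminf_ennreal_2dimen[of "\<lambda>k. \<Sum>j. diam_pow t (U k j)" "\<lambda>(k,j). diam_pow t (U k j)"]
    by (simp add: V_def case_prod_beta)
  also have "\<dots> \<le> (\<Sum>k. ennreal (a (k + n)))"
  proof (intro suminf_le)
    fix k
    have 1: "diam_pow t (U k j) \<le> ennreal ((2 * r (k + n)) powr t)" for j
      using dU[of k j] \<open>t > 0\<close> by (auto simp: diam_pow_def intro!: ennreal_leI powr_mono2 diameter_ge_0 simp: U_def)
    have "(\<Sum>j. diam_pow t (U k j)) = (\<Sum>j<card (P (k + n)). diam_pow t (U k j))"
      by (rule suminf_finite) (auto simp: U_def diam_pow_def)
    also have "\<dots> \<le> (\<Sum>j<card (P (k + n)). ennreal ((2 * r (k + n)) powr t))"
      by (intro sum_mono 1)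
    also have "\<dots> = ennreal (a (k + n))"
      by (simp add: a_def ennreal_mult ennreal_of_nat_eq_real_of_nat)
    finally show "(\<Sum>j. diam_pow t (U k j)) \<le> ennreal (a (k + n))" .
  qed auto
  also have "\<dots> = ennreal (\<Sum>k. a (k + n))"
    using summ_a a0 by (intro suminf_ennreal2) auto
  also have "\<dots> \<le> ennreal \<epsilon>" using n(1) by (intro ennreal_leI) auto
  finally show "hausdorff_premeasure t \<delta> E \<le> ennreal \<epsilon>" .
qed

section \<open>Counting lattice points\<close>

lemma card_le_fibres:
  assumes "finite S" "finite T" "\<And>s. s \<in> S \<Longrightarrow> \<phi> s \<in> T"
    and "\<And>t. t \<in> T \<Longrightarrow> card {s \<in> S. \<phi> s = t} \<le> K"
  shows "card S \<le> card T * K"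
proof -
  have "S = (\<Union>t\<in>T. {s \<in> S. \<phi> s = t})" using assms(3) by auto
  then have "card S \<le> (\<Sum>t\<in>T. card {s \<in> S. \<phi> s = t})"
    using card_UN_le[OF assms(2), of "\<lambda>t. {s \<in> S. \<phi> s = t}"] by simp
  also have "\<dots> \<le> card T * K"
    using sum_bounded_above[of T "\<lambda>t. card {s \<in> S. \<phi> s = t}" K] assms(4) by simp
  finally show ?thesis .
qed

section \<open>Discrete subgroups of a Euclidean space\<close>

definition cube :: "real \<Rightarrow> 'a::euclidean_space set" where
  "cube R = {z. \<forall>i\<in>Basis. \<bar>z \<bullet> i\<bar> \<le> R}"

locale discrete_subgroup =
  fixes L :: "'a::euclidean_space set"
  assumes zero_mem: "0 \<in> L"
    and diff_mem: "x \<in> L \<Longrightarrow> y \<in> L \<Longrightarrow> x - y \<in> L"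
    and finite_cube: "finite (L \<inter> cube R)"
begin

lemma add_mem: "x \<in> L \<Longrightarrow> y \<in> L \<Longrightarrow> x + y \<in> L"
  by (metis diff_0 diff_mem diff_minus_eq_add zero_mem)

lemma nat_mult_mem: "x \<in> L \<Longrightarrow> of_nat n *\<^sub>R x \<in> L"
  by (induction n) (auto simp: zero_mem add_mem scaleR_left_distrib)

lemma int_mult_mem: "x \<in> L \<Longrightarrow> of_int k *\<^sub>R x \<in> L"
proof (cases "k \<ge> 0")
  case True
  then show "x \<in> L \<Longrightarrow> ?thesis" using nat_mult_mem[of x "nat k"] by simp
next
  case False
  then show "x \<in> L \<Longrightarrow> ?thesis"
    using diff_mem[OF zero_mem nat_mult_mem[of x "nat (- k)"]] by simp
qed

lemma sum_mem: "(\<And>i. i \<in> I \<Longrightarrow> f i \<in> L) \<Longrightarrow> sum f I \<in> L"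
  by (induction I rule: infinite_finite_induct) (auto simp: zero_mem add_mem)

text \<open>Expand \<open>z\<close> in a basis chosen among the lattice vectors of the cube and
  round the coefficients down. The remainder is a combination of at most \<open>DIM('a)\<close>
  vectors of the cube with coefficients in [0, 1).\<close>

lemma near_lattice_point:
  fixes R :: real
  assumes full: "span (L \<inter> cube R) = UNIV" and "R \<ge> 0"
  obtains l where "l \<in> L" "z - l \<in> cube (real DIM('a) * R)"
proof -
  obtain B where B: "B \<subseteq> L \<inter> cube R" "independent B" "span B = UNIV"
    using maximal_independent_subset[of "L \<inter> cube R"] full
    by (metis span_mono span_span top.extremum_uniqueI)
  have finB: "finite B" using B(2) independent_bound by blast
  have cardB: "card B \<le> DIM('a)" using B(2) independent_bound by blast
  obtain c where c: "z = (\<Sum>v\<in>B. c v *\<^sub>R v)"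
    using span_finite[OF finB] B(3) by auto
  define l where "l = (\<Sum>v\<in>B. of_int \<lfloor>c v\<rfloor> *\<^sub>R v)"
  show ?thesis
  proof
    show "l \<in> L" unfolding l_def by (rule sum_mem) (use B(1) int_mult_mem in auto)
    have "z - l = (\<Sum>v\<in>B. frac (c v) *\<^sub>R v)"
      by (simp add: c l_def frac_def scaleR_diff_left sum_subtractf)
    moreover have "\<bar>(\<Sum>v\<in>B. frac (c v) *\<^sub>R v) \<bullet> i\<bar> \<le> real DIM('a) * R" if "i \<in> Basis" for i
    proof -
      have "\<bar>(\<Sum>v\<in>B. frac (c v) *\<^sub>R v) \<bullet> i\<bar> \<le> (\<Sum>v\<in>B. \<bar>frac (c v) * (v \<bullet> i)\<bar>)"
        by (simp add: inner_sum_left)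
      also have "\<dots> \<le> (\<Sum>v\<in>B. 1 * R)"
        using B(1) that unfolding abs_mult
        by (intro sum_mono mult_mono) (auto simp: cube_def less_imp_le[OF frac_lt_1])
      also have "\<dots> \<le> real DIM('a) * R"
        using cardB \<open>R \<ge> 0\<close> by (simp add: mult_right_mono)
      finally show ?thesis .
    qed
    ultimately show "z - l \<in> cube (real DIM('a) * R)" by (simp add: cube_def)
  qed
qed

text \<open>Lattice points in a hyperplane are determined up to a unit cube by all coordinates
  but the one in which the normal vector is largest.\<close>
lemma card_cube_hyperplane_le:
  fixes R :: real
  assumes "f \<noteq> 0" "\<And>y. y \<in> L \<inter> cube R \<Longrightarrow> f \<bullet> y = 0" and R: "R \<ge> 1"
  shows "real (card (L \<inter> cube R)) \<le> (4 * real DIM('a)) ^ DIM('a) * R ^ (DIM('a) - 1) * card (L \<inter> cube 1)"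
proof -
  let ?d = "real DIM('a)"
  have d1: "?d \<ge> 1" using DIM_positive[where 'a='a] by linarith
  obtain j :: 'a where j: "j \<in> Basis" "\<And>i. i \<in> Basis \<Longrightarrow> \<bar>f \<bullet> i\<bar> \<le> \<bar>f \<bullet> j\<bar>"
    by (rule obtains_MAX[of "Basis :: 'a set" "\<lambda>i. \<bar>f \<bullet> i\<bar>"]) (auto, metis Max_ge finite_Basis finite_imageI imageI)
  have fj: "\<bar>f \<bullet> j\<bar> > 0"
  proof (rule ccontr)
    assume "\<not> \<bar>f \<bullet> j\<bar> > 0"
    then have "f \<bullet> i = 0" if "i \<in> Basis" for i using j(2)[OF that] by simp
    then show False using assms(1) euclidean_all_zero_iff by blast
  qed
  \<comment> \<open>Cells of side \<open>1 / ?d\<close> make the other \<open>?d - 1\<close>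
    coordinates of a difference so small that the equation of the hyperplane bounds coordinate
    \<open>j\<close> by \<open>(?d - 1) / ?d\<close>, hence by 1.\<close>
  define \<phi> where "\<phi> y = (\<lambda>i\<in>Basis - {j}. \<lfloor>?d * (y \<bullet> i)\<rfloor>)" for y
  define J where "J = {\<lfloor>- (?d * R)\<rfloor>..\<lfloor>?d * R\<rfloor>}"
  have cardJ: "real (card J) \<le> 4 * ?d * R"
  proof -
    have "?d * R \<ge> 1" using d1 R using mult_mono[of 1 ?d 1 R] by simp
    then have "0 \<le> \<lfloor>?d * R\<rfloor> - \<lfloor>- (?d * R)\<rfloor> + 1" by linarith
    then have "real (card J) = of_int (\<lfloor>?d * R\<rfloor> - \<lfloor>- (?d * R)\<rfloor> + 1)"
      unfolding J_def by (subst card_atLeastAtMost_int) (simp add: of_nat_nat)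
    also have "\<dots> \<le> ?d * R + (?d * R + 1) + 1"
      unfolding of_int_add of_int_diff by linarith
    also have "\<dots> \<le> 4 * ?d * R" using \<open>?d * R \<ge> 1\<close> by linarith
    finally show ?thesis .
  qed
  have "card (L \<inter> cube R) \<le> card (PiE (Basis - {j}) (\<lambda>_. J)) * card (L \<inter> cube 1)"
  proof (rule card_le_fibres[where \<phi> = \<phi>])
    show "\<phi> y \<in> PiE (Basis - {j}) (\<lambda>_. J)" if "y \<in> L \<inter> cube R" for y
    proof -
      have "\<lfloor>?d * (y \<bullet> i)\<rfloor> \<in> J" if "i \<in> Basis" for i
      proof -
        have "- R \<le> y \<bullet> i" "y \<bullet> i \<le> R" using \<open>y \<in> L \<inter> cube R\<close> that by (auto simp: cube_def abs_le_iff)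
        then have "?d * (- R) \<le> ?d * (y \<bullet> i)" "?d * (y \<bullet> i) \<le> ?d * R"
          using d1 by (intro mult_left_mono; simp)+
        then show ?thesis unfolding J_def by (auto intro!: floor_mono)
      qed
      then show ?thesis unfolding \<phi>_def by auto
    qed
    fix g
    show "card {y \<in> L \<inter> cube R. \<phi> y = g} \<le> card (L \<inter> cube 1)"
    proof (cases "{y \<in> L \<inter> cube R. \<phi> y = g} = {}")
      case False
      then obtain z where z: "z \<in> L" "z \<in> cube R" "\<phi> z = g" by auto
      have "(\<lambda>y. y - z) ` {y \<in> L \<inter> cube R. \<phi> y = g} \<subseteq> L \<inter> cube 1"
      proof safe
        fix y assume y: "y \<in> L" "y \<in> cube R" "g = \<phi> y"
        show "y - z \<in> L" using y z diff_mem by auto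
        have small: "\<bar>(y - z) \<bullet> i\<bar> \<le> 1 / ?d" if "i \<in> Basis - {j}" for i
        proof -
          have "\<lfloor>?d * (y \<bullet> i)\<rfloor> = \<lfloor>?d * (z \<bullet> i)\<rfloor>"
            using y(3) z(3) that unfolding \<phi>_def by (metis restrict_apply')
          then have "\<bar>?d * (y \<bullet> i) - ?d * (z \<bullet> i)\<bar> \<le> 1" by linarith
          then have "?d * \<bar>(y - z) \<bullet> i\<bar> \<le> 1"
            using d1 by (simp add: inner_diff_left abs_mult flip: right_diff_distrib)
          then show ?thesis using d1 by (simp add: field_simps)
        qed
        have "f \<bullet> (y - z) = 0" using assms(2) y z by (simp add: inner_diff_right)
        then have "(\<Sum>i\<in>Basis. (f \<bullet> i) * ((y - z) \<bullet> i)) = 0"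
          by (metis euclidean_inner)
        then have "(f \<bullet> j) * ((y - z) \<bullet> j) = - (\<Sum>i\<in>Basis - {j}. (f \<bullet> i) * ((y - z) \<bullet> i))"
          using sum.remove[OF finite_Basis j(1), of "\<lambda>i. (f \<bullet> i) * ((y - z) \<bullet> i)"] by simp
        then have "\<bar>f \<bullet> j\<bar> * \<bar>(y - z) \<bullet> j\<bar> \<le> (\<Sum>i\<in>Basis - {j}. \<bar>f \<bullet> i\<bar> * \<bar>(y - z) \<bullet> i\<bar>)"
          using sum_abs[of "\<lambda>i. (f \<bullet> i) * ((y - z) \<bullet> i)" "Basis - {j}"] by (simp add: abs_mult[symmetric])
        also have "\<dots> \<le> (\<Sum>i\<in>Basis - {j}. \<bar>f \<bullet> j\<bar> * (1 / ?d))"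
          by (intro sum_mono mult_mono j(2) small) auto
        also have "\<dots> = \<bar>f \<bullet> j\<bar> * ((?d - 1) / ?d)"
          using j(1) DIM_positive[where 'a='a] by (simp add: card_Diff_singleton of_nat_diff)
        also have "\<dots> \<le> \<bar>f \<bullet> j\<bar> * 1"
          using d1 by (intro mult_left_mono) auto
        finally have "\<bar>(y - z) \<bullet> j\<bar> \<le> 1" using fj by simp
        moreover have "1 / ?d \<le> 1" using d1 by simp
        ultimately show "y - z \<in> cube 1"
          unfolding cube_def using small by (smt (verit) DiffI mem_Collect_eq singletonD)
      qed
      then show ?thesis
        by (intro card_inj_on_le[where f = "\<lambda>y. y - z"]) (auto simp: inj_on_def finite_cube)
    next
      case True
      then show ?thesis by (simp only: card.empty)
    qed
  qed (use finite_cube in \<open>auto simp: J_def intro!: finite_PiE\<close>)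
  then have "card (L \<inter> cube R) \<le> card J ^ (DIM('a) - 1) * card (L \<inter> cube 1)"
    using j(1) by (simp add: card_PiE card_Diff_singleton)
  then have "real (card (L \<inter> cube R)) \<le> real (card J) ^ (DIM('a) - 1) * card (L \<inter> cube 1)"
    by (metis of_nat_le_iff of_nat_mult of_nat_power)
  also have "\<dots> \<le> (4 * ?d * R) ^ (DIM('a) - 1) * card (L \<inter> cube 1)"
    using cardJ by (intro mult_right_mono power_mono) auto
  also have "\<dots> = (4 * ?d) ^ (DIM('a) - 1) * R ^ (DIM('a) - 1) * card (L \<inter> cube 1)"
    by (simp add: power_mult_distrib)
  also have "\<dots> \<le> (4 * ?d) ^ DIM('a) * R ^ (DIM('a) - 1) * card (L \<inter> cube 1)"
    using d1 R by (intro mult_right_mono power_increasing) (linarith | simp)+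
  finally show ?thesis by simp
qed

text \<open>The assumption on \<open>C\<close> stands in for the covolume: some translate of each
  cube is no fuller than average. If the points in the cube span, a lattice vector lies within
  \<open>?d * R\<close> of the centre of a sparse cube of radius \<open>(?d + 1) * R\<close>, and
  shifting by it moves all the points into that cube. Otherwise they lie in a hyperplane.\<close>

lemma card_cube_le:
  fixes C R :: real
  assumes C: "\<And>\<rho>. \<rho> \<ge> 1 \<Longrightarrow> \<exists>z. finite {y \<in> L. y - z \<in> cube \<rho>} \<and>
      real (card {y \<in> L. y - z \<in> cube \<rho>}) \<le> C * \<rho> ^ DIM('a)" and R: "R \<ge> 1"
  shows "real (card (L \<inter> cube R)) \<le> (4 * real DIM('a)) ^ DIM('a) * R ^ (DIM('a) - 1) * card (L \<inter> cube 1)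
     + C * (real DIM('a) + 1) ^ DIM('a) * R ^ DIM('a)"
proof -
  let ?d = "real DIM('a)"
  have "C \<ge> 0" using C[of 1] by (metis mult.right_neutral of_nat_0_le_iff order.refl order_trans power_one)
  show ?thesis
  proof (cases "span (L \<inter> cube R) = UNIV")
    case True
    define \<rho> where "\<rho> = (?d + 1) * R"
    have "\<rho> \<ge> 1" unfolding \<rho>_def using R mult_mono[of 1 "?d + 1" 1 R] by simp
    then obtain z where z: "finite {y \<in> L. y - z \<in> cube \<rho>}"
        "real (card {y \<in> L. y - z \<in> cube \<rho>}) \<le> C * \<rho> ^ DIM('a)" using C by blast
    obtain l where l: "l \<in> L" "z - l \<in> cube (?d * R)"
      using near_lattice_point[OF True] R by (metis dual_order.trans zero_le_one)
    have "card (L \<inter> cube R) \<le> card {y \<in> L. y - z \<in> cube \<rho>}"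
    proof (rule card_inj_on_le[where f = "\<lambda>y. y + l"])
      show "(\<lambda>y. y + l) ` (L \<inter> cube R) \<subseteq> {y \<in> L. y - z \<in> cube \<rho>}"
      proof safe
        fix y assume y: "y \<in> L" "y \<in> cube R"
        show "y + l \<in> L" using y l add_mem by simp
        have "\<bar>(y + l - z) \<bullet> i\<bar> \<le> \<rho>" if "i \<in> Basis" for i
        proof -
          have "\<bar>y \<bullet> i\<bar> \<le> R" "\<bar>(z - l) \<bullet> i\<bar> \<le> ?d * R" using y l that by (auto simp: cube_def)
          then show ?thesis unfolding \<rho>_def by (simp add: inner_diff_left inner_add_left algebra_simps)
        qed
        then show "y + l - z \<in> cube \<rho>" by (simp add: cube_def)
      qed
    qed (use z in auto)
    then have "real (card (L \<inter> cube R)) \<le> C * \<rho> ^ DIM('a)" using z(2) by linarith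
    also have "\<dots> = C * (?d + 1) ^ DIM('a) * R ^ DIM('a)" by (simp add: \<rho>_def power_mult_distrib)
    finally show ?thesis using R by (simp add: add_increasing)
  next
    case False
    then obtain f where f: "f \<noteq> 0" "span (L \<inter> cube R) \<subseteq> {x. f \<bullet> x = 0}"
      using span_not_univ_subset_hyperplane by blast
    then have "f \<bullet> y = 0" if "y \<in> L \<inter> cube R" for y using span_base[OF that] by auto
    from card_cube_hyperplane_le[OF f(1) this R] show ?thesis
      using \<open>C \<ge> 0\<close> R by (simp add: add_increasing2)
  qed
qed

end

section \<open>Integer points in thin boxes\<close>

definition box_pts :: "real ^ 'n \<Rightarrow> real \<Rightarrow> real \<Rightarrow> ('n \<Rightarrow> real) \<Rightarrow> (int \<times> ('n \<Rightarrow> int)) set" where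
  "box_pts x \<alpha> \<beta> w = {(q, p). \<bar>of_int q\<bar> \<le> \<alpha> \<and> (\<forall>i. \<bar>of_int q * x $ i - of_int (p i) - w i\<bar> \<le> \<beta>)}"

definition box_count :: "real ^ 'n \<Rightarrow> real \<Rightarrow> real \<Rightarrow> nat" where
  "box_count x \<alpha> \<beta> = card (box_pts x \<alpha> \<beta> (\<lambda>_. 0))"

lemma int_interval_eq: "{p::int. \<bar>c - of_int p\<bar> \<le> r} = {\<lceil>c - r\<rceil>..\<lfloor>c + r\<rfloor>}" for c r :: real
  by (auto simp: abs_le_iff ceiling_le_iff le_floor_iff; linarith)

lemma finite_int_interval: "finite {p::int. \<bar>c - of_int p\<bar> \<le> r}" for c r :: real
  by (simp add: int_interval_eq)

lemma card_int_interval_le: "r \<ge> 0 \<Longrightarrow> real (card {p::int. \<bar>c - of_int p\<bar> \<le> r}) \<le> 2 * r + 1" for c r :: real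
  unfolding int_interval_eq card_atLeastAtMost_int by (cases "\<lceil>c - r\<rceil> \<le> \<lfloor>c + r\<rfloor>") (simp_all; linarith)+

lemma box_pts_eq:
  "box_pts x \<alpha> \<beta> w = (SIGMA q:{q. \<bar>0 - of_int q\<bar> \<le> \<alpha>}. PiE UNIV (\<lambda>i. {p. \<bar>(of_int q * x $ i - w i) - of_int p\<bar> \<le> \<beta>}))"
  by (auto simp: box_pts_def PiE_def Pi_def algebra_simps)

lemma finite_box_pts [simp]: "finite (box_pts x \<alpha> \<beta> w)"
  unfolding box_pts_eq by (intro finite_SigmaI finite_PiE finite_int_interval) auto

lemma card_box_pts:
  "card (box_pts x \<alpha> \<beta> w) = (\<Sum>q | \<bar>0 - of_int q\<bar> \<le> \<alpha>. \<Prod>i\<in>UNIV. card {p::int. \<bar>(of_int q * x $ i - w i) - of_int p\<bar> \<le> \<beta>})"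
  unfolding box_pts_eq
  by (subst card_SigmaI) (auto simp: card_PiE intro!: finite_PiE finite_int_interval finite_int_interval[where c = 0, simplified])

lemma sum_card_disjoint_le:
  assumes "finite I" "finite A" "\<And>k. k \<in> I \<Longrightarrow> S k \<subseteq> A"
    and "\<And>k l. k \<in> I \<Longrightarrow> l \<in> I \<Longrightarrow> k \<noteq> l \<Longrightarrow> S k \<inter> S l = {}"
  shows "(\<Sum>k\<in>I. card (S k)) \<le> card A"
proof -
  have "(\<Sum>k\<in>I. card (S k)) = card (\<Union>k\<in>I. S k)"
    using assms by (intro card_UN_disjoint[symmetric]) (auto intro: finite_subset)
  also have "\<dots> \<le> card A" using assms by (intro card_mono) auto
  finally show ?thesis .
qed

text \<open>Averaging over a grid of \<open>n ^ CARD('n)\<close> translates with step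
  \<open>3 * r\<close>. In each coordinate the translated intervals are disjoint and lie in one
  interval of length \<open>3 * r * n\<close>, which has at most \<open>3 * r * n + 1\<close>
  integers; there are at most \<open>2 * \<alpha> + 1 \<le> 3 * \<alpha>\<close> values of
  \<open>q\<close>.\<close>

lemma sparse_translate:
  fixes x :: "real ^ 'n"
  assumes "\<alpha> \<ge> 1" "r > 0"
  shows "\<exists>w. real (card (box_pts x \<alpha> r w)) \<le> 3 * \<alpha> * (4 * r) ^ CARD('n)"
proof (rule ccontr)
  assume contra: "\<nexists>w. real (card (box_pts x \<alpha> r w)) \<le> 3 * \<alpha> * (4 * r) ^ CARD('n)"
  \<comment> \<open>With \<open>n * r \<ge> 1\<close> the bound \<open>3 * r * n + 1\<close> becomes
    \<open>4 * r * n\<close>.\<close>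
  obtain n where n: "real n \<ge> 1 / r" "n > 0"
    using real_arch_simple[of "max 1 (1 / r)"] by (metis max.boundedE not_gr_zero not_one_le_zero of_nat_0)
  have nr: "1 \<le> n * r" using n(1) assms by (simp add: field_simps)
  define W where "W k = (\<lambda>i. 3 * r * real (k i))" for k :: "'n \<Rightarrow> nat"
  define c where "c q i k = card {p::int. \<bar>(of_int q * x $ i - 3 * r * real k) - of_int p\<bar> \<le> r}"
    for q :: int and i :: 'n and k :: nat
  define I where "I = (PiE UNIV (\<lambda>_. {..<n}) :: ('n \<Rightarrow> nat) set)"
  define Q where "Q = {q::int. \<bar>0 - of_int q\<bar> \<le> \<alpha>}"
  have finQ: "finite Q" unfolding Q_def by (rule finite_int_interval)
  have finI: "finite I" unfolding I_def by (intro finite_PiE) auto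
  have cardI: "card I = n ^ CARD('n)" by (simp add: I_def card_PiE)
  have c: "real (\<Sum>k<n. c q i k) \<le> 4 * r * n" for q i
  proof -
    let ?s = "of_int q * x $ i - 3 * r * (real n - 1) / 2" and ?R = "3 * r * real n / 2"
    have "(\<Sum>k<n. c q i k) \<le> card {p::int. \<bar>?s - of_int p\<bar> \<le> ?R}"
      unfolding c_def
    proof (rule sum_card_disjoint_le)
      fix k assume "k \<in> {..<n}"
      then have "real k \<le> real n - 1" by simp
      then have "r * real k \<le> r * (real n - 1)" using assms by (intro mult_left_mono) auto
      moreover have "r * real k \<ge> 0" using assms by simp
      ultimately show "{p. \<bar>(of_int q * x $ i - 3 * r * real k) - of_int p\<bar> \<le> r} \<subseteq> {p::int. \<bar>?s - of_int p\<bar> \<le> ?R}"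
      proof (intro subsetI, unfold mem_Collect_eq)
        fix p :: int assume p: "\<bar>(of_int q * x $ i - 3 * r * real k) - of_int p\<bar> \<le> r"
        have "3 * r * (real n - 1) / 2 = 3 / 2 * (r * real n) - 3 / 2 * r" by (simp add: field_simps)
        then show "\<bar>?s - of_int p\<bar> \<le> ?R"
          using p \<open>r * real k \<ge> 0\<close> \<open>r * real k \<le> r * (real n - 1)\<close> assms
          unfolding abs_le_iff right_diff_distrib by linarith
      qed
    next
      have *: "{p::int. \<bar>(of_int q * x $ i - 3 * r * real k) - of_int p\<bar> \<le> r} \<inter>
          {p. \<bar>(of_int q * x $ i - 3 * r * real l) - of_int p\<bar> \<le> r} = {}" if "k < l" for k l
      proof -
        have "r * (real k + 1) \<le> r * real l" using that assms by (intro mult_left_mono) auto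
        then show ?thesis using assms by (auto simp: abs_le_iff algebra_simps)
      qed
      fix k l :: nat assume "k \<noteq> l"
      then show "{p::int. \<bar>(of_int q * x $ i - 3 * r * real k) - of_int p\<bar> \<le> r} \<inter>
          {p. \<bar>(of_int q * x $ i - 3 * r * real l) - of_int p\<bar> \<le> r} = {}"
        using *[of k l] *[of l k] by (cases "k < l") (auto simp: Int_commute)
    qed (rule finite_lessThan finite_int_interval)+
    then have "real (\<Sum>k<n. c q i k) \<le> 2 * ?R + 1"
      using card_int_interval_le[of ?R ?s] assms by (smt (verit) mult_nonneg_nonneg of_nat_0_le_iff of_nat_le_iff divide_nonneg_nonneg)
    then show ?thesis using nr by (simp add: algebra_simps)
  qed
  have "(\<Sum>k\<in>I. card (box_pts x \<alpha> r (W k))) = (\<Sum>k\<in>I. \<Sum>q\<in>Q. \<Prod>i\<in>UNIV. c q i (k i))"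
    by (simp add: card_box_pts W_def c_def Q_def)
  also have "\<dots> = (\<Sum>q\<in>Q. \<Sum>k\<in>I. \<Prod>i\<in>UNIV. c q i (k i))"
    by (rule sum.swap)
  \<comment> \<open>For fixed \<open>q\<close> the count is a product over the coordinates and the
    translates form a product set, so the average factorises.\<close>
  also have "\<dots> = (\<Sum>q\<in>Q. \<Prod>i\<in>UNIV. \<Sum>k<n. c q i k)"
    unfolding I_def by (intro sum.cong refl prod_sum_PiE[symmetric]) auto
  finally have "real (\<Sum>k\<in>I. card (box_pts x \<alpha> r (W k))) = (\<Sum>q\<in>Q. \<Prod>i\<in>UNIV. real (\<Sum>k<n. c q i k))"
    by (simp only: of_nat_sum of_nat_prod)
  also have "\<dots> \<le> (\<Sum>q\<in>Q. \<Prod>i\<in>(UNIV::'n set). 4 * r * n)"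
    by (intro sum_mono prod_mono) (use c in \<open>auto intro!: sum_nonneg\<close>)
  also have "\<dots> = card Q * (4 * r * n) ^ CARD('n)" by simp
  also have "\<dots> \<le> (3 * \<alpha>) * (4 * r * n) ^ CARD('n)"
    using card_int_interval_le[of \<alpha> 0] assms unfolding Q_def
    by (intro mult_right_mono) auto
  also have "\<dots> = (\<Sum>k\<in>I. 3 * \<alpha> * (4 * r) ^ CARD('n))"
    by (simp add: cardI power_mult_distrib)
  also have "\<dots> < (\<Sum>k\<in>I. real (card (box_pts x \<alpha> r (W k))))"
    using contra cardI n finI by (intro sum_strict_mono) (auto simp: not_le)
  finally show False by simp
qed

section \<open>The lattice of a vector under the diagonal flow\<close>

definition lattice_of :: "real ^ 'n \<Rightarrow> real \<Rightarrow> real \<Rightarrow> (real \<times> (real ^ 'n)) set" where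
  "lattice_of x \<alpha> \<beta> = range (\<lambda>(q::int, p::'n \<Rightarrow> int). (of_int q / \<alpha>, \<chi> i. (of_int q * x $ i - of_int (p i)) / \<beta>))"

lemma cube_prod_vec: "z \<in> cube R \<longleftrightarrow> \<bar>fst z\<bar> \<le> R \<and> (\<forall>i. \<bar>snd z $ i\<bar> \<le> R)"
  for z :: "real \<times> (real ^ 'n)"
  unfolding cube_def Basis_prod_def
  by (auto simp: Basis_vec_def cart_eq_inner_axis inner_prod_def)

lemma bij_betw_box_pts_lattice_of:
  assumes "\<alpha> > 0" "\<beta> > 0"
  shows "bij_betw (\<lambda>(q, p). (of_int q / \<alpha>, \<chi> i. (of_int q * x $ i - of_int (p i)) / \<beta>))
    (box_pts x (R * \<alpha>) (R * \<beta>) w) {y \<in> lattice_of x \<alpha> \<beta>. y - (0, \<chi> i. w i / \<beta>) \<in> cube R}"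
  unfolding bij_betw_def
proof
  show "inj_on (\<lambda>(q, p). (of_int q / \<alpha>, \<chi> i. (of_int q * x $ i - of_int (p i)) / \<beta>)) (box_pts x (R * \<alpha>) (R * \<beta>) w)"
    using assms by (auto simp: inj_on_def vec_eq_iff)
  have *: "\<bar>of_int q / \<alpha>\<bar> \<le> R \<longleftrightarrow> \<bar>of_int q\<bar> \<le> R * \<alpha>" for q :: int
    using assms by (simp add: field_simps)
  have **: "\<bar>(of_int q * x $ i - of_int (p i)) / \<beta> - w i / \<beta>\<bar> \<le> R \<longleftrightarrow>
      \<bar>of_int q * x $ i - of_int (p i) - w i\<bar> \<le> R * \<beta>" for q :: int and p :: "'a \<Rightarrow> int" and i
    using assms by (simp add: field_simps flip: diff_divide_distrib)
  show "(\<lambda>(q, p). (of_int q / \<alpha>, \<chi> i. (of_int q * x $ i - of_int (p i)) / \<beta>)) ` box_pts x (R * \<alpha>) (R * \<beta>) w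
      = {y \<in> lattice_of x \<alpha> \<beta>. y - (0, \<chi> i. w i / \<beta>) \<in> cube R}"
    unfolding lattice_of_def box_pts_def cube_prod_vec using * ** by fastforce
qed

lemma discrete_subgroup_lattice_of:
  assumes "\<alpha> > 0" "\<beta> > 0"
  shows "discrete_subgroup (lattice_of x \<alpha> \<beta>)"
proof
  show "0 \<in> lattice_of x \<alpha> \<beta>"
    unfolding lattice_of_def by (rule range_eqI[of _ _ "(0, \<lambda>_. 0)"]) (simp add: zero_prod_def vec_eq_iff)
  fix y z assume "y \<in> lattice_of x \<alpha> \<beta>" "z \<in> lattice_of x \<alpha> \<beta>"
  then obtain q p q' p' where "y = (of_int q / \<alpha>, \<chi> i. (of_int q * x $ i - of_int (p i)) / \<beta>)"
      "z = (of_int q' / \<alpha>, \<chi> i. (of_int q' * x $ i - of_int (p' i)) / \<beta>)"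
    unfolding lattice_of_def by auto
  then show "y - z \<in> lattice_of x \<alpha> \<beta>"
    unfolding lattice_of_def
    by (intro range_eqI[of _ _ "(q - q', \<lambda>i. p i - p' i)"])
       (simp add: vec_eq_iff diff_divide_distrib left_diff_distrib algebra_simps)
next
  show "finite (lattice_of x \<alpha> \<beta> \<inter> cube R)" for R
    using bij_betw_finite[OF bij_betw_box_pts_lattice_of[OF assms, of x R "\<lambda>_. 0"]]
    by (simp add: zero_prod_def[symmetric] zero_vec_def[symmetric] Int_def)
qed

text \<open>\<open>lattice_of x \<alpha> \<beta>\<close> has covolume 1 precisely because
  \<open>\<alpha> * \<beta> ^ CARD('n) = 1\<close>, so \<open>sparse_translate\<close> supplies the
  constant \<open>3 * 4 ^ m\<close> for \<open>card_cube_le\<close>, independent of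
  \<open>x\<close>, \<open>\<alpha>\<close> and \<open>\<beta>\<close>. Only the additive term grows
  at the volume rate; the term proportional to the old count grows like
  \<open>R ^ m\<close>.\<close>

lemma box_count_scale_up:
  fixes x :: "real ^ 'n"
  assumes "\<alpha> \<ge> 1" "\<beta> > 0" "\<alpha> * \<beta> ^ CARD('n) = 1" "R \<ge> 1"
  defines "m \<equiv> CARD('n)"
  shows "real (box_count x (R * \<alpha>) (R * \<beta>)) \<le> (4 * (real m + 1)) ^ (m + 1) * R ^ m * box_count x \<alpha> \<beta>
    + 3 * 4 ^ m * (real m + 2) ^ (m + 1) * R ^ (m + 1)"
proof -
  have "\<alpha> > 0" using assms by simp
  interpret discrete_subgroup "lattice_of x \<alpha> \<beta>"
    by (rule discrete_subgroup_lattice_of) fact+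
  have dim: "DIM(real \<times> (real ^ 'n)) = m + 1" by (simp add: m_def)
  have count: "card (lattice_of x \<alpha> \<beta> \<inter> cube \<rho>) = box_count x (\<rho> * \<alpha>) (\<rho> * \<beta>)" for \<rho>
    using bij_betw_same_card[OF bij_betw_box_pts_lattice_of[OF \<open>\<alpha> > 0\<close> \<open>\<beta> > 0\<close>, of x \<rho> "\<lambda>_. 0"]]
    by (simp add: box_count_def zero_prod_def[symmetric] zero_vec_def[symmetric] Int_def)
  have "\<exists>z. finite {y \<in> lattice_of x \<alpha> \<beta>. y - z \<in> cube \<rho>} \<and>
      real (card {y \<in> lattice_of x \<alpha> \<beta>. y - z \<in> cube \<rho>}) \<le> (3 * 4 ^ m) * \<rho> ^ DIM(real \<times> (real ^ 'n))"
    if \<rho>: "\<rho> \<ge> 1" for \<rho>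
  proof -
    have "\<rho> * \<alpha> \<ge> 1" using \<rho> assms(1) mult_mono[of 1 \<rho> 1 \<alpha>] by simp
    then obtain w where w: "real (card (box_pts x (\<rho> * \<alpha>) (\<rho> * \<beta>) w)) \<le> 3 * (\<rho> * \<alpha>) * (4 * (\<rho> * \<beta>)) ^ m"
      using sparse_translate[of "\<rho> * \<alpha>" "\<rho> * \<beta>" x] \<rho> \<open>\<beta> > 0\<close> unfolding m_def by auto
    also have "\<dots> = 3 * 4 ^ m * \<rho> ^ (m + 1) * (\<alpha> * \<beta> ^ m)"
      by (simp add: power_mult_distrib)
    also have "\<dots> = 3 * 4 ^ m * \<rho> ^ (m + 1)" using assms(3) by (simp add: m_def)
    finally show ?thesis
      using bij_betw_same_card[OF bij_betw_box_pts_lattice_of[OF \<open>\<alpha> > 0\<close> \<open>\<beta> > 0\<close>, of x \<rho> w]]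
        bij_betw_finite[OF bij_betw_box_pts_lattice_of[OF \<open>\<alpha> > 0\<close> \<open>\<beta> > 0\<close>, of x \<rho> w]] unfolding dim by auto
  qed
  from card_cube_le[OF this \<open>R \<ge> 1\<close>] show ?thesis
    unfolding dim count by (simp add: algebra_simps)
qed

text \<open>Let \<open>v\<close> be the point of the small box with the largest
  \<open>\<bar>q\<bar>\<close>. The translates of the small set by \<open>3 * j\<close> times
  \<open>v\<close>, for \<open>3 * j < K\<close>, stay in the large box and are disjoint, since
  within one copy the values of \<open>q\<close> differ by at most twice that of \<open>v\<close>.
  If all points have \<open>q = 0\<close>, only the origin is left because
  \<open>\<beta> / K < 1\<close>; this is the summand \<open>K\<close>.\<close>

lemma box_count_scale_down:
  fixes x :: "real ^ 'n"
  assumes "\<beta> > 0" "K > 0" "\<beta> / real K < 1"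
  shows "K * box_count x (\<alpha> / K) (\<beta> / K) \<le> 3 * box_count x \<alpha> \<beta> + K"
proof (cases "\<exists>q p. (q, p) \<in> box_pts x (\<alpha> / K) (\<beta> / K) (\<lambda>_. 0) \<and> q \<noteq> 0")
  case False
  have "box_pts x (\<alpha> / K) (\<beta> / K) (\<lambda>_. 0) \<subseteq> {(0, \<lambda>_. 0)}"
  proof
    fix z assume z: "z \<in> box_pts x (\<alpha> / K) (\<beta> / K) (\<lambda>_. 0)"
    then obtain p where p: "z = (0, p)" using False by (cases z) auto
    have "p i = 0" for i
    proof -
      have "\<bar>of_int (p i)\<bar> \<le> \<beta> / K" using z p by (simp add: box_pts_def)
      then show ?thesis using assms(3) by linarith
    qed
    then show "z \<in> {(0, \<lambda>_. 0)}" using p by auto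
  qed
  then have "box_count x (\<alpha> / K) (\<beta> / K) \<le> 1"
    unfolding box_count_def by (metis card_mono card_1_singleton_iff finite.emptyI finite.insertI One_nat_def is_singleton_altdef is_singletonI)
  then show ?thesis by (simp add: trans_le_add2)
next
  case True
  define S where "S = box_pts x (\<alpha> / K) (\<beta> / K) (\<lambda>_. 0)"
  have finS: "finite S" by (simp add: S_def)
  obtain v where v: "v \<in> S" "\<And>s. s \<in> S \<Longrightarrow> \<bar>fst s\<bar> \<le> \<bar>fst v\<bar>" 
  proof -
    have "S \<noteq> {}" using True by (auto simp: S_def)
    then show ?thesis
      by (rule obtains_MAX[OF finS, of "\<lambda>s. \<bar>fst s\<bar>"]) (metis that Max_ge finS finite_imageI imageI)
  qed
  obtain a p where ap: "v = (a, p)" by fastforce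
  have a0: "a \<noteq> 0" using True v(2) ap by (force simp: S_def)
  define tr where "tr j s = (int (3 * j) * a + fst s, \<lambda>i. int (3 * j) * p i + snd s i)" for j :: nat and s :: "int \<times> ('n \<Rightarrow> int)"
  define J where "J = {j::nat. 3 * j < K}"
  \<comment> \<open>The bound is \<open>K / 3\<close> rounded up, so that
    \<open>K \<le> 3 * card J\<close>.\<close>
  have J: "J = {..<(K + 2) div 3}" by (auto simp: J_def)
  have "(\<Sum>j\<in>J. card (tr j ` S)) \<le> box_count x \<alpha> \<beta>"
    unfolding box_count_def
  proof (rule sum_card_disjoint_le)
    fix j assume "j \<in> J"
    then have jK: "real (3 * j) + 1 \<le> K" by (simp add: J_def)
    show "tr j ` S \<subseteq> box_pts x \<alpha> \<beta> (\<lambda>_. 0)"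
    proof (rule image_subsetI)
      fix t assume "t \<in> S"
      then obtain b r where s: "(b, r) \<in> S" and t: "t = (b, r)" by (cases t) auto
      have vb: "\<bar>of_int a\<bar> \<le> \<alpha> / K" "\<bar>of_int b\<bar> \<le> \<alpha> / K"
         "\<bar>of_int a * x $ i - of_int (p i)\<bar> \<le> \<beta> / K" "\<bar>of_int b * x $ i - of_int (r i)\<bar> \<le> \<beta> / K" for i
        using s v(1) ap by (auto simp: S_def box_pts_def)
      have gen: "\<bar>real (3 * j) * u + u'\<bar> \<le> c" if "\<bar>u\<bar> \<le> c / K" "\<bar>u'\<bar> \<le> c / K" for u u' c :: real
      proof -
        have c0: "0 \<le> c / K" using that(1) by linarith
        have "\<bar>real (3 * j) * u + u'\<bar> \<le> real (3 * j) * \<bar>u\<bar> + \<bar>u'\<bar>"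
          by (metis abs_mult abs_of_nat abs_triangle_ineq)
        also have "\<dots> \<le> real (3 * j) * (c / K) + c / K"
          using that by (intro add_mono mult_left_mono) auto
        also have "\<dots> = (real (3 * j) + 1) * (c / K)" by (simp add: algebra_simps)
        also have "\<dots> \<le> K * (c / K)" using jK c0 by (intro mult_right_mono) auto
        finally show ?thesis using assms(2) by simp
      qed
      show "tr j t \<in> box_pts x \<alpha> \<beta> (\<lambda>_. 0)"
        using gen[OF vb(1,2)] gen[OF vb(3,4)] t
        by (auto simp: tr_def box_pts_def algebra_simps)
    qed
  next
    have *: "tr j ` S \<inter> tr l ` S = {}" if "j < l" for j l
    proof -
      have "tr j s \<noteq> tr l t" if "s \<in> S" "t \<in> S" for s t
      proof
        assume "tr j s = tr l t"
        then have "int (3 * j) * a + fst s = int (3 * l) * a + fst t" by (simp add: tr_def)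
        then have "(3 * int (l - j)) * a = fst s - fst t"
          using \<open>j < l\<close> by (simp add: algebra_simps of_nat_diff)
        then have "(3 * int (l - j)) * \<bar>a\<bar> = \<bar>fst s - fst t\<bar>"
          by (metis abs_mult abs_of_nonneg of_nat_0_le_iff mult_nonneg_nonneg zero_le_numeral)
        also have "\<dots> \<le> 2 * \<bar>a\<bar>" using v(2)[OF that(1)] v(2)[OF that(2)] ap by simp
        finally have "(3 * int (l - j)) * \<bar>a\<bar> \<le> 2 * \<bar>a\<bar>" .
        then have "3 * int (l - j) \<le> 2" using a0 by simp
        then show False using \<open>j < l\<close> by simp
      qed
      then show ?thesis by blast
    qed
    fix j l :: nat assume "j \<noteq> l"
    then show "tr j ` S \<inter> tr l ` S = {}"
      using *[of j l] *[of l j] by (cases "j < l") auto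
  qed (auto simp: J)
  moreover have "card (tr j ` S) = card S" for j
    by (rule card_image) (auto simp: inj_on_def tr_def fun_eq_iff prod_eq_iff)
  ultimately have "card J * card S \<le> box_count x \<alpha> \<beta>" by simp
  moreover have "K * card S \<le> 3 * card J * card S" unfolding J by (intro mult_le_mono1) simp
  moreover have "3 * card J * card S = 3 * (card J * card S)" by simp
  ultimately have "K * card S \<le> 3 * box_count x \<alpha> \<beta>" by linarith
  then show ?thesis by (simp add: S_def box_count_def)
qed

section \<open>Contraction of the counting function\<close>

lemma double_counting_le:
  fixes M :: real
  assumes "finite I" "finite T" "\<And>i. i \<in> I \<Longrightarrow> S i \<subseteq> T"
    and "\<And>z. z \<in> T \<Longrightarrow> real (card {i \<in> I. z \<in> S i}) \<le> M"
  shows "(\<Sum>i\<in>I. real (card (S i))) \<le> card T * M"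
proof -
  have "(\<Sum>i\<in>I. real (card (S i))) = (\<Sum>i\<in>I. \<Sum>z\<in>T. of_bool (z \<in> S i))"
    using assms(2,3) by (intro sum.cong) (auto simp: of_bool_def sum.If_cases Int_absorb1)
  also have "\<dots> = (\<Sum>z\<in>T. \<Sum>i\<in>I. of_bool (z \<in> S i))" by (rule sum.swap)
  also have "\<dots> = (\<Sum>z\<in>T. real (card {i \<in> I. z \<in> S i}))"
    using assms(1) by (intro sum.cong) (auto simp: of_bool_def sum.If_cases Int_def)
  also have "\<dots> \<le> card T * M" using assms(4) by (rule sum_bounded_above)
  finally show ?thesis .
qed

lemma card_nat_progression_le:
  fixes c h r s :: real
  assumes "h > 0" "r \<ge> 0" "\<bar>s\<bar> = 1"
  shows "finite {k::nat. \<bar>c + s * (h * real k)\<bar> \<le> r} \<and> real (card {k::nat. \<bar>c + s * (h * real k)\<bar> \<le> r}) \<le> 2 * (r / h) + 1"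
proof -
  have "int ` {k::nat. \<bar>c + s * (h * real k)\<bar> \<le> r} \<subseteq> {p::int. \<bar>(- s * c / h) - of_int p\<bar> \<le> r / h}"
  proof safe
    fix k :: nat assume k: "\<bar>c + s * (h * real k)\<bar> \<le> r"
    have ss: "s * s = 1" using assms(3) by (metis abs_mult_self_eq mult_1)
    have "s * (c + s * (h * real k)) = s * c + (s * s) * (h * real k)"
      by (simp add: distrib_left)
    then have e2: "s * c + h * real k = s * (c + s * (h * real k))" by (simp add: ss)
    have "\<bar>(- s * c / h) - real k\<bar> * h = \<bar>((- s * c / h) - real k) * h\<bar>"
      using assms(1) by (simp add: abs_mult)
    also have "((- s * c / h) - real k) * h = - (s * c + h * real k)"
      using assms(1) by (simp add: left_diff_distrib)
    also have "\<bar>- (s * c + h * real k)\<bar> = \<bar>s\<bar> * \<bar>c + s * (h * real k)\<bar>"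
      unfolding e2 abs_minus_cancel abs_mult ..
    also have "\<dots> \<le> r" using k assms(3) by simp
    finally have "\<bar>(- s * c / h) - real k\<bar> \<le> r / h" using assms by (simp add: pos_le_divide_eq)
    then show "\<bar>(- s * c / h) - of_int (int k)\<bar> \<le> r / h" by simp
  qed
  note sub = this
  have "finite (int ` {k::nat. \<bar>c + s * (h * real k)\<bar> \<le> r})"
    by (rule finite_subset[OF sub finite_int_interval])
  moreover have "card (int ` {k::nat. \<bar>c + s * (h * real k)\<bar> \<le> r}) \<le> card {p::int. \<bar>(- s * c / h) - of_int p\<bar> \<le> r / h}"
    by (rule card_mono[OF finite_int_interval sub])
  ultimately show ?thesis
    using card_int_interval_le[of "r / h" "- s * c / h"] assms
    by (simp add: card_image finite_image_iff)
qed

text \<open>With \<open>growth_const\<close>, the two dimensional constants of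
  \<open>box_count_scale_up\<close>.\<close>

definition growth_coeff :: "nat \<Rightarrow> real" where
  "growth_coeff m = (4 * (real m + 1)) ^ (m + 1)"

definition growth_const :: "nat \<Rightarrow> real" where
  "growth_const m = 3 * 4 ^ m * (real m + 2) ^ (m + 1)"

text \<open>One step of the flow sends \<open>\<alpha>\<close> to
  \<open>e ^ (2 * m) * \<alpha>\<close> and \<open>\<beta>\<close> to
  \<open>\<beta> / e\<^sup>2\<close>, which keeps \<open>\<alpha> * \<beta> ^ m = 1\<close>. The
  cell at \<open>x\<close> has side \<open>\<beta> / \<alpha>\<close>, the amount by which
  \<open>x\<close> may move before \<open>q * x\<close> with \<open>q\<close> up to
  \<open>\<alpha>\<close> moves by \<open>\<beta>\<close>; this side shrinks by
  \<open>D = e ^ (2 * m + 2)\<close>. The choice \<open>e = 2 * K\<close> serves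
  \<open>\<beta> / e\<^sup>2 + \<beta> / e \<le> \<beta> / K\<close>.\<close>

locale contraction_step =
  fixes x :: "real ^ 'n" and \<alpha> \<beta> :: real and K m e D :: nat
  assumes \<alpha>: "\<alpha> \<ge> 1" and \<beta>: "\<beta> > 0" and unimodular: "\<alpha> * \<beta> ^ CARD('n) = 1" and K: "K \<ge> 2"
  defines "m \<equiv> CARD('n)" and "e \<equiv> 2 * K" and "D \<equiv> e ^ (2 * m + 2)"
begin

definition child :: "('n \<Rightarrow> nat) \<Rightarrow> real ^ 'n" where
  "child i = (\<chi> j. x $ j + real (i j) * (\<beta> / \<alpha> / D))"

definition children :: "('n \<Rightarrow> nat) set" where
  "children = PiE UNIV (\<lambda>_. {..<D})"

text \<open>Integer pairs are collected rather than lattice vectors, so that the points of different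
  children live in one set and can be counted doubly.\<close>

definition pts :: "('n \<Rightarrow> nat) \<Rightarrow> (int \<times> ('n \<Rightarrow> int)) set" where
  "pts i = box_pts (child i) (e ^ (2 * m) * \<alpha>) (\<beta> / e\<^sup>2) (\<lambda>_. 0)"

lemma finite_children: "finite children" and card_children: "card children = D ^ m"
  by (auto simp: children_def m_def card_PiE intro: finite_PiE)

lemma e_pos: "real e \<ge> 4" and D_pos: "D > 0" using K by (auto simp: e_def D_def)

lemma \<beta>_le_1: "\<beta> \<le> 1"
proof (rule ccontr)
  assume "\<not> \<beta> \<le> 1"
  then have "\<beta> ^ CARD('n) > 1" by (intro one_less_power) auto
  then have "1 * 1 < \<alpha> * \<beta> ^ CARD('n)" using \<alpha> by (intro mult_le_less_imp_less) auto
  then show False using unimodular by simp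
qed

text \<open>A child's corner differs from \<open>x\<close> by less than
  \<open>\<beta> / \<alpha>\<close> in each coordinate, so passing back to \<open>x\<close> costs at
  most \<open>\<beta> * R\<close>.\<close>

lemma pts_bound:
  assumes i: "i \<in> children" and z: "(q, p) \<in> pts i" and q: "\<bar>of_int q\<bar> \<le> \<alpha> * R"
  shows "\<bar>of_int q * x $ j - of_int (p j)\<bar> \<le> \<beta> / e\<^sup>2 + \<beta> * R"
proof -
  have "i j < D" using i by (auto simp: children_def PiE_def)
  have "\<bar>of_int q * child i $ j - of_int (p j)\<bar> \<le> \<beta> / e\<^sup>2"
    using z by (simp add: pts_def box_pts_def)
  moreover have "\<bar>of_int q * (real (i j) * (\<beta> / \<alpha> / D))\<bar> \<le> \<beta> * R"
  proof -
    have "0 \<le> \<alpha> * R" using q by linarith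
    then have "R \<ge> 0" using \<alpha> by (simp add: zero_le_mult_iff)
    have "\<bar>of_int q * (real (i j) * (\<beta> / \<alpha> / D))\<bar> = \<bar>of_int q\<bar> * (\<beta> / \<alpha>) * (real (i j) / D)"
      using \<alpha> \<beta> by (simp add: abs_mult)
    also have "\<dots> \<le> (\<alpha> * R) * (\<beta> / \<alpha>) * 1"
      using \<alpha> \<beta> q \<open>i j < D\<close> \<open>R \<ge> 0\<close> by (intro mult_mono) auto
    also have "\<dots> = \<beta> * R" using \<alpha> by simp
    finally show ?thesis .
  qed
  moreover have "of_int q * child i $ j - of_int (p j) =
      (of_int q * x $ j - of_int (p j)) + of_int q * (real (i j) * (\<beta> / \<alpha> / D))"
    unfolding child_def vec_lambda_beta distrib_left by simp
  ultimately show ?thesis by linarith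
qed

text \<open>For \<open>q\<close> this small, \<open>q * x\<close> barely moves from child to child
  and averaging gains nothing. All such points lie in the parent's box shrunk by \<open>K\<close>,
  and the gain comes from \<open>box_count_scale_down\<close>.\<close>

lemma small_sum:
  "(\<Sum>i\<in>children. real (card (pts i \<inter> {z. \<bar>of_int (fst z)\<bar> \<le> \<alpha> / e}))) \<le> real D ^ m * (3 / K * box_count x \<alpha> \<beta> + 1)"
proof -
  have "(\<Sum>i\<in>children. real (card (pts i \<inter> {z. \<bar>of_int (fst z)\<bar> \<le> \<alpha> / e})))
      \<le> card (box_pts x (\<alpha> / K) (\<beta> / K) (\<lambda>_. 0)) * real (D ^ m)"
  proof (rule double_counting_le[OF finite_children])
    fix i assume i: "i \<in> children"
    show "pts i \<inter> {z. \<bar>of_int (fst z)\<bar> \<le> \<alpha> / e} \<subseteq> box_pts x (\<alpha> / K) (\<beta> / K) (\<lambda>_. 0)"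
    proof
      fix z assume z: "z \<in> pts i \<inter> {z. \<bar>of_int (fst z)\<bar> \<le> \<alpha> / e}"
      obtain q p where qp: "z = (q, p)" by fastforce
      have le: "\<alpha> / e \<le> \<alpha> / K" using \<alpha> K by (intro divide_left_mono) (auto simp: e_def)
      have "\<beta> / e\<^sup>2 \<le> \<beta> / e" using \<beta> K by (intro divide_left_mono) (auto simp: e_def power2_eq_square)
      moreover have "\<beta> / e + \<beta> / e = \<beta> / K" by (simp add: e_def)
      ultimately have le': "\<beta> / e\<^sup>2 + \<beta> * (1 / e) \<le> \<beta> / K" by simp
      have "\<bar>of_int q * x $ j - of_int (p j)\<bar> \<le> \<beta> / K" for j
        using pts_bound[OF i, of q p "1 / e" j] z qp le' by auto
      then show "z \<in> box_pts x (\<alpha> / K) (\<beta> / K) (\<lambda>_. 0)"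
        using z qp le by (auto simp: box_pts_def)
    qed
  next
    fix z
    have "card {i \<in> children. z \<in> pts i \<inter> {z. \<bar>of_int (fst z)\<bar> \<le> \<alpha> / e}} \<le> card children"
      by (intro card_mono finite_children) auto
    then show "real (card {i \<in> children. z \<in> pts i \<inter> {z. \<bar>of_int (fst z)\<bar> \<le> \<alpha> / e}}) \<le> real (D ^ m)"
      by (simp add: card_children del: of_nat_power)
  qed simp
  also have "\<dots> = real D ^ m * box_count x (\<alpha> / K) (\<beta> / K)" by (simp add: box_count_def)
  also have "\<dots> \<le> real D ^ m * (3 / K * box_count x \<alpha> \<beta> + 1)"
  proof (intro mult_left_mono)
    have "\<beta> / K < 1" using \<beta>_le_1 \<beta> K by (simp add: field_simps)
    then have "real (K * box_count x (\<alpha> / K) (\<beta> / K)) \<le> real (3 * box_count x \<alpha> \<beta> + K)"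
      using box_count_scale_down[OF \<beta>, of K x \<alpha>] K by (simp only: of_nat_le_iff)
    then show "box_count x (\<alpha> / K) (\<beta> / K) \<le> 3 / K * box_count x \<alpha> \<beta> + 1"
      using K by (simp add: field_simps)
  qed simp
  finally show ?thesis .
qed

text \<open>The division by \<open>e\<close> replaces the exponent \<open>l - 1\<close>, so that
  \<open>l = 0\<close> is the layer just above the small points.\<close>

definition layer :: "nat \<Rightarrow> (int \<times> ('n \<Rightarrow> int)) set" where
  "layer l = {z. \<alpha> * e ^ l / e < \<bar>of_int (fst z)\<bar> \<and> \<bar>of_int (fst z)\<bar> \<le> \<alpha> * e ^ l}"

text \<open>As a child's index in direction \<open>j\<close> runs, \<open>q\<close> times that
  coordinate runs through a progression of step \<open>h\<close>, at least
  \<open>\<beta> * e ^ l / (e * D)\<close>, and has to hit an interval of half-length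
  \<open>\<beta> / e\<^sup>2\<close>. That leaves at most \<open>2 * D / e ^ (l + 1) + 1\<close>
  indices, independently in each direction.\<close>

lemma children_hitting_le:
  assumes l: "l \<le> 2 * m" and z: "z \<in> layer l"
  shows "real (card {i \<in> children. z \<in> pts i}) \<le> (3 * D / e ^ (l + 1)) ^ m"
proof -
  obtain q p where qp: "z = (q, p)" by fastforce
  \<comment> \<open>The sign of \<open>q\<close> is split off because the progression is indexed by
    naturals and needs a positive step.\<close>
  define s :: real where "s = sgn (of_int q)"
  define h where "h = \<bar>of_int q\<bar> * (\<beta> / \<alpha> / D)"
  have el: "\<alpha> * e ^ l / e > 0" using \<alpha> e_pos by simp
  have q: "\<alpha> * e ^ l / e < \<bar>of_int q\<bar>" using z qp by (simp add: layer_def)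
  then have "of_int q \<noteq> (0::real)" using el by auto
  then have s: "\<bar>s\<bar> = 1" by (simp add: s_def abs_sgn_eq)
  have h: "h > 0" using \<open>of_int q \<noteq> (0::real)\<close> \<alpha> \<beta> D_pos by (simp add: h_def)
  define N where "N j = {k::nat. \<bar>(of_int q * x $ j - of_int (p j)) + s * (h * real k)\<bar> \<le> \<beta> / e\<^sup>2}" for j
  have sq: "s * \<bar>of_int q\<bar> = of_int q" by (simp add: s_def sgn_mult_abs)
  have sub: "{i \<in> children. z \<in> pts i} \<subseteq> PiE UNIV N"
  proof
    fix i assume "i \<in> {i \<in> children. z \<in> pts i}"
    then have "\<bar>of_int q * child i $ j - of_int (p j)\<bar> \<le> \<beta> / e\<^sup>2" for j
      by (simp add: qp pts_def box_pts_def)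
    moreover have "of_int q * child i $ j - of_int (p j) = (of_int q * x $ j - of_int (p j)) + s * (h * real (i j))" for j
    proof -
      have "s * (h * real (i j)) = (s * \<bar>of_int q\<bar>) * (real (i j) * (\<beta> / \<alpha> / D))" by (simp add: h_def)
      then show ?thesis by (simp add: sq child_def distrib_left)
    qed
    ultimately show "i \<in> PiE UNIV N" by (simp add: N_def PiE_def)
  qed
  have N: "finite (N j)" "real (card (N j)) \<le> 3 * D / e ^ (l + 1)" for j
  proof -
    have N0: "finite (N j)" "real (card (N j)) \<le> 2 * (\<beta> / e\<^sup>2 / h) + 1"
      using card_nat_progression_le[OF h _ s, of "\<beta> / e\<^sup>2" "of_int q * x $ j - of_int (p j)"] \<beta>
      unfolding N_def by auto
    show "finite (N j)" by (rule N0)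
    have "\<beta> / e\<^sup>2 / h = \<alpha> * D / (e\<^sup>2 * \<bar>of_int q\<bar>)"
      using \<alpha> \<beta> D_pos \<open>of_int q \<noteq> (0::real)\<close> by (simp add: h_def field_simps)
    also have "\<dots> \<le> \<alpha> * D / (e\<^sup>2 * (\<alpha> * e ^ l / e))"
    proof -
      have a: "real (e\<^sup>2) * (\<alpha> * e ^ l / e) \<le> real (e\<^sup>2) * \<bar>of_int q\<bar>"
        using q by (intro mult_left_mono) auto
      have b: "0 < real (e\<^sup>2) * \<bar>of_int q\<bar> * (real (e\<^sup>2) * (\<alpha> * e ^ l / e))"
        using el e_pos q by (intro mult_pos_pos) auto
      show ?thesis using divide_left_mono[OF a _ b, of "\<alpha> * D"] \<alpha> by simp
    qed
    also have "\<dots> = D / e ^ (l + 1)"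
      using \<alpha> e_pos by (simp add: field_simps power2_eq_square)
    finally have "real (card (N j)) \<le> 2 * (D / e ^ (l + 1)) + 1" using N0(2) by linarith
    \<comment> \<open>Since \<open>l + 1 \<le> 2 * m + 1\<close>, the exponent in \<open>D\<close>
      is large enough to absorb the summand 1.\<close>
    moreover have "real e ^ (l + 1) \<le> real D"
      unfolding D_def of_nat_power using l e_pos by (intro power_increasing) auto
    then have "1 \<le> real D / real (e ^ (l + 1))" using e_pos by simp
    ultimately have "real (card (N j)) \<le> 3 * (D / e ^ (l + 1))" by linarith
    then show "real (card (N j)) \<le> 3 * D / e ^ (l + 1)" by simp
  qed
  have "card {i \<in> children. z \<in> pts i} \<le> card (PiE UNIV N)"
    by (rule card_mono[OF _ sub]) (use N in \<open>auto intro: finite_PiE\<close>)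
  also have "\<dots> = (\<Prod>j\<in>UNIV. card (N j))" by (simp add: card_PiE)
  finally have "real (card {i \<in> children. z \<in> pts i}) \<le> (\<Prod>j\<in>UNIV. real (card (N j)))"
    by (simp only: of_nat_le_iff flip: of_nat_prod)
  also have "\<dots> \<le> (\<Prod>j\<in>(UNIV::'n set). 3 * D / e ^ (l + 1))"
    by (intro prod_mono) (use N in auto)
  finally show ?thesis by (simp add: m_def)
qed

text \<open>Enlarging the parent's box by \<open>2 * e ^ l\<close> multiplies the count by
  \<open>(2 * e ^ l) ^ m\<close> up to constants, and each point is hit by a fraction
  \<open>(3 / e ^ (l + 1)) ^ m\<close> of the children. The powers of \<open>e ^ l\<close> cancel
  and \<open>(6 / e) ^ m\<close> remains. The additive term keeps one factor \<open>e ^ l\<close>,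
  harmless as \<open>l \<le> 2 * m\<close>.\<close>

lemma layer_sum:
  assumes l: "l \<le> 2 * m"
  shows "(\<Sum>i\<in>children. real (card (pts i \<inter> layer l))) \<le>
    real D ^ m * (6 ^ m * growth_coeff m / e ^ m * box_count x \<alpha> \<beta> + 2 * 6 ^ m * growth_const m * e ^ m)"
proof -
  have el: "real e ^ l \<ge> 1" using e_pos by (intro one_le_power) auto
  have "(\<Sum>i\<in>children. real (card (pts i \<inter> layer l)))
      \<le> card (box_pts x (2 * e ^ l * \<alpha>) (2 * e ^ l * \<beta>) (\<lambda>_. 0) \<inter> layer l) * (3 * D / e ^ (l + 1)) ^ m"
  proof (rule double_counting_le[OF finite_children])
    fix i assume i: "i \<in> children"
    show "pts i \<inter> layer l \<subseteq> box_pts x (2 * e ^ l * \<alpha>) (2 * e ^ l * \<beta>) (\<lambda>_. 0) \<inter> layer l"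
    proof
      fix z assume z: "z \<in> pts i \<inter> layer l"
      obtain q p where qp: "z = (q, p)" by fastforce
      have q: "\<bar>of_int q\<bar> \<le> \<alpha> * e ^ l" using z qp by (simp add: layer_def)
      have "\<beta> / e\<^sup>2 \<le> \<beta> / 1" using \<beta> e_pos by (intro divide_left_mono) (auto simp: one_le_power)
      also have "\<dots> \<le> \<beta> * real e ^ l" using \<beta> el by simp
      finally have "\<bar>of_int q * x $ j - of_int (p j)\<bar> \<le> 2 * e ^ l * \<beta>" for j
        using pts_bound[OF i _ q, of p j] z qp by (simp add: mult.commute)
      moreover have "\<bar>of_int q\<bar> \<le> 2 * e ^ l * \<alpha>"
      proof -
        have "0 \<le> \<alpha> * real e ^ l" using \<alpha> by simp
        then have "\<bar>of_int q\<bar> \<le> 2 * (\<alpha> * real e ^ l)" using q by simp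
        then show ?thesis by (simp add: mult_ac)
      qed
      ultimately show "z \<in> box_pts x (2 * e ^ l * \<alpha>) (2 * e ^ l * \<beta>) (\<lambda>_. 0) \<inter> layer l"
        using z qp by (auto simp: box_pts_def)
    qed
  next
    fix z assume z: "z \<in> box_pts x (2 * e ^ l * \<alpha>) (2 * e ^ l * \<beta>) (\<lambda>_. 0) \<inter> layer l"
    then have "{i \<in> children. z \<in> pts i \<inter> layer l} = {i \<in> children. z \<in> pts i}" by auto
    then show "real (card {i \<in> children. z \<in> pts i \<inter> layer l}) \<le> (3 * D / e ^ (l + 1)) ^ m"
      using children_hitting_le[OF l] z by auto
  qed simp
  also have "\<dots> \<le> box_count x (2 * e ^ l * \<alpha>) (2 * e ^ l * \<beta>) * (3 * D / e ^ (l + 1)) ^ m"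
    unfolding box_count_def by (intro mult_right_mono) (auto intro!: card_mono)
  also have "\<dots> \<le> (growth_coeff m * (2 * e ^ l) ^ m * box_count x \<alpha> \<beta> + growth_const m * (2 * e ^ l) ^ (m + 1)) * (3 * D / e ^ (l + 1)) ^ m"
    using box_count_scale_up[OF \<alpha> \<beta> unimodular, of "2 * e ^ l" x] el
    unfolding growth_coeff_def growth_const_def m_def by (intro mult_right_mono) (auto simp: mult.assoc)
  also have "\<dots> = real D ^ m * (6 ^ m * growth_coeff m / e ^ m * box_count x \<alpha> \<beta> + 2 * 6 ^ m * growth_const m * (real e ^ l / e ^ m))"
  proof -
    have eq: "(3 * real D / real e ^ (l + 1)) ^ m = real D ^ m * (3 ^ m / (real e ^ m * real e ^ (l * m)))"
      by (simp add: power_divide power_mult_distrib power_mult)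
    have eq': "(2 * real e ^ l) ^ m * (3 ^ m / (real e ^ m * real e ^ (l * m))) = 6 ^ m / real e ^ m"
      using e_pos by (simp add: power_mult_distrib power_mult[symmetric] flip: power_mult_distrib[of 2 3])
    have gen: "(c1 * Y * F + c2 * (Y * Z)) * (d * A) = d * ((c1 * F + c2 * Z) * (Y * A))" for c1 c2 d A F Y Z :: real
      by (simp add: algebra_simps)
    show ?thesis
      unfolding of_nat_mult of_nat_numeral of_nat_power eq power_add[of _ m 1] power_one_right gen eq' by (simp add: algebra_simps)
  qed
  also have "\<dots> \<le> real D ^ m * (6 ^ m * growth_coeff m / e ^ m * box_count x \<alpha> \<beta> + 2 * 6 ^ m * growth_const m * e ^ m)"
  proof (intro mult_left_mono add_left_mono)
    have "real e ^ l \<le> real e ^ (m + m)" using l e_pos by (intro power_increasing) auto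
    then show "real e ^ l / e ^ m \<le> real (e ^ m)" using e_pos by (simp add: field_simps power_add)
  qed (auto simp: growth_const_def)
  finally show ?thesis .
qed

lemma contraction:
  "(\<Sum>i\<in>children. real (box_count (child i) (e ^ (2 * m) * \<alpha>) (\<beta> / e\<^sup>2))) \<le>
    real D ^ m * ((3 / K + (2 * m + 1) * (6 ^ m * growth_coeff m / e ^ m)) * box_count x \<alpha> \<beta> + (1 + (2 * m + 1) * (2 * 6 ^ m * growth_const m * e ^ m)))"
proof -
  let ?small = "{z. \<bar>of_int (fst z)\<bar> \<le> \<alpha> / e} :: (int \<times> ('n \<Rightarrow> int)) set"
  have cover: "pts i \<subseteq> (pts i \<inter> ?small) \<union> (\<Union>l\<in>{..2 * m}. pts i \<inter> layer l)" for i
  proof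
    fix z assume z: "z \<in> pts i"
    show "z \<in> (pts i \<inter> ?small) \<union> (\<Union>l\<in>{..2 * m}. pts i \<inter> layer l)"
    proof (cases "z \<in> ?small")
      case False
      \<comment> \<open>The layer of \<open>z\<close> is the least admissible exponent; minimality
        gives the lower bound on \<open>q\<close>, except for exponent 0, where it is the failure to
        be small.\<close>
      define P where "P l \<longleftrightarrow> \<bar>of_int (fst z)\<bar> \<le> \<alpha> * e ^ l" for l
      have P: "P (2 * m)" using z by (auto simp: P_def pts_def box_pts_def mult.commute)
      define l where "l = (LEAST l. P l)"
      have l: "P l" "l \<le> 2 * m" using P unfolding l_def by (auto intro: LeastI Least_le)
      have "\<alpha> * e ^ l / e < \<bar>of_int (fst z)\<bar>"
      proof (cases l)
        case 0
        then show ?thesis using False by simp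
      next
        case (Suc k)
        then have "\<not> P k" using not_less_Least[of k P] by (simp add: l_def)
        then show ?thesis using Suc e_pos by (simp add: P_def)
      qed
      then show ?thesis using l z by (auto simp: layer_def P_def)
    qed (use z in auto)
  qed
  have "real (box_count (child i) (e ^ (2 * m) * \<alpha>) (\<beta> / e\<^sup>2)) \<le>
      real (card (pts i \<inter> ?small)) + (\<Sum>l\<le>2 * m. real (card (pts i \<inter> layer l)))" for i
  proof -
    have fin: "finite (pts i)" by (simp add: pts_def)
    have "card (pts i) \<le> card ((pts i \<inter> ?small) \<union> (\<Union>l\<in>{..2 * m}. pts i \<inter> layer l))"
      using fin by (intro card_mono cover) auto
    also have "\<dots> \<le> card (pts i \<inter> ?small) + card (\<Union>l\<in>{..2 * m}. pts i \<inter> layer l)" by (rule card_Un_le)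
    also have "\<dots> \<le> card (pts i \<inter> ?small) + (\<Sum>l\<le>2 * m. card (pts i \<inter> layer l))"
      by (intro add_left_mono card_UN_le) simp
    finally show ?thesis unfolding box_count_def pts_def[symmetric]
      by (simp only: of_nat_le_iff flip: of_nat_sum of_nat_add)
  qed
  then have "(\<Sum>i\<in>children. real (box_count (child i) (e ^ (2 * m) * \<alpha>) (\<beta> / e\<^sup>2))) \<le>
      (\<Sum>i\<in>children. real (card (pts i \<inter> ?small)) + (\<Sum>l\<le>2 * m. real (card (pts i \<inter> layer l))))"
    by (rule sum_mono)
  also have "\<dots> = (\<Sum>i\<in>children. real (card (pts i \<inter> ?small))) + (\<Sum>l\<le>2 * m. \<Sum>i\<in>children. real (card (pts i \<inter> layer l)))"
    unfolding sum.distrib by (subst sum.swap) (rule refl)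
  also have "\<dots> \<le> real D ^ m * (3 / K * box_count x \<alpha> \<beta> + 1) +
      (\<Sum>l\<le>2 * m. real D ^ m * (6 ^ m * growth_coeff m / e ^ m * box_count x \<alpha> \<beta> + 2 * 6 ^ m * growth_const m * e ^ m))"
    by (intro add_mono small_sum sum_mono layer_sum) auto
  also have "\<dots> = real D ^ m * ((3 / K + (2 * m + 1) * (6 ^ m * growth_coeff m / e ^ m)) * box_count x \<alpha> \<beta> + (1 + (2 * m + 1) * (2 * 6 ^ m * growth_const m * e ^ m)))"
  proof -
    have "d * (a * F + 1) + (\<Sum>l\<le>2 * m. d * (b * F + c)) = d * ((a + (2 * m + 1) * b) * F + (1 + (2 * m + 1) * c))"
      for a b c d F :: real by (simp add: algebra_simps)
    from this[of "real D ^ m" "3 / K" "real (box_count x \<alpha> \<beta>)" "6 ^ m * growth_coeff m / real (e ^ m)" "2 * 6 ^ m * growth_const m * real (e ^ m)"]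
    show ?thesis by (simp only: of_nat_power)
  qed
  finally show ?thesis .
qed

end

section \<open>Box dimension of the singular vectors\<close>

definition cell_corner :: "nat \<Rightarrow> nat \<Rightarrow> ('n \<Rightarrow> int) \<Rightarrow> real ^ 'n" where
  "cell_corner D n k = (\<chi> i. of_int (k i) / real D ^ n)"

definition refine_factor :: "'n itself \<Rightarrow> nat \<Rightarrow> nat" where
  "refine_factor _ e = e ^ (2 * CARD('n) + 2)"

text \<open>The box parameters at level \<open>n\<close> satisfy
  \<open>\<beta> / \<alpha> = 1 / D ^ n\<close>, the side of the cell, so the count at the corner
  represents the whole cell.\<close>

definition cell_count :: "nat \<Rightarrow> nat \<Rightarrow> ('n::finite \<Rightarrow> int) \<Rightarrow> nat" where
  "cell_count e n k = box_count (cell_corner (refine_factor TYPE('n) e) n k)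
     (real e ^ (2 * CARD('n) * n)) (1 / real e ^ (2 * n))"

text \<open>The factor 1/4 leaves room for the constant: where the count is at least
  \<open>4 * C\<close>, the right-hand side is at most half of the count times the number of
  subcells.\<close>

lemma cell_contraction:
  obtains e C where "e \<ge> 4" "C \<ge> 1"
    and "\<And>n (k :: 'n::finite \<Rightarrow> int). (\<Sum>i\<in>PiE UNIV (\<lambda>_. {..<refine_factor TYPE('n::finite) e}).
        real (cell_count e (Suc n) (\<lambda>j. k j * int (refine_factor TYPE('n::finite) e) + int (i j))))
      \<le> real (refine_factor TYPE('n::finite) e) ^ CARD('n) * (real (cell_count e n k) / 4 + C)"
proof -
  define m where "m = CARD('n)"
  define B where "B = (2 * m + 1) * 6 ^ m * growth_coeff m"
  \<comment> \<open>The bound 24 makes \<open>3 / K\<close> at most 1/8, and \<open>4 * B\<close>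
    makes \<open>B / e = B / (2 * K)\<close> at most 1/8.\<close>
  obtain K :: nat where K: "real K \<ge> max 24 (4 * B)" using real_arch_simple by blast
  define e where "e = 2 * K"
  define D where "D = e ^ (2 * m + 2)"
  define C where "C = 1 + (2 * m + 1) * (2 * 6 ^ m * growth_const m * e ^ m)"
  have m1: "m \<ge> 1" by (simp add: m_def Suc_leI)
  have B0: "B \<ge> 0" by (simp add: B_def growth_coeff_def)
  have e4: "real e \<ge> 4" using K by (simp add: e_def)
  have coef: "3 / K + (2 * m + 1) * (6 ^ m * growth_coeff m / e ^ m) \<le> 1 / 4"
  proof -
    have "3 / K \<le> 1 / 8" using K by (simp add: field_simps)
    have "real e ^ 1 \<le> real e ^ m" using e4 m1 by (intro power_increasing) auto
    then have "B / real e ^ m \<le> B / e" using B0 e4 by (intro divide_left_mono) auto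
    also have "\<dots> \<le> 1 / 8" using K by (simp add: e_def field_simps)
    finally have "B / real e ^ m \<le> 1 / 8" .
    moreover have "B / real e ^ m = (2 * m + 1) * (6 ^ m * growth_coeff m / e ^ m)"
      by (simp add: B_def algebra_simps)
    ultimately show ?thesis using \<open>3 / K \<le> 1 / 8\<close> by linarith
  qed
  show ?thesis
  proof (rule that)
    show "e \<ge> 4" using e4 by simp
    show "C \<ge> 1" by (simp add: C_def growth_const_def)
    fix n and k :: "'n \<Rightarrow> int"
    have D: "refine_factor TYPE('n) e = D" by (simp add: refine_factor_def D_def m_def)
    define \<alpha> where "\<alpha> = real e ^ (2 * m * n)"
    define \<beta> where "\<beta> = 1 / real e ^ (2 * n)"
    have "\<beta> ^ m = 1 / real e ^ (2 * m * n)"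
      by (simp add: \<beta>_def power_divide mult_ac flip: power_mult)
    then have uni: "\<alpha> * \<beta> ^ m = 1" using e4 by (simp add: \<alpha>_def)
    interpret contraction_step "cell_corner D n k" \<alpha> \<beta> K m e D
    proof unfold_locales
      show "\<alpha> \<ge> 1" unfolding \<alpha>_def using e4 by (intro one_le_power) linarith
      show "\<beta> > 0" using e4 by (simp add: \<beta>_def)
      show "K \<ge> 2" using K by simp
    qed (use uni in \<open>simp_all add: m_def e_def D_def\<close>)
    have "real D ^ n = (real e ^ (2 * m + 2)) ^ n" by (simp add: D_def)
    also have "\<dots> = real e ^ (2 * m * n + 2 * n)" unfolding power_mult[symmetric] by (simp add: algebra_simps)
    also have "\<dots> = real e ^ (2 * m * n) * real e ^ (2 * n)" by (rule power_add)
    finally have ratio: "\<beta> / \<alpha> / D = 1 / real D ^ Suc n"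
      by (simp add: \<alpha>_def \<beta>_def)
    have child: "child i = cell_corner D (Suc n) (\<lambda>j. k j * int D + int (i j))" for i
    proof -
      have "of_int (k j) / real D ^ n = of_int (k j) * D * (1 / real D ^ Suc n)" for j
        using D_pos by simp
      then show ?thesis
        unfolding child_def ratio unfolding cell_corner_def by (simp add: vec_eq_iff add_divide_distrib)
    qed
    have \<alpha>': "real e ^ (2 * m) * \<alpha> = real e ^ (2 * m * Suc n)"
      by (simp add: \<alpha>_def flip: power_add)
    have \<beta>': "\<beta> / (real e)\<^sup>2 = 1 / real e ^ (2 * Suc n)"
      by (simp add: \<beta>_def power2_eq_square)
    have cnt: "cell_count e n k = box_count (cell_corner D n k) \<alpha> \<beta>"
      by (simp add: cell_count_def D \<alpha>_def \<beta>_def m_def)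
    have "(\<Sum>i\<in>children. real (cell_count e (Suc n) (\<lambda>j. k j * int D + int (i j)))) =
        (\<Sum>i\<in>children. real (box_count (child i) (e ^ (2 * m) * \<alpha>) (\<beta> / e\<^sup>2)))"
      unfolding cell_count_def D m_def[symmetric] child of_nat_power \<alpha>' \<beta>' ..
    also have "\<dots> \<le> real D ^ m * ((3 / K + (2 * m + 1) * (6 ^ m * growth_coeff m / e ^ m)) * box_count (cell_corner D n k) \<alpha> \<beta> + C)"
      unfolding C_def by (rule contraction)
    also have "\<dots> \<le> real D ^ m * (1 / 4 * box_count (cell_corner D n k) \<alpha> \<beta> + C)"
      by (intro mult_left_mono add_right_mono mult_right_mono coef) auto
    finally show "(\<Sum>i\<in>PiE UNIV (\<lambda>_. {..<refine_factor TYPE('n) e}).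
        real (cell_count e (Suc n) (\<lambda>j. k j * int (refine_factor TYPE('n) e) + int (i j))))
      \<le> real (refine_factor TYPE('n) e) ^ CARD('n) * (real (cell_count e n k) / 4 + C)"
      unfolding D children_def cnt by (simp add: m_def)
  qed
qed

section \<open>The tree of nested cells\<close>

definition cell_index :: "nat \<Rightarrow> nat \<Rightarrow> real ^ 'n \<Rightarrow> 'n \<Rightarrow> int" where
  "cell_index D n y = (\<lambda>i. \<lfloor>y $ i * real D ^ n\<rfloor>)"

lemma cell_index_Suc_div:
  assumes "D > 0"
  shows "(\<lambda>i. cell_index D (Suc n) y i div int D) = cell_index D n y"
proof
  fix i
  have "y $ i * real D ^ n = (y $ i * real D ^ Suc n) / of_int (int D)" using assms by simp
  then show "cell_index D (Suc n) y i div int D = cell_index D n y i"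
    unfolding cell_index_def by (simp only: floor_divide_real_eq_div of_nat_0_le_iff)
qed

lemma cell_index_close:
  assumes "D > 0"
  shows "\<bar>y $ i - cell_corner D n (cell_index D n y) $ i\<bar> \<le> 1 / real D ^ n"
proof -
  let ?a = "y $ i * real D ^ n"
  have "\<bar>?a - of_int \<lfloor>?a\<rfloor>\<bar> \<le> 1" by linarith
  then have "\<bar>?a - of_int \<lfloor>?a\<rfloor>\<bar> / real D ^ n \<le> 1 / real D ^ n" by (intro divide_right_mono) auto
  moreover have "y $ i - of_int \<lfloor>?a\<rfloor> / real D ^ n = (?a - of_int \<lfloor>?a\<rfloor>) / real D ^ n"
    using assms by (simp add: diff_divide_distrib)
  ultimately show ?thesis using assms by (simp add: cell_corner_def cell_index_def abs_divide)
qed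

text \<open>The points of a bounded region whose lattices stay, from time \<open>j0\<close> on, in the part of the
  cusp where the counting function is at least \<open>T\<close>.\<close>
definition cusp_set :: "nat \<Rightarrow> real \<Rightarrow> nat \<Rightarrow> nat \<Rightarrow> (real ^ 'n) set" where
  "cusp_set e T j0 l = {y. (\<forall>i. \<bar>y $ i\<bar> \<le> l) \<and>
     (\<forall>j\<ge>j0. T \<le> real (cell_count e j (cell_index (refine_factor TYPE('n) e) j y)))}"

text \<open>Weigh each surviving cell by its count. All its ancestors down from level
  \<open>j0\<close> exceed the threshold, so the total weight grows by at most
  \<open>D ^ m / 2\<close> per level, and it dominates the number of cells because each weight is at
  least 1.\<close>

lemma cusp_set_cover:
  obtains e T where "e \<ge> 4" "\<And>j0 l. \<exists>c. \<forall>n. \<exists>P. finite P \<and>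
      real (card P) \<le> c * (real (refine_factor TYPE('n) e) ^ CARD('n) / 2) ^ n \<and>
      (\<forall>y \<in> cusp_set e T j0 l :: (real ^ 'n) set. \<exists>p\<in>P. \<forall>i. \<bar>y $ i - p $ i\<bar> \<le> 1 / real (refine_factor TYPE('n) e) ^ n)"
proof -
  obtain e C where e: "e \<ge> 4" and C: "C \<ge> 1"
    and contr: "\<And>n (k :: 'n \<Rightarrow> int). (\<Sum>i\<in>PiE UNIV (\<lambda>_. {..<refine_factor TYPE('n) e}).
        real (cell_count e (Suc n) (\<lambda>j. k j * int (refine_factor TYPE('n) e) + int (i j))))
      \<le> real (refine_factor TYPE('n) e) ^ CARD('n) * (real (cell_count e n k) / 4 + C)"
    using cell_contraction[where 'n = 'n] by blast
  define D where "D = refine_factor TYPE('n) e"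
  have D0: "D > 0" using e by (simp add: D_def refine_factor_def)
  define T where "T = 4 * C"
  define m where "m = CARD('n)"
  have contr': "(\<Sum>i\<in>PiE UNIV (\<lambda>_. {..<D}). real (cell_count e (Suc n) (\<lambda>j. k j * int D + int (i j))))
      \<le> real D ^ m / 2 * cell_count e n k" if "T \<le> cell_count e n k" for n and k :: "'n \<Rightarrow> int"
  proof -
    have "real D ^ m * (real (cell_count e n k) / 4 + C) \<le> real D ^ m * (real (cell_count e n k) / 2)"
      using that by (intro mult_left_mono) (auto simp: T_def)
    then show ?thesis using contr[where n = n and k = k] by (simp add: D_def m_def)
  qed
  show ?thesis
  proof (rule that[OF e])
    fix j0 l :: nat
    define M0 where "M0 = (PiE UNIV (\<lambda>_. {- int (l * D ^ j0)..int (l * D ^ j0)}) :: ('n \<Rightarrow> int) set)"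
    \<comment> \<open>\<open>M n\<close> holds the cells of level \<open>j0 + n\<close> whose
      ancestors, obtained by \<open>div\<close>, all reach the threshold back to level
      \<open>j0\<close>, where the cells are those that can meet the bounded region.\<close>
    define M where "M = rec_nat {k \<in> M0. T \<le> cell_count e j0 k}
      (\<lambda>n S. {k. T \<le> cell_count e (j0 + Suc n) k \<and> (\<lambda>i. k i div int D) \<in> S})"
    have M_0: "M 0 = {k \<in> M0. T \<le> cell_count e j0 k}" by (simp add: M_def)
    have M_Suc: "M (Suc n) = {k. T \<le> cell_count e (j0 + Suc n) k \<and> (\<lambda>i. k i div int D) \<in> M n}" for n
      by (simp add: M_def)
    have MT: "T \<le> cell_count e (j0 + n) k" if "k \<in> M n" for n k
      using that by (cases n) (auto simp: M_0 M_Suc)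
    define I where "I = (PiE UNIV (\<lambda>_. {..<D}) :: ('n \<Rightarrow> nat) set)"
    have finI: "finite I" by (auto simp: I_def intro: finite_PiE)
    define \<phi> where "\<phi> = (\<lambda>(k :: 'n \<Rightarrow> int, i :: 'n \<Rightarrow> nat) j. k j * int D + int (i j))"
    have sub: "M (Suc n) \<subseteq> \<phi> ` (M n \<times> I)" for n
    proof
      fix k assume k: "k \<in> M (Suc n)"
      have "k = \<phi> (\<lambda>i. k i div int D, \<lambda>i. nat (k i mod int D))"
        using D0 by (auto simp: \<phi>_def fun_eq_iff)
      moreover have "(\<lambda>i. nat (k i mod int D)) \<in> I"
        using D0 by (auto simp: I_def PiE_def nat_less_iff)
      ultimately show "k \<in> \<phi> ` (M n \<times> I)" using k unfolding M_Suc by blast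
    qed
    have finM: "finite (M n)" for n
    proof (induction n)
      case 0
      have "finite M0" unfolding M0_def by (intro finite_PiE) auto
      then show ?case unfolding M_0 by simp
    next
      case (Suc n)
      then show ?case using finite_subset[OF sub] finI by blast
    qed
    define W where "W n = (\<Sum>k\<in>M n. real (cell_count e (j0 + n) k))" for n
    have W: "W n \<le> W 0 * (real D ^ m / 2) ^ n" for n
    proof (induction n)
      case (Suc n)
      have "W (Suc n) \<le> (\<Sum>k\<in>\<phi> ` (M n \<times> I). real (cell_count e (j0 + Suc n) k))"
        unfolding W_def using finM finI by (intro sum_mono2 sub) auto
      also have "\<dots> \<le> (\<Sum>z\<in>M n \<times> I. real (cell_count e (j0 + Suc n) (\<phi> z)))"
        using sum_image_le[of "M n \<times> I" "\<lambda>k. real (cell_count e (j0 + Suc n) k)" \<phi>] finM finI by (simp add: o_def)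
      also have "\<dots> = (\<Sum>k\<in>M n. \<Sum>i\<in>I. real (cell_count e (Suc (j0 + n)) (\<lambda>j. k j * int D + int (i j))))"
        by (simp add: sum.cartesian_product \<phi>_def case_prod_beta)
      also have "\<dots> \<le> (\<Sum>k\<in>M n. real D ^ m / 2 * cell_count e (j0 + n) k)"
        unfolding I_def by (intro sum_mono contr' MT)
      also have "\<dots> = real D ^ m / 2 * W n" by (simp add: W_def sum_distrib_left)
      also have "\<dots> \<le> real D ^ m / 2 * (W 0 * (real D ^ m / 2) ^ n)"
        using Suc.IH by (intro mult_left_mono) auto
      finally show ?case by (simp add: mult_ac)
    qed simp
    have W0: "W 0 \<ge> 0" unfolding W_def by (intro sum_nonneg) auto
    have cardM: "real (card (M n)) \<le> W n" for n
    proof -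
      have "real (card (M n)) = (\<Sum>k\<in>M n. 1)" by simp
      also have "\<dots> \<le> W n" unfolding W_def using MT C by (intro sum_mono) (fastforce simp: T_def)
      finally show ?thesis .
    qed
    have mem: "cell_index D (j0 + n) y \<in> M n" if y: "y \<in> cusp_set e T j0 l" for y :: "real ^ 'n" and n
    proof (induction n)
      case 0
      have "cell_index D j0 y i \<in> {- int (l * D ^ j0)..int (l * D ^ j0)}" for i
      proof -
        have "\<bar>y $ i\<bar> \<le> real l" using y by (simp add: cusp_set_def)
        then have yi: "- real l \<le> y $ i" "y $ i \<le> real l" by linarith+
        have "- real l * real D ^ j0 \<le> y $ i * real D ^ j0" "y $ i * real D ^ j0 \<le> real l * real D ^ j0"
          by (rule mult_right_mono[OF yi(1)], simp, rule mult_right_mono[OF yi(2)], simp)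
        then have "of_int (- int (l * D ^ j0)) \<le> y $ i * real D ^ j0" "y $ i * real D ^ j0 \<le> of_int (int (l * D ^ j0))"
          by simp_all
        then show ?thesis unfolding cell_index_def atLeastAtMost_iff
          using le_floor_iff[of "- int (l * D ^ j0)" "y $ i * real D ^ j0"]
            floor_mono[of "y $ i * real D ^ j0" "of_int (int (l * D ^ j0))"] by (simp only: floor_of_int simp_thms)
      qed
      then show ?case using y by (auto simp: M_0 M0_def cusp_set_def D_def)
    next
      case (Suc n)
      then show ?case using y cell_index_Suc_div[OF D0, of "j0 + n" y]
        by (auto simp: M_Suc cusp_set_def D_def)
    qed
    show "\<exists>c. \<forall>n. \<exists>P. finite P \<and> real (card P) \<le> c * (real (refine_factor TYPE('n) e) ^ CARD('n) / 2) ^ n \<and>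
      (\<forall>y \<in> cusp_set e T j0 l :: (real ^ 'n) set. \<exists>p\<in>P. \<forall>i. \<bar>y $ i - p $ i\<bar> \<le> 1 / real (refine_factor TYPE('n) e) ^ n)"
    proof (intro exI allI conjI)
      fix n
      \<comment> \<open>Corners of level \<open>j0 + n\<close> are even finer than the accuracy
        asked at level \<open>n\<close>; this hides \<open>j0\<close> in the constant.\<close>
      let ?P = "cell_corner D (j0 + n) ` M n"
      show "finite ?P" using finM by simp
      have "real (card ?P) \<le> card (M n)" using card_image_le[OF finM] by simp
      also have "\<dots> \<le> W 0 * (real D ^ m / 2) ^ n" using cardM W order_trans by blast
      finally show "real (card ?P) \<le> W 0 * (real (refine_factor TYPE('n) e) ^ CARD('n) / 2) ^ n"
        by (simp add: D_def m_def)
      show "\<forall>y \<in> cusp_set e T j0 l :: (real ^ 'n) set. \<exists>p\<in>?P. \<forall>i. \<bar>y $ i - p $ i\<bar> \<le> 1 / real (refine_factor TYPE('n) e) ^ n"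
      proof
        fix y :: "real ^ 'n" assume y: "y \<in> cusp_set e T j0 l"
        have "real D ^ n \<le> real D ^ (j0 + n)" using D0 by (intro power_increasing) auto
        then have "1 / real D ^ (j0 + n) \<le> 1 / real D ^ n" using D0 by (intro divide_left_mono) auto
        then have "\<bar>y $ i - cell_corner D (j0 + n) (cell_index D (j0 + n) y) $ i\<bar> \<le> 1 / real D ^ n" for i
          using cell_index_close[OF D0, of y i "j0 + n"] by linarith
        then show "\<exists>p\<in>?P. \<forall>i. \<bar>y $ i - p $ i\<bar> \<le> 1 / real (refine_factor TYPE('n) e) ^ n"
          using mem[OF y] by (auto simp: D_def)
      qed
    qed
  qed
qed

section \<open>Comparing an arbitrary norm with the Euclidean norm\<close>

lemma is_norm_triangle_sum:
  assumes "is_norm N" "finite I"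
  shows "N (sum f I) \<le> (\<Sum>i\<in>I. N (f i))"
  using assms(2)
proof (induction I rule: finite_induct)
  case empty
  have "N 0 = 0" using assms(1) unfolding is_norm_def by blast
  then show ?case by simp
next
  case (insert i I)
  have "N (f i + sum f I) \<le> N (f i) + N (sum f I)" using assms(1) by (simp add: is_norm_def)
  then show ?case using insert by simp
qed

lemma is_norm_le_norm:
  fixes N :: "real ^ 'n \<Rightarrow> real"
  assumes N: "is_norm N"
  obtains b where "b > 0" "\<And>v. N v \<le> b * norm v"
proof -
  have hom: "N (c *\<^sub>R x) = \<bar>c\<bar> * N x" and nonneg: "0 \<le> N x" for c x
    using N unfolding is_norm_def by blast+
  define b where "b = (\<Sum>i\<in>UNIV. N (axis i 1 :: real ^ 'n))"
  have b: "b \<ge> 0" unfolding b_def by (intro sum_nonneg nonneg)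
  have "N v \<le> b * norm v" for v
  proof -
    have "N v = N (\<Sum>i\<in>UNIV. v $ i *\<^sub>R axis i 1)"
      using basis_expansion[of v] by (simp add: scalar_mult_eq_scaleR)
    also have "\<dots> \<le> (\<Sum>i\<in>UNIV. N (v $ i *\<^sub>R axis i 1))" by (rule is_norm_triangle_sum[OF N]) simp
    also have "\<dots> \<le> (\<Sum>i\<in>UNIV. norm v * N (axis i 1))"
      unfolding hom by (intro sum_mono mult_right_mono component_le_norm_cart nonneg)
    also have "\<dots> = b * norm v" by (simp add: b_def sum_distrib_left mult.commute)
    finally show ?thesis .
  qed
  then have "N v \<le> (b + 1) * norm v" for v by (smt (verit) mult_right_mono norm_ge_zero)
  then show ?thesis using that[of "b + 1"] b by simp
qed

text \<open>The upper bound makes \<open>N\<close> Lipschitz, so it attains a minimum on the compact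
  unit sphere, which is positive by definiteness.\<close>

lemma is_norm_ge_norm:
  fixes N :: "real ^ 'n \<Rightarrow> real"
  assumes N: "is_norm N"
  obtains a where "a > 0" "\<And>v. a * norm v \<le> N v"
proof -
  have hom: "N (c *\<^sub>R x) = \<bar>c\<bar> * N x" and tri: "N (x + y) \<le> N x + N y" and nonneg: "0 \<le> N x"
    and zero: "N x = 0 \<longleftrightarrow> x = 0" for c x y
    using N unfolding is_norm_def by blast+
  obtain b where b: "b > 0" "\<And>v. N v \<le> b * norm v" using is_norm_le_norm[OF N] by blast
  have "b-lipschitz_on (sphere 0 1) N"
  proof (rule lipschitz_onI)
    fix x y :: "real ^ 'n"
    have "N x \<le> N (x - y) + N y" "N y \<le> N (x - y) + N x"
      using tri[of "x - y" y] tri[of "y - x" x] hom[of "-1" "x - y"] by simp_all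
    then show "dist (N x) (N y) \<le> b * dist x y"
      using b(2)[of "x - y"] by (simp add: dist_norm)
  qed (use b in simp)
  then have cont: "continuous_on (sphere 0 1) N" by (rule lipschitz_on_continuous_on)
  have "sphere (0 :: real ^ 'n) 1 \<noteq> {}" by simp
  then obtain u where u: "norm u = 1" "\<And>x. norm x = 1 \<Longrightarrow> N u \<le> N x"
    using continuous_attains_inf[OF compact_sphere _ cont] by auto
  show ?thesis
  proof (rule that)
    have "u \<noteq> 0" using u by auto
    then show "N u > 0" using nonneg[of u] zero[of u] by linarith
    show "N u * norm v \<le> N v" for v
    proof (cases "v = 0")
      case False
      have "N u \<le> N ((1 / norm v) *\<^sub>R v)" using False by (intro u) simp
      also have "\<dots> = N v / norm v" by (simp add: hom)
      finally show ?thesis using False by (simp add: field_simps)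
    qed (simp add: nonneg)
  qed
qed

text \<open>One direction of Dani's correspondence: a singular vector has at every late time a
  nonzero integer point far inside the box, and the multiples of this point by \<open>0..K\<close>
  already give more than \<open>T\<close> points.\<close>

lemma singular_set_subset_cusp_sets:
  fixes N :: "real ^ 'n \<Rightarrow> real"
  assumes N: "is_norm N" and y: "y \<in> singular_set N" and e: "e \<ge> 4"
  obtains j0 l where "y \<in> cusp_set e T j0 l"
proof -
  define m where "m = CARD('n)"
  have m: "m > 0" by (simp add: m_def)
  obtain a where a: "a > 0" "\<And>v. a * norm v \<le> N v" using is_norm_ge_norm[OF N] by blast
  obtain K :: nat where K: "real K \<ge> max 1 T" using real_arch_simple by blast
  \<comment> \<open>The point fits \<open>\<delta>\<close> times into the box for \<open>y\<close>,
    but replacing \<open>y\<close> by the corner of its cell doubles the error to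
    \<open>2 * \<beta> / \<delta>\<close>; so multiples up to \<open>\<delta> / 2 = K\<close>
    remain.\<close>
  define \<delta> where "\<delta> = 2 * real K"
  have \<delta>: "\<delta> \<ge> 2" using K by (simp add: \<delta>_def)
  \<comment> \<open>Chosen so that \<open>c * (\<alpha> / \<delta>) powr (- 1 / m) / a\<close>
    equals \<open>\<beta> / \<delta>\<close>, in view of
    \<open>\<beta> = \<alpha> powr (- 1 / m)\<close>.\<close>
  define c where "c = a / (\<delta> * \<delta> powr (1 / m))"
  have "c > 0" using a \<delta> by (simp add: c_def)
  then obtain Q0 where Q0: "\<And>Q. Q \<ge> Q0 \<Longrightarrow> approximable N y Q (c * Q powr (- 1 / m))"
    using y unfolding singular_set_def m_def eventually_at_top_linorder by blast
  \<comment> \<open>As \<open>\<alpha>\<close> is at least \<open>2 ^ j\<close>, hence at least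
    \<open>j\<close>, this forces \<open>\<alpha> / \<delta> \<ge> Q0\<close>.\<close>
  obtain j0 :: nat where j0: "real j0 \<ge> Q0 * \<delta>" using real_arch_simple by blast
  obtain l :: nat where l: "real l \<ge> norm y" using real_arch_simple by blast
  show ?thesis
  proof (rule that)
    have "T \<le> real (cell_count e j (cell_index (refine_factor TYPE('n) e) j y))" if j: "j \<ge> j0" for j
    proof -
      define D where "D = refine_factor TYPE('n) e"
      define x where "x = cell_corner D j (cell_index D j y)"
      define \<alpha> where "\<alpha> = real e ^ (2 * m * j)"
      define \<beta> where "\<beta> = 1 / real e ^ (2 * j)"
      have e0: "real e \<ge> 4" using e by simp
      have \<alpha>0: "\<alpha> > 0" and \<beta>0: "\<beta> > 0" using e0 by (auto simp: \<alpha>_def \<beta>_def)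
      have "real D ^ j = \<alpha> * real e ^ (2 * j)"
        unfolding D_def refine_factor_def \<alpha>_def m_def
        unfolding of_nat_power power_mult[symmetric] power_add[symmetric]
        by (rule arg_cong[where f = "power (real e)"]) (simp add: algebra_simps)
      then have ratio: "1 / real D ^ j = \<beta> / \<alpha>" by (simp add: \<beta>_def)
      have "D > 0" using e by (simp add: D_def refine_factor_def)
      then have xy: "\<bar>y $ i - x $ i\<bar> \<le> \<beta> / \<alpha>" for i
        using cell_index_close[of D y i j] by (simp add: x_def ratio)
      have "Q0 * \<delta> \<le> real j" using j0 j by linarith
      also have "real j \<le> 2 ^ j" by (rule of_nat_less_two_power[THEN less_imp_le])
      also have "\<dots> \<le> real e ^ j" using e0 by (intro power_mono) auto
      also have "\<dots> \<le> \<alpha>" unfolding \<alpha>_def using e0 m by (intro power_increasing) auto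
      finally have "Q0 \<le> \<alpha> / \<delta>" using \<delta> by (simp add: field_simps)
      from Q0[OF this] obtain q p where q: "1 \<le> q" "of_int q \<le> \<alpha> / \<delta>"
        and p: "N (of_int q *\<^sub>R y - (\<chi> i. of_int (p $ i))) \<le> c * (\<alpha> / \<delta>) powr (- 1 / m)"
        unfolding approximable_def by blast
      have qp: "\<bar>of_int q * y $ i - of_int (p $ i)\<bar> \<le> \<beta> / \<delta>" for i
      proof -
        have "\<bar>of_int q * y $ i - of_int (p $ i)\<bar> \<le> norm (of_int q *\<^sub>R y - (\<chi> i. of_int (p $ i)))"
          using component_le_norm_cart[of "of_int q *\<^sub>R y - (\<chi> i. of_int (p $ i))" i] by simp
        also have "\<dots> \<le> c * (\<alpha> / \<delta>) powr (- 1 / m) / a"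
          using a(2) p a(1) by (simp add: pos_le_divide_eq mult.commute) (meson order_trans)
        also have "\<dots> = \<alpha> powr (- 1 / m) / \<delta>"
          using a \<alpha>0 \<delta> by (simp add: c_def powr_divide powr_minus_divide)
        also have "\<alpha> powr (- 1 / m) = \<beta>"
        proof -
          have "\<alpha> = real e powr (2 * m * j)" using e0 by (simp add: \<alpha>_def powr_realpow[symmetric])
          then have "\<alpha> powr (- 1 / m) = real e powr (- real (2 * j))" using m by (simp add: powr_powr)
          also have "\<dots> = \<beta>" using e0 by (simp only: powr_minus_divide \<beta>_def powr_realpow)
          finally show ?thesis .
        qed
        finally show ?thesis .
      qed
      define f where "f t = (int t * q, \<lambda>i. int t * p $ i)" for t :: nat
      have "f ` {..K} \<subseteq> box_pts x \<alpha> \<beta> (\<lambda>_. 0)"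
      proof (rule image_subsetI)
        fix t assume "t \<in> {..K}"
        then have t: "real t \<le> \<delta> / 2" by (simp add: \<delta>_def)
        have "real t * of_int q \<le> \<delta> * (\<alpha> / \<delta>)" using t q \<delta> by (intro mult_mono) auto
        then have 1: "\<bar>of_int (int t * q)\<bar> \<le> \<alpha>" using q \<delta> by simp
        have "\<bar>of_int (int t * q) * x $ i - of_int (int t * p $ i)\<bar> \<le> \<beta>" for i
        proof -
          have "\<bar>of_int q * (y $ i - x $ i)\<bar> \<le> \<alpha> / \<delta> * (\<beta> / \<alpha>)"
            unfolding abs_mult using q xy by (intro mult_mono) auto
          then have "\<bar>of_int q * y $ i - of_int q * x $ i\<bar> \<le> \<beta> / \<delta>"
            using \<alpha>0 by (simp add: right_diff_distrib)
          then have "\<bar>of_int q * x $ i - of_int (p $ i)\<bar> \<le> 2 * (\<beta> / \<delta>)" using qp[of i] by linarith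
          then have "real t * \<bar>of_int q * x $ i - of_int (p $ i)\<bar> \<le> \<delta> / 2 * (2 * (\<beta> / \<delta>))"
            using t \<delta> by (intro mult_mono) auto
          moreover have "of_int (int t * q) * x $ i - of_int (int t * p $ i) = real t * (of_int q * x $ i - of_int (p $ i))"
            by (simp add: right_diff_distrib mult.assoc)
          then have "\<bar>of_int (int t * q) * x $ i - of_int (int t * p $ i)\<bar> = real t * \<bar>of_int q * x $ i - of_int (p $ i)\<bar>"
            by (simp only: abs_mult abs_of_nat)
          ultimately show ?thesis using \<delta> by simp
        qed
        then show "f t \<in> box_pts x \<alpha> \<beta> (\<lambda>_. 0)" using 1 by (simp add: f_def box_pts_def)
      qed
      moreover have "inj_on f {..K}" using q by (auto simp: inj_on_def f_def)
      ultimately have "Suc K \<le> card (box_pts x \<alpha> \<beta> (\<lambda>_. 0))"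
        by (metis card_atMost card_inj_on_le finite_box_pts)
      then have "real K \<le> box_count x \<alpha> \<beta>" by (simp add: box_count_def)
      moreover have "T \<le> real K" using K by simp
      ultimately have "T \<le> real (box_count x \<alpha> \<beta>)" by linarith
      then show ?thesis by (simp add: cell_count_def x_def D_def \<alpha>_def \<beta>_def m_def)
    qed
    moreover have "\<bar>y $ i\<bar> \<le> l" for i using component_le_norm_cart[of y i] l by simp
    ultimately show "y \<in> cusp_set e T j0 l" by (simp add: cusp_set_def)
  qed
qed

section \<open>Very well approximable vectors\<close>

text \<open>The condition on \<open>\<sigma>\<close> admits both signs at once: 1 will give
  differences and -1 sums. The preimages of the \<open>V n\<close> under
  \<open>x \<mapsto> z + \<sigma> *\<^sub>R x\<close> are again open and dense, because this map has
  the affine inverse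
  \<open>y \<mapsto> - \<sigma> *\<^sub>R z + \<sigma> *\<^sub>R y\<close>.\<close>

lemma comeagre_sum:
  fixes V :: "nat \<Rightarrow> 'a::{real_normed_vector,heine_borel} set"
  assumes V: "\<And>n. open (V n)" "\<And>n. closure (V n) = UNIV" and \<sigma>: "\<sigma> * \<sigma> = (1::real)"
  obtains x where "\<And>n. x \<in> V n" "\<And>n. z + \<sigma> *\<^sub>R x \<in> V n"
proof -
  define f where "f x = z + \<sigma> *\<^sub>R x" for x
  define V' where "V' n = f -` V n" for n
  have cont: "continuous_on UNIV f" unfolding f_def by (intro continuous_intros)
  have "V' n = (+) (- \<sigma> *\<^sub>R z) ` ((*\<^sub>R) \<sigma> ` V n)" for n
  proof (intro set_eqI iffI)
    fix x assume "x \<in> V' n"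
    moreover have "x = - \<sigma> *\<^sub>R z + \<sigma> *\<^sub>R f x" by (simp add: f_def algebra_simps \<sigma>)
    ultimately show "x \<in> (+) (- \<sigma> *\<^sub>R z) ` ((*\<^sub>R) \<sigma> ` V n)" by (auto simp: V'_def)
  next
    fix x assume "x \<in> (+) (- \<sigma> *\<^sub>R z) ` ((*\<^sub>R) \<sigma> ` V n)"
    then obtain v where v: "v \<in> V n" "x = - \<sigma> *\<^sub>R z + \<sigma> *\<^sub>R v" by auto
    have "f x = v" unfolding f_def v(2) scaleR_add_right scaleR_scaleR by (simp add: \<sigma>)
    then show "x \<in> V' n" using v by (simp add: V'_def)
  qed
  then have "closure (V' n) = (+) (- \<sigma> *\<^sub>R z) ` ((*\<^sub>R) \<sigma> ` UNIV)" for n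
    using V(2)[of n] by (simp only: closure_translation closure_scaleR[symmetric])
  moreover have "x = - \<sigma> *\<^sub>R z + \<sigma> *\<^sub>R f x" for x by (simp add: f_def algebra_simps \<sigma>)
  ultimately have V': "closure (V' n) = UNIV" for n by (metis UNIV_I UNIV_eq_I image_eqI)
  have "UNIV \<subseteq> closure (\<Inter>(range V \<union> range V'))"
  proof (rule Baire)
    fix T assume "T \<in> range V \<union> range V'"
    then show "openin (top_of_set UNIV) T \<and> UNIV \<subseteq> closure T"
      using V V' cont by (auto simp: V'_def open_vimage)
  qed auto
  then have "\<Inter>(range V \<union> range V') \<noteq> {}" by (metis UNIV_not_empty closure_empty subset_empty)
  then obtain x where x: "\<forall>X \<in> range V \<union> range V'. x \<in> X" by blast
  have "x \<in> V n" for n using x by blast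
  moreover have "x \<in> V' n" for n using x by blast
  then have "z + \<sigma> *\<^sub>R x \<in> V n" for n by (simp add: V'_def f_def)
  ultimately show ?thesis by (rule that)
qed

text \<open>Written over \<open>Basis\<close> to serve both vectors and, for the first part, single
  reals.\<close>

definition dyadic_point :: "nat \<Rightarrow> ('a \<Rightarrow> int) \<Rightarrow> 'a::euclidean_space" where
  "dyadic_point i p = (\<Sum>b\<in>Basis. (of_int (p b) / 2 ^ i) *\<^sub>R b)"

text \<open>The intersection of these sets over \<open>n\<close> is comeagre, yet consists of very well approximable
  points when \<open>\<epsilon>\<close> decays fast.\<close>
definition dyadic_nbhd :: "(nat \<Rightarrow> real) \<Rightarrow> nat \<Rightarrow> 'a::euclidean_space set" where
  "dyadic_nbhd \<epsilon> n = (\<Union>i\<in>{n..}. \<Union>p. ball (dyadic_point i p) (\<epsilon> i))"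

lemma open_dyadic_nbhd: "open (dyadic_nbhd \<epsilon> n)"
  unfolding dyadic_nbhd_def by auto

lemma closure_dyadic_nbhd:
  assumes "\<And>i. \<epsilon> i > 0"
  shows "closure (dyadic_nbhd \<epsilon> n) = (UNIV :: 'a::euclidean_space set)"
proof (rule UNIV_eq_I[symmetric])
  fix x :: 'a
  show "x \<in> closure (dyadic_nbhd \<epsilon> n)"
    unfolding closure_approachable
  proof (intro allI impI)
    fix \<delta> :: real assume "\<delta> > 0"
    obtain k where k: "DIM('a) / \<delta> < 2 ^ k" using real_arch_pow[of 2] by auto
    define i where "i = max n k"
    have "(2::real) ^ k \<le> 2 ^ i" by (intro power_increasing) (auto simp: i_def)
    then have i: "DIM('a) / \<delta> < 2 ^ i" using k by linarith
    define p where "p b = \<lfloor>(x \<bullet> b) * 2 ^ i\<rfloor>" for b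
    define y where "y = dyadic_point i p"
    have yb: "y \<bullet> b = of_int (p b) / 2 ^ i" if "b \<in> Basis" for b
      using that by (simp add: y_def dyadic_point_def)
    have "\<bar>(y - x) \<bullet> b\<bar> \<le> 1 / 2 ^ i" if "b \<in> Basis" for b
    proof -
      have "\<bar>of_int (p b) - (x \<bullet> b) * 2 ^ i\<bar> \<le> 1" unfolding p_def by linarith
      moreover have "(y - x) \<bullet> b = (of_int (p b) - (x \<bullet> b) * 2 ^ i) / 2 ^ i"
        using yb[OF that] by (simp add: inner_diff_left diff_divide_distrib)
      ultimately show ?thesis by (simp add: abs_divide divide_right_mono)
    qed
    then have "(\<Sum>b\<in>Basis. \<bar>(y - x) \<bullet> b\<bar>) \<le> (\<Sum>b\<in>(Basis :: 'a set). 1 / 2 ^ i)" by (rule sum_mono)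
    then have "dist y x \<le> DIM('a) / 2 ^ i"
      using norm_le_l1[of "y - x"] by (simp add: dist_norm)
    also have "\<dots> < \<delta>" using i \<open>\<delta> > 0\<close> by (simp add: field_simps)
    finally have "dist y x < \<delta>" .
    moreover have "y \<in> dyadic_nbhd \<epsilon> n"
      unfolding dyadic_nbhd_def
    proof (intro UN_I)
      show "i \<in> {n..}" by (simp add: i_def)
      show "y \<in> ball (dyadic_point i p) (\<epsilon> i)" using assms by (simp add: y_def)
    qed simp
    ultimately show "\<exists>y\<in>dyadic_nbhd \<epsilon> n. dist y x < \<delta>" by blast
  qed
qed

text \<open>With denominator \<open>2 ^ i\<close> the error is at most
  \<open>b * 2 ^ i * (1 / 2) ^ (i * i)\<close>. Once \<open>b \<le> 2 ^ i\<close> and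
  \<open>i \<ge> w + 2\<close> this is at most \<open>(2 ^ i) powr (- w)\<close>, so
  \<open>Q = 2 ^ i\<close> works for every \<open>w\<close>.\<close>

lemma dyadic_nbhd_subset_W_infty:
  fixes N :: "real ^ 'n \<Rightarrow> real"
  assumes N: "is_norm N" and \<epsilon>: "\<And>i. \<epsilon> i = (1 / 2) ^ (i * i)" and x: "\<And>n. x \<in> dyadic_nbhd \<epsilon> n"
  shows "x \<in> W_infty N"
proof -
  obtain b where b: "b > 0" "\<And>v. N v \<le> b * norm v" using is_norm_le_norm[OF N] by blast
  have "\<exists>\<^sub>F Q in at_top. approximable N x Q (Q powr (- real w))" for w :: nat
    unfolding frequently_def eventually_at_top_linorder
  proof safe
    fix Q0 :: real assume Q0: "\<forall>Q\<ge>Q0. \<not> approximable N x Q (Q powr (- real w))"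
    obtain n0 :: nat where n0: "real n0 \<ge> max Q0 (max b (real (w + 2)))" using real_arch_simple by blast
    obtain i p where i: "i \<ge> n0" and p': "dist (dyadic_point i p) x < \<epsilon> i"
      using x[of n0] by (auto simp: dyadic_nbhd_def)
    define P where "P j = p (axis j 1)" for j
    have "dyadic_point i p = (\<chi> j. of_int (P j) / 2 ^ i)"
    proof -
      have "dyadic_point i p $ j = of_int (P j) / 2 ^ i" for j
        unfolding cart_eq_inner_axis by (simp add: dyadic_point_def P_def axis_in_Basis_iff)
      then show ?thesis by (simp add: vec_eq_iff)
    qed
    then have p: "dist (\<chi> j. of_int (P j) / 2 ^ i) x < \<epsilon> i" using p' by simp
    have "real i < 2 ^ i" by (rule of_nat_less_two_power)
    moreover have "Q0 \<le> real n0" "b \<le> real n0" "real (w + 2) \<le> real n0" using n0 by simp_all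
    moreover have "real n0 \<le> real i" using i by simp
    ultimately have big: "2 ^ i \<ge> Q0" "2 ^ i \<ge> b" "i \<ge> w + 2" by linarith+
    have "N (of_int (2 ^ i) *\<^sub>R x - (\<chi> j. of_int ((\<chi> j. P j) $ j))) \<le> (2 ^ i) powr (- real w)"
    proof -
      have "of_int (2 ^ i) *\<^sub>R x - (\<chi> j. of_int ((\<chi> j. P j) $ j)) = 2 ^ i *\<^sub>R (x - (\<chi> j. of_int (P j) / 2 ^ i))"
        by (simp add: vec_eq_iff right_diff_distrib)
      then have "N (of_int (2 ^ i) *\<^sub>R x - (\<chi> j. of_int ((\<chi> j. P j) $ j))) \<le> b * (2 ^ i * dist (\<chi> j. of_int (P j) / 2 ^ i) x)"
        using b(2)[of "2 ^ i *\<^sub>R (x - (\<chi> j. of_int (P j) / 2 ^ i))"] by (simp add: dist_norm norm_minus_commute)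
      also have "\<dots> \<le> 2 ^ i * (2 ^ i * (1 / 2) ^ (i * i))"
        using p b big by (intro mult_mono) (auto simp: \<epsilon>)
      also have "\<dots> = 2 ^ (i * 2) * (1 / 2) ^ (i * i)" by (simp add: power_mult power2_eq_square power_mult_distrib flip: power_add)
      also have "\<dots> \<le> 2 ^ (i * 2) * (1 / 2) ^ (i * (w + 2))"
        using big by (intro mult_left_mono power_decreasing) auto
      also have "\<dots> = (1 / 2) ^ (i * w)" by (simp add: distrib_left power_add power_one_over mult_2_right)
      also have "\<dots> = (2 ^ i) powr (- real w)"
        by (simp add: powr_minus powr_realpow power_mult power_one_over inverse_eq_divide)
      finally show ?thesis .
    qed
    then have "approximable N x (2 ^ i) ((2 ^ i) powr (- real w))"
      unfolding approximable_def by (intro exI[of _ "2 ^ i"] exI[of _ "\<chi> j. P j"]) simp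
    then show False using Q0 big by blast
  qed
  then have "ereal (real w) \<le> omega N x" for w :: nat
    unfolding omega_def by (intro Sup_upper) auto
  then show ?thesis unfolding W_infty_def mem_Collect_eq
    by (metis ereal_infty_less_eq(1) less_PInf_Ex_of_nat linorder_not_le ereal_less_eq(1) not_le)
qed

lemma W_infty_sum:
  fixes N :: "real ^ 'n \<Rightarrow> real"
  assumes N: "is_norm N" and \<sigma>: "\<sigma> * \<sigma> = (1::real)"
  obtains x where "x \<in> W_infty N" "z + \<sigma> *\<^sub>R x \<in> W_infty N"
proof -
  define \<epsilon> :: "nat \<Rightarrow> real" where "\<epsilon> i = (1 / 2) ^ (i * i)" for i
  obtain x where "\<And>n. x \<in> dyadic_nbhd \<epsilon> n" "\<And>n. z + \<sigma> *\<^sub>R x \<in> dyadic_nbhd \<epsilon> n"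
    using comeagre_sum[of "dyadic_nbhd \<epsilon>" \<sigma> z] open_dyadic_nbhd closure_dyadic_nbhd[of \<epsilon>] \<sigma>
    by (metis \<epsilon>_def zero_less_power half_gt_zero zero_less_one)
  then show ?thesis using that dyadic_nbhd_subset_W_infty[OF N] \<epsilon>_def by metis
qed

section \<open>Sums of very well approximable and singular vectors\<close>

text \<open>Dirichlet's theorem in the other \<open>m - 1\<close> coordinates gives the exponent
  \<open>1 / (m - 1)\<close>, and its excess over \<open>1 / m\<close> beats every constant
  \<open>c\<close>.\<close>

lemma singular_set_if_coordinate_zero:
  fixes N :: "real ^ 'n \<Rightarrow> real"
  assumes N: "is_norm N" and card: "CARD('n) \<ge> 2" and x: "x $ k = 0"
  shows "x \<in> singular_set N"
  unfolding singular_set_def mem_Collect_eq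
proof (intro allI impI)
  fix c :: real assume c: "c > 0"
  define m where "m = CARD('n)"
  define r where "r = 1 / real (m - 1)"
  obtain b where b: "b > 0" "\<And>v. N v \<le> b * norm v" using is_norm_le_norm[OF N] by blast
  have m: "m \<ge> 2" using card by (simp add: m_def)
  have r: "r > 0" "r - 1 / m > 0" using m by (auto simp: r_def frac_less2 of_nat_diff)
  have card': "card (UNIV - {k}) = m - 1" by (simp add: m_def)
  \<comment> \<open>\<open>h\<close> numbers the coordinates other than \<open>k\<close> for
    Dirichlet's theorem; \<open>g\<close> is its inverse.\<close>
  obtain h where h: "bij_betw h {..<m - 1} (UNIV - {k})"
    using ex_bij_betw_nat_finite[of "UNIV - {k}"] card' by (auto simp: atLeast0LessThan)
  define g where "g = the_inv_into {..<m - 1} h"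
  have g: "g j < m - 1" "h (g j) = j" if "j \<noteq> k" for j
    using h that the_inv_into_into[of h "{..<m - 1}" j "{..<m - 1}"] f_the_inv_into_f[of h "{..<m - 1}" j]
    by (auto simp: g_def bij_betw_def)
  have "eventually (\<lambda>Q. 2 * b * m / c \<le> Q powr (r - 1 / m)) at_top"
    using eventually_ge_at_top[of "(2 * b * m / c) powr (1 / (r - 1 / m))"]
  proof eventually_elim
    case (elim Q)
    then have "((2 * b * m / c) powr (1 / (r - 1 / m))) powr (r - 1 / m) \<le> Q powr (r - 1 / m)"
      using r by (intro powr_mono2) auto
    then show ?case using r b c m by (simp add: powr_powr)
  qed
  then show "\<forall>\<^sub>F Q in at_top. approximable N x Q (c * Q powr (- 1 / real CARD('n)))"
    using eventually_ge_at_top[of 1]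
  proof eventually_elim
    case (elim Q)
    \<comment> \<open>With \<open>r = 1 / (m - 1)\<close> this keeps the denominator, at most
      \<open>M ^ (m - 1)\<close>, below \<open>Q\<close>.\<close>
    define M where "M = nat \<lfloor>Q powr r\<rfloor>"
    have "Q powr r \<ge> 1" using elim r by (intro ge_one_powr_ge_zero) auto
    then have M: "M > 0" "real M \<le> Q powr r" "Q powr r \<le> 2 * real M"
    proof -
      have "real M = of_int \<lfloor>Q powr r\<rfloor>" using \<open>Q powr r \<ge> 1\<close> by (simp add: M_def)
      moreover have "\<lfloor>Q powr r\<rfloor> \<ge> 1" using \<open>Q powr r \<ge> 1\<close> by simp
      ultimately have "real M \<ge> 1" "real M \<le> Q powr r" "Q powr r < real M + 1" by linarith+
      then show "M > 0" "real M \<le> Q powr r" "Q powr r \<le> 2 * real M" by linarith+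
    qed
    obtain q p where q: "0 < q" "q \<le> int (M ^ (m - 1))"
      and p: "\<And>i. i < m - 1 \<Longrightarrow> \<bar>of_int q * x $ h i - of_int (p i)\<bar> < 1 / M"
      using Dirichlet_approx_simult[OF M(1), of "m - 1" "\<lambda>i. x $ h i"] by metis
    define p' :: "int ^ 'n" where "p' = (\<chi> j. if j = k then 0 else p (g j))"
    have comp: "\<bar>(of_int q *\<^sub>R x - (\<chi> i. of_int (p' $ i))) $ j\<bar> \<le> 1 / M" for j
    proof (cases "j = k")
      case False
      then show ?thesis using p[OF g(1)[OF False]] g(2)[OF False] by (simp add: p'_def)
    qed (simp add: p'_def x)
    have "norm (of_int q *\<^sub>R x - (\<chi> i. of_int (p' $ i))) \<le> (\<Sum>j\<in>(UNIV :: 'n set). 1 / M)"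
      by (rule order_trans[OF norm_le_l1_cart]) (intro sum_mono comp)
    then have "norm (of_int q *\<^sub>R x - (\<chi> i. of_int (p' $ i))) \<le> m / M" by (simp add: m_def)
    then have "N (of_int q *\<^sub>R x - (\<chi> i. of_int (p' $ i))) \<le> b * (m / M)"
      using b(2) mult_left_mono[OF _ less_imp_le[OF b(1)]] by (meson order_trans)
    also have "\<dots> \<le> 2 * b * m / Q powr r"
    proof -
      have "real m * Q powr r \<le> real m * (2 * real M)" using M by (intro mult_left_mono) auto
      then show ?thesis using M b elim by (simp add: field_simps)
    qed
    also have "\<dots> \<le> c * Q powr (- 1 / m)"
    proof -
      have "2 * b * m \<le> c * Q powr (r - 1 / m)" using elim(1) c by (simp add: field_simps)
      also have "Q powr (r - 1 / m) = Q powr (- 1 / m) * Q powr r" by (simp flip: powr_add)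
      finally show ?thesis using elim by (simp add: field_simps)
    qed
    finally have "N (of_int q *\<^sub>R x - (\<chi> i. of_int (p' $ i))) \<le> c * Q powr (- 1 / real CARD('n))"
      by (simp add: m_def)
    moreover have "of_int q \<le> Q"
    proof -
      have "real_of_int q \<le> real M ^ (m - 1)" using q(2) by (metis of_int_le_iff of_int_of_nat_eq of_nat_power)
      also have "\<dots> \<le> (Q powr r) ^ (m - 1)" using M by (intro power_mono) auto
      also have "\<dots> = Q" using elim m by (simp add: r_def powr_realpow[symmetric] powr_powr)
      finally show ?thesis .
    qed
    ultimately show ?case using q(1) unfolding approximable_def by (intro exI[of _ q] exI[of _ p']) simp
  qed
qed

text \<open>Take \<open>x\<close> supported on coordinate \<open>k\<close> and cancelling that
  coordinate of \<open>z\<close>: then \<open>x\<close> vanishes at \<open>l\<close> and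
  \<open>z + \<sigma> *\<^sub>R x\<close> at \<open>k\<close>.\<close>

lemma singular_set_sum:
  fixes N :: "real ^ 'n \<Rightarrow> real"
  assumes N: "is_norm N" and card: "CARD('n) \<ge> 2" and \<sigma>: "\<sigma> * \<sigma> = (1::real)"
  obtains x where "x \<in> singular_set N" "z + \<sigma> *\<^sub>R x \<in> singular_set N"
proof -
  obtain k l :: 'n where kl: "k \<noteq> l"
    using card card_le_Suc0_iff_eq[of "UNIV :: 'n set"] by auto
  define x where "x = (\<chi> i. if i = k then - \<sigma> * z $ k else 0)"
  show ?thesis
  proof (rule that)
    show "x \<in> singular_set N"
      by (rule singular_set_if_coordinate_zero[OF N card, of _ l]) (use kl in \<open>simp add: x_def\<close>)
    show "z + \<sigma> *\<^sub>R x \<in> singular_set N"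
      by (rule singular_set_if_coordinate_zero[OF N card, of _ k]) (simp add: x_def mult.assoc[symmetric] \<sigma>)
  qed
qed

text \<open>Sandwiching \<open>Q\<close> between \<open>D ^ i\<close> and \<open>D ^ Suc i\<close>
  turns the real parameter into a discrete scale matching the cells; infinite order permits any
  \<open>w\<close>.\<close>

lemma W_infty_approx:
  fixes N :: "real ^ 'n \<Rightarrow> real"
  assumes a: "a > 0" "\<And>v. a * norm v \<le> N v" and x: "x \<in> W_infty N" and D: "D \<ge> 2"
  obtains i q p where "i \<ge> n" "1 \<le> q" "q \<le> D ^ Suc i"
    "\<And>j. \<bar>real q * x $ j - of_int (p j)\<bar> \<le> 1 / (a * real D ^ (i * w))"
proof -
  have "ereal (real w) < omega N x" using x by (simp add: W_infty_def)
  then obtain w' :: real where w': "real w < w'" and fr: "\<exists>\<^sub>F Q in at_top. approximable N x Q (Q powr (- w'))"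
    unfolding omega_def less_Sup_iff by auto
  obtain Q where Q: "Q \<ge> real D ^ n" "approximable N x Q (Q powr (- w'))"
    using fr unfolding frequently_def eventually_at_top_linorder by blast
  have Dn: "real D ^ n \<ge> 1" using D by simp
  define k where "k = nat \<lfloor>Q\<rfloor>"
  have k: "real k \<le> Q" "Q < real k + 1" "k \<ge> 1" using Q(1) Dn unfolding k_def by linarith+
  obtain i where i: "D ^ i \<le> k" "k < D ^ (i + 1)" using ex_power_ivl1[OF D k(3)] by blast
  have DiQ: "real D ^ i \<le> Q" using i(1) k(1) by (metis of_nat_le_iff of_nat_power order_trans)
  have "real (k + 1) \<le> real (D ^ (i + 1))" using i(2) by (simp only: of_nat_le_iff Suc_eq_plus1[symmetric] Suc_le_eq)
  then have QD: "Q < real D ^ Suc i" using k by simp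
  obtain q p where q: "1 \<le> q" "of_int q \<le> Q"
    and p: "N (of_int q *\<^sub>R x - (\<chi> i. of_int (p $ i))) \<le> Q powr (- w')"
    using Q(2) unfolding approximable_def by blast
  show ?thesis
  proof (rule that)
    show "i \<ge> n"
    proof (rule ccontr)
      assume "\<not> i \<ge> n"
      then have "real D ^ Suc i \<le> real D ^ n" using D by (intro power_increasing) auto
      then show False using QD Q(1) by linarith
    qed
    show "1 \<le> nat q" using q(1) by simp
    have "real (nat q) < real (D ^ Suc i)" using q QD by simp
    then show "nat q \<le> D ^ Suc i" by (simp only: of_nat_less_iff less_imp_le)
    have Q1: "Q \<ge> 1" using Q(1) Dn by linarith
    have "Q powr (- w') \<le> Q powr (- real w)" using Q1 w' by (intro powr_mono) auto
    also have "\<dots> = 1 / Q ^ w" using Q1 by (simp add: powr_minus powr_realpow inverse_eq_divide)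
    also have "\<dots> \<le> 1 / (real D ^ i) ^ w"
      using DiQ D Q1 by (intro divide_left_mono power_mono mult_pos_pos zero_less_power) auto
    finally have Qw: "Q powr (- w') \<le> 1 / real D ^ (i * w)" by (simp add: power_mult)
    show "\<bar>real (nat q) * x $ j - of_int (p $ j)\<bar> \<le> 1 / (a * real D ^ (i * w))" for j
    proof -
      have "a * \<bar>of_int q * x $ j - of_int (p $ j)\<bar> \<le> a * norm (of_int q *\<^sub>R x - (\<chi> i. of_int (p $ i)))"
        using component_le_norm_cart[of "of_int q *\<^sub>R x - (\<chi> i. of_int (p $ i))" j] a by simp
      also have "\<dots> \<le> 1 / real D ^ (i * w)" using a(2)[of "of_int q *\<^sub>R x - (\<chi> i. of_int (p $ i))"] p Qw by linarith
      finally show ?thesis using a q D by (simp add: field_simps)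
    qed
  qed
qed

section \<open>Covering sums of very well approximable and singular vectors\<close>

definition rational_pts :: "nat \<Rightarrow> nat \<Rightarrow> (real ^ 'n) set" where
  "rational_pts H L = (\<lambda>(q::nat, p :: 'n \<Rightarrow> int). \<chi> j. of_int (p j) / real q) ` ({1..H} \<times> PiE UNIV (\<lambda>_. {- int (L * H)..int (L * H)}))"

lemma finite_rational_pts: "finite (rational_pts H L)"
  unfolding rational_pts_def by (intro finite_imageI finite_cartesian_product finite_PiE) auto

lemma card_rational_pts: "card (rational_pts H L :: (real ^ 'n) set) \<le> H * (2 * L * H + 1) ^ CARD('n)"
proof -
  have "card (rational_pts H L :: (real ^ 'n) set) \<le> card ({1..H} \<times> PiE (UNIV :: 'n set) (\<lambda>_. {- int (L * H)..int (L * H)}))"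
    unfolding rational_pts_def by (intro card_image_le finite_cartesian_product finite_PiE) auto
  also have "\<dots> = card {1..H} * card {- int (L * H)..int (L * H)} ^ CARD('n)"
    by (simp only: card_cartesian_product card_PiE[OF finite] prod_constant)
  also have "\<dots> = H * (2 * L * H + 1) ^ CARD('n)"
  proof -
    have "card {- int k..int k} = 2 * k + 1" for k unfolding card_atLeastAtMost_int by linarith
    then show ?thesis by (simp only: card_atLeastAtMost diff_Suc_1 mult.assoc)
  qed
  finally show ?thesis .
qed

lemma hausdorff_dim_W_infty_plus_singular:
  fixes N :: "real ^ 'n \<Rightarrow> real"
  assumes N: "is_norm N" and \<sigma>: "\<bar>\<sigma>\<bar> = (1::real)"
  shows "hausdorff_dim {x + \<sigma> *\<^sub>R y |x y. x \<in> W_infty N \<and> y \<in> singular_set N} < ereal (real CARD('n))"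
proof -
  define m where "m = CARD('n)"
  have m: "m \<ge> 1" by (simp add: m_def Suc_leI)
  obtain a where a: "a > 0" "\<And>v. a * norm v \<le> N v" using is_norm_ge_norm[OF N] by blast
  obtain e T where e: "e \<ge> 4" and "\<And>j0 l. \<exists>c. \<forall>n. \<exists>P. finite P \<and>
      real (card P) \<le> c * (real (refine_factor TYPE('n) e) ^ CARD('n) / 2) ^ n \<and>
      (\<forall>y \<in> cusp_set e T j0 l :: (real ^ 'n) set. \<exists>p\<in>P. \<forall>i. \<bar>y $ i - p $ i\<bar> \<le> 1 / real (refine_factor TYPE('n) e) ^ n)"
    using cusp_set_cover[where 'n = 'n] by blast
  then obtain c P where P: "\<And>j0 l n. finite (P j0 l n)"
      "\<And>j0 l n. real (card (P j0 l n)) \<le> c j0 l * (real (refine_factor TYPE('n) e) ^ CARD('n) / 2) ^ n"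
      "\<And>j0 l n y. (y :: real ^ 'n) \<in> cusp_set e T j0 l \<Longrightarrow> \<exists>p\<in>P j0 l n. \<forall>i. \<bar>y $ i - p $ i\<bar> \<le> 1 / real (refine_factor TYPE('n) e) ^ n"
    by metis
  define D where "D = refine_factor TYPE('n) e"
  have D: "D \<ge> 2"
  proof -
    have "e ^ 1 \<le> D" unfolding D_def refine_factor_def using e by (intro power_increasing) auto
    then show ?thesis using e by simp
  qed
  \<comment> \<open>Halfway between \<open>m\<close> and the bound \<open>m - ln 2 / ln D\<close>
    for the box dimension of the cusp sets, so each level of cells costs
    \<open>1 / sqrt 2\<close>.\<close>
  define t where "t = m - ln 2 / (2 * ln D)"
  have lnD: "ln 2 \<le> ln (real D)" "ln (2::real) > 0" using D by auto
  have t: "t > 0" "t < m"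
  proof -
    have "u / (2 * v) \<le> 1 / 2" if "u \<le> v" "u > 0" for u v :: real
      using that by (simp add: divide_le_eq)
    from this[OF lnD] have "ln 2 / (2 * ln (real D)) \<le> 1 / 2" .
    moreover have "real m \<ge> 1" using m by simp
    ultimately show "t > 0" unfolding t_def by linarith
    have "0 < ln (real D)" by (rule less_le_trans[OF lnD(2,1)])
    then have "0 < ln 2 / (2 * ln (real D))" by (intro divide_pos_pos mult_pos_pos lnD(2)) simp_all
    then show "t < m" by (simp add: t_def)
  qed
  have Dt: "real D ^ m / 2 * real D powr (- t) = 1 / sqrt 2"
  proof -
    have "real D powr (- t) = exp (- (m * ln D) + ln 2 / 2)"
      using D lnD by (simp add: powr_def t_def field_simps)
    also have "\<dots> = exp (ln 2 / 2) / exp (m * ln D)" unfolding exp_diff[symmetric] by simp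
    also have "exp (m * ln D) = real D ^ m" using D by (simp add: exp_of_nat_mult)
    also have "exp (ln 2 / 2) = sqrt (2::real)"
    proof (rule real_sqrt_unique[symmetric])
      have "(exp (ln 2 / 2))\<^sup>2 = exp (ln 2 / 2 + ln 2 / 2 :: real)" by (simp only: exp_add power2_eq_square)
      then show "(exp (ln 2 / 2))\<^sup>2 = (2::real)" by simp
    qed simp
    finally have "real D ^ m / 2 * real D powr (- t) = sqrt 2 / 2" using D by simp
    also have "\<dots> = 1 / sqrt 2"
      using real_sqrt_mult_self[of 2] by (simp add: divide_eq_eq eq_divide_eq del: real_sqrt_mult_self)
    finally show ?thesis .
  qed
  \<comment> \<open>The \<open>w\<close> levels per step outweigh the growth
    \<open>D ^ Suc m\<close> of the number of rational points, leaving a ratio below 1/2.\<close>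
  obtain w where w: "(1 / sqrt 2) ^ w < 1 / (2 * real D ^ Suc m)"
    using real_arch_pow_inv[of "1 / (2 * real D ^ Suc m)" "1 / sqrt 2"] D by auto
  have null: "hausdorff_measure t {x + \<sigma> *\<^sub>R y |x y. x \<in> W_infty N \<and> (\<forall>i. \<bar>x $ i\<bar> \<le> l) \<and> y \<in> cusp_set e T j0 l} = 0" for j0 l :: nat
  proof -
    \<comment> \<open>Allows for the approximation error, at most \<open>1 / a\<close>, in bounding
      the numerators by those of a box of size \<open>l + A\<close>.\<close>
    obtain A :: nat where A: "real A \<ge> 1 / a" using real_arch_simple by blast
    define PP where "PP i = (\<lambda>(r, p). r + \<sigma> *\<^sub>R p) ` (rational_pts (D ^ Suc i) (l + A) \<times> P j0 l (i * w))" for i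
    \<comment> \<open>Per coordinate, \<open>1 / a\<close> comes from the rational approximation and
      1 from the cell; the factor \<open>m\<close> passes to the Euclidean norm.\<close>
    define B where "B = m * (1 / a + 1)"
    define r where "r i = B / real D ^ (i * w)" for i
    have B: "B > 0" using m a by (simp add: B_def add_pos_pos)
    define C where "C = real D * (3 * (l + A + 1) * real D) ^ m * c j0 l * (2 * B) powr t"
    have "w > 0"
    proof (rule ccontr)
      assume "\<not> w > 0"
      moreover have "1 \<le> 2 * real D ^ Suc m" using one_le_power[of "real D" "Suc m"] D by linarith
      ultimately show False using w by (simp add: field_simps)
    qed
    have bound: "real (card (PP i)) * (2 * r i) powr t \<le> C * (1 / 2) ^ i" for i
    proof -
      have D1: "real D ^ Suc i \<ge> 1" using D by (intro one_le_power) auto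
      have eqr: "(2 * r i) powr t = (2 * B) powr t * (real D powr (- t)) ^ (i * w)"
      proof -
        have "(2 * r i) powr t = (2 * B) powr t / (real D ^ (i * w)) powr t"
          using B D by (simp add: r_def powr_divide)
        also have "(real D ^ (i * w)) powr t = (real D powr t) ^ (i * w)"
          using D by (simp add: powr_realpow[symmetric] powr_powr mult.commute)
        finally show ?thesis by (simp add: powr_minus power_inverse inverse_eq_divide power_one_over)
      qed
      have "card (PP i) \<le> card (rational_pts (D ^ Suc i) (l + A) :: (real ^ 'n) set) * card (P j0 l (i * w))"
        unfolding PP_def using card_image_le[OF finite_cartesian_product[OF finite_rational_pts P(1)]]
        by (metis card_cartesian_product)
      then have "real (card (PP i)) \<le> real (card (rational_pts (D ^ Suc i) (l + A) :: (real ^ 'n) set)) * real (card (P j0 l (i * w)))"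
        by (metis of_nat_le_iff of_nat_mult)
      also have "\<dots> \<le> (real D ^ Suc i * (3 * (l + A + 1) * real D ^ Suc i) ^ m) * (c j0 l * (real D ^ m / 2) ^ (i * w))"
      proof (intro mult_mono)
        have "real (card (rational_pts (D ^ Suc i) (l + A) :: (real ^ 'n) set)) \<le> real (D ^ Suc i * (2 * (l + A) * D ^ Suc i + 1) ^ m)"
          unfolding m_def by (simp only: of_nat_le_iff card_rational_pts)
        also have "\<dots> = real D ^ Suc i * (2 * (real l + real A) * real D ^ Suc i + 1) ^ m" by (simp add: add.commute)
        also have "\<dots> \<le> real D ^ Suc i * (3 * (l + A + 1) * real D ^ Suc i) ^ m"
        proof (intro mult_left_mono power_mono)
          have "2 * (real l + real A) * real D ^ Suc i + 1 \<le> 2 * (real l + real A) * real D ^ Suc i + real D ^ Suc i"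
            using D1 by linarith
          also have "\<dots> = (2 * (real l + real A) + 1) * real D ^ Suc i" by (simp only: distrib_right mult_1)
          also have "\<dots> \<le> 3 * (l + A + 1) * real D ^ Suc i" using D1 by (intro mult_right_mono) auto
          finally show "2 * (real l + real A) * real D ^ Suc i + 1 \<le> 3 * (l + A + 1) * real D ^ Suc i" .
        qed auto
        finally show "real (card (rational_pts (D ^ Suc i) (l + A) :: (real ^ 'n) set)) \<le> real D ^ Suc i * (3 * (l + A + 1) * real D ^ Suc i) ^ m" .
        show "real (card (P j0 l (i * w))) \<le> c j0 l * (real D ^ m / 2) ^ (i * w)"
          using P(2)[of j0 l "i * w"] by (simp add: D_def m_def)
      qed auto
      finally have "real (card (PP i)) * (2 * r i) powr t \<le>
          (real D ^ Suc i * (3 * (l + A + 1) * real D ^ Suc i) ^ m) * (c j0 l * (real D ^ m / 2) ^ (i * w)) * (2 * r i) powr t"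
        by (intro mult_right_mono) auto
      also have "\<dots> = C * ((real D ^ Suc m) ^ i * ((real D ^ m / 2 * real D powr (- t)) ^ w) ^ i)"
      proof -
        have 1: "E ^ (i * w) * F ^ (i * w) = ((E * F) ^ w) ^ i" for E F :: real
          by (simp only: power_mult_distrib power_mult[symmetric] mult.commute[of w i])
        have 2: "x ^ Suc i * (k * x ^ Suc i) ^ m = x * (k * x) ^ m * (x ^ Suc m) ^ i" for k x :: real
          by (simp add: power_mult_distrib power_mult[symmetric] mult_ac)
        have "X * (cc * p) * (bb * q) = X * cc * bb * (p * q)" for X cc p bb q :: real by simp
        note this[of "real D ^ Suc i * (3 * (l + A + 1) * real D ^ Suc i) ^ m" "c j0 l" "(real D ^ m / 2) ^ (i * w)"
            "(2 * B) powr t" "(real D powr (- t)) ^ (i * w)"]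
        then show ?thesis unfolding eqr 1 2 C_def by (simp only: mult.assoc mult.left_commute mult.commute)
      qed
      also have "\<dots> = C * (real D ^ Suc m * (1 / sqrt 2) ^ w) ^ i"
        unfolding Dt power_mult_distrib ..
      also have "\<dots> \<le> C * (1 / 2) ^ i"
      proof (intro mult_left_mono power_mono)
        have "real D ^ Suc m * (1 / sqrt 2) ^ w \<le> real D ^ Suc m * (1 / (2 * real D ^ Suc m))"
          by (intro mult_left_mono less_imp_le[OF w]) simp
        also have "\<dots> = 1 / 2" using D by simp
        finally show "real D ^ Suc m * (1 / sqrt 2) ^ w \<le> 1 / 2" .
        have "real (card (P j0 l 0)) \<le> c j0 l" using P(2)[of j0 l 0] by simp
        then have "0 \<le> c j0 l" by (rule order_trans[OF of_nat_0_le_iff])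
        then show "0 \<le> C" by (simp add: C_def)
      qed auto
      finally show ?thesis .
    qed
    show ?thesis
    proof (rule hausdorff_measure_limsup_null[OF t(1)])
      show "finite (PP i)" for i
        unfolding PP_def by (intro finite_imageI finite_cartesian_product finite_rational_pts P)
      show "r i > 0" for i using B D by (simp add: r_def)
      have "(\<lambda>i. B * (1 / real D ^ w) ^ i) \<longlonglongrightarrow> B * 0"
        using D \<open>w > 0\<close> by (intro tendsto_mult_left LIMSEQ_power_zero) (auto simp: one_less_power)
      then show "r \<longlonglongrightarrow> 0"
        by (simp add: r_def[abs_def] power_one_over power_mult[symmetric] mult.commute)
      show "summable (\<lambda>i. real (card (PP i)) * (2 * r i) powr t)"
        by (rule summable_comparison_test'[where g = "\<lambda>i. C * (1 / 2) ^ i"]) (use bound in \<open>auto intro!: summable_mult summable_geometric\<close>)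
      fix z assume "z \<in> {x + \<sigma> *\<^sub>R y |x y. x \<in> W_infty N \<and> (\<forall>i. \<bar>x $ i\<bar> \<le> l) \<and> y \<in> cusp_set e T j0 l}"
      then obtain x y where z: "z = x + \<sigma> *\<^sub>R y" and x: "x \<in> W_infty N" "\<And>i. \<bar>x $ i\<bar> \<le> l" and y: "y \<in> cusp_set e T j0 l"
        by blast
      show "\<exists>\<^sub>\<infinity>i. \<exists>p\<in>PP i. dist z p \<le> r i"
        unfolding INFM_nat_le
      proof
        fix n
        obtain i q p where i: "i \<ge> n" and q: "1 \<le> q" "q \<le> D ^ Suc i"
          and p: "\<And>j. \<bar>real q * x $ j - of_int (p j)\<bar> \<le> 1 / (a * real D ^ (i * w))"
          using W_infty_approx[OF a x(1) D, of n w] by metis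
        obtain s where s: "s \<in> P j0 l (i * w)" "\<And>j. \<bar>y $ j - s $ j\<bar> \<le> 1 / real D ^ (i * w)"
          using P(3)[OF y, of "i * w"] unfolding D_def by blast
        define u :: "real ^ 'n" where "u = (\<chi> j. of_int (p j) / real q)"
        have Dw: "real D ^ (i * w) \<ge> 1" using D by (intro one_le_power) auto
        have "u \<in> rational_pts (D ^ Suc i) (l + A)"
        proof -
          have "p j \<in> {- int ((l + A) * D ^ Suc i)..int ((l + A) * D ^ Suc i)}" for j
          proof -
            have D1: "real D ^ Suc i \<ge> 1" using D by (intro one_le_power) auto
            have "1 / (a * real D ^ (i * w)) \<le> 1 / (a * 1)" using a Dw D by (intro divide_left_mono mult_left_mono) auto
            also have "\<dots> \<le> real A * 1" using A by simp
            also have "\<dots> \<le> real A * real D ^ Suc i" using D1 by (intro mult_left_mono) auto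
            finally have 1: "\<bar>real q * x $ j - of_int (p j)\<bar> \<le> real A * real D ^ Suc i" using p[of j] by linarith
            have "real q \<le> real D ^ Suc i" using q(2) by (metis of_nat_le_iff of_nat_power)
            then have "\<bar>real q * x $ j\<bar> \<le> real D ^ Suc i * l"
              unfolding abs_mult using x(2) by (intro mult_mono) auto
            with 1 have "\<bar>of_int (p j)\<bar> \<le> (real l + real A) * real D ^ Suc i"
              unfolding distrib_right by (simp only: mult.commute[of "real D ^ Suc i"])
            then have "real_of_int \<bar>p j\<bar> \<le> real_of_int (int ((l + A) * D ^ Suc i))" by simp
            then have "\<bar>p j\<bar> \<le> int ((l + A) * D ^ Suc i)" by (simp only: of_int_le_iff)
            then show ?thesis unfolding atLeastAtMost_iff by linarith
          qed
          then show ?thesis unfolding rational_pts_def u_def using q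
            by (intro image_eqI[of _ _ "(q, p)"]) auto
        qed
        then have mem: "u + \<sigma> *\<^sub>R s \<in> PP i" unfolding PP_def using s(1) by (intro image_eqI[of _ _ "(u, s)"]) auto
        have xu: "\<bar>x $ j - u $ j\<bar> \<le> 1 / a / real D ^ (i * w)" for j
        proof -
          have "x $ j - u $ j = (real q * x $ j - of_int (p j)) / real q" using q by (simp add: u_def diff_divide_distrib)
          then have "\<bar>x $ j - u $ j\<bar> = \<bar>real q * x $ j - of_int (p j)\<bar> / real q" by (simp add: abs_divide)
          also have "\<dots> \<le> \<bar>real q * x $ j - of_int (p j)\<bar> / 1" using q by (intro divide_left_mono) auto
          finally show ?thesis using p[of j] by simp
        qed
        have "\<bar>(z - (u + \<sigma> *\<^sub>R s)) $ j\<bar> \<le> (1 / a + 1) / real D ^ (i * w)" for j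
        proof -
          have "(z - (u + \<sigma> *\<^sub>R s)) $ j = (x $ j - u $ j) + \<sigma> * (y $ j - s $ j)" by (simp add: z algebra_simps)
          also have "\<bar>\<dots>\<bar> \<le> \<bar>x $ j - u $ j\<bar> + \<bar>y $ j - s $ j\<bar>"
            using abs_triangle_ineq[of "x $ j - u $ j" "\<sigma> * (y $ j - s $ j)"] by (simp only: abs_mult \<sigma> mult_1)
          also have "\<dots> \<le> 1 / a / real D ^ (i * w) + 1 / real D ^ (i * w)" by (intro add_mono xu s)
          finally show ?thesis by (simp add: add_divide_distrib)
        qed
        then have "norm (z - (u + \<sigma> *\<^sub>R s)) \<le> (\<Sum>j\<in>(UNIV :: 'n set). (1 / a + 1) / real D ^ (i * w))"
          by (intro order_trans[OF norm_le_l1_cart] sum_mono) auto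
        then have "dist z (u + \<sigma> *\<^sub>R s) \<le> r i" by (simp add: dist_norm r_def B_def m_def)
        then show "\<exists>i\<ge>n. \<exists>p\<in>PP i. dist z p \<le> r i" using i mem by blast
      qed
    qed
  qed
  have "hausdorff_measure t {x + \<sigma> *\<^sub>R y |x y. x \<in> W_infty N \<and> y \<in> singular_set N} = 0"
  proof (rule hausdorff_measure_countable_Union_null[of UNIV])
    show "hausdorff_measure t ((\<lambda>(j0, l). {x + \<sigma> *\<^sub>R y |x y. x \<in> W_infty N \<and> (\<forall>i. \<bar>x $ i\<bar> \<le> real l) \<and> y \<in> cusp_set e T j0 l}) k) = 0" for k :: "nat \<times> nat"
      using null by (cases k) simp
    show "{x + \<sigma> *\<^sub>R y |x y. x \<in> W_infty N \<and> y \<in> singular_set N} \<subseteq>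
        (\<Union>k\<in>UNIV. (\<lambda>(j0, l). {x + \<sigma> *\<^sub>R y |x y. x \<in> W_infty N \<and> (\<forall>i. \<bar>x $ i\<bar> \<le> real l) \<and> y \<in> cusp_set e T j0 l}) k)"
    proof
      fix z assume "z \<in> {x + \<sigma> *\<^sub>R y |x y. x \<in> W_infty N \<and> y \<in> singular_set N}"
      then obtain x y where z: "z = x + \<sigma> *\<^sub>R y" and x: "x \<in> W_infty N" and y: "y \<in> singular_set N" by blast
      obtain j0 l where jl: "y \<in> cusp_set e T j0 l"
        using singular_set_subset_cusp_sets[OF N y e] by blast
      \<comment> \<open>One bound has to serve both summands; \<open>cusp_set\<close> grows with
        it.\<close>
      obtain l' :: nat where l': "real l' \<ge> max (real l) (norm x)" using real_arch_simple by blast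
      have "y \<in> cusp_set e T j0 l'" using jl l' unfolding cusp_set_def by (auto intro: order_trans)
      moreover have "\<bar>x $ i\<bar> \<le> real l'" for i using component_le_norm_cart[of x i] l' by simp
      ultimately show "z \<in> (\<Union>k\<in>UNIV. (\<lambda>(j0, l). {x + \<sigma> *\<^sub>R y |x y. x \<in> W_infty N \<and> (\<forall>i. \<bar>x $ i\<bar> \<le> real l) \<and> y \<in> cusp_set e T j0 l}) k)"
        using x z by (intro UN_I[of "(j0, l')"]) auto
    qed
  qed simp
  then have "hausdorff_dim {x + \<sigma> *\<^sub>R y |x y. x \<in> W_infty N \<and> y \<in> singular_set N} \<le> ereal t"
    using t by (intro hausdorff_dim_le) auto
  also have "\<dots> < ereal m" using t by simp
  finally show ?thesis by (simp add: m_def)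
qed

section \<open>Sets adapted to all four operations\<close>

definition real_op :: "arith_op \<Rightarrow> real \<Rightarrow> real \<Rightarrow> real" where
  "real_op opr = (case opr of Op_Add \<Rightarrow> (+) | Op_Sub \<Rightarrow> (-) | Op_Mul \<Rightarrow> (*) | Op_Div \<Rightarrow> (/))"

lemma set_op_eq:
  "set_op opr A B = {(\<chi> i. real_op opr (a $ i) (b $ i)) | a b. a \<in> A \<and> b \<in> B \<and> (opr = Op_Div \<longrightarrow> (\<forall>i. b $ i \<noteq> 0))}"
  by (cases opr) (simp_all add: real_op_def)

text \<open>The two exponentials reach the nonzero products and quotients of both signs. They never
  vanish, so the zero function is added for \<open>z = 0\<close>.\<close>

definition exp_branches :: "(real \<Rightarrow> real) set" where
  "exp_branches = {\<lambda>x. x, exp, \<lambda>x. - exp x, \<lambda>x. 0}"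

text \<open>Exponentials turn a set that solves \<open>z = a + b\<close> and \<open>z = a - b\<close> into one that also solves
  \<open>z = a * b\<close> and \<open>z = a / b\<close>.\<close>
definition exp_closure :: "real set \<Rightarrow> real set" where
  "exp_closure F = (\<Union>g\<in>exp_branches. g ` F)"

definition vec_power :: "real set \<Rightarrow> (real ^ 'n) set" where
  "vec_power T = {v. \<forall>i. v $ i \<in> T}"

lemma exp_closure_op_surj:
  assumes add: "\<And>z. \<exists>a\<in>F. \<exists>b\<in>F. z = a + b" and sub: "\<And>z. \<exists>a\<in>F. \<exists>b\<in>F. z = a - b"
  shows "\<exists>a\<in>exp_closure F. \<exists>b\<in>exp_closure F. z = real_op opr a b \<and> (opr = Op_Div \<longrightarrow> b \<noteq> 0)"
proof -
  have mem: "x \<in> exp_closure F" "exp x \<in> exp_closure F" "- exp x \<in> exp_closure F" "0 \<in> exp_closure F" if "x \<in> F" for x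
    using that by (auto simp: exp_closure_def exp_branches_def)
  obtain c where c: "c \<in> F" using add by blast
  show ?thesis
  proof (cases opr)
    case Op_Add
    obtain a b where "a \<in> F" "b \<in> F" "z = a + b" using add by blast
    then show ?thesis
      unfolding Op_Add real_op_def arith_op.case using mem(1)
      by (intro bexI[of _ a] bexI[of _ b]) auto
  next
    case Op_Sub
    obtain a b where "a \<in> F" "b \<in> F" "z = a - b" using sub by blast
    then show ?thesis
      unfolding Op_Sub real_op_def arith_op.case using mem(1)
      by (intro bexI[of _ a] bexI[of _ b]) auto
  next
    case Op_Mul
    \<comment> \<open>For \<open>z = 0\<close> the value of \<open>ln \<bar>z\<bar>\<close> is
      immaterial: that case uses the zero branch.\<close>
    obtain a b where ab: "a \<in> F" "b \<in> F" "ln \<bar>z\<bar> = a + b" using add by blast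
    then have "z \<noteq> 0 \<Longrightarrow> \<bar>z\<bar> = exp a * exp b" by (metis exp_add exp_ln zero_less_abs_iff)
    then consider "z = 0 * 0" | "z = exp a * exp b" | "z = - exp a * exp b" by fastforce
    then show ?thesis
    proof cases
      case 1
      then show ?thesis using mem(4)[OF c] by (intro bexI[of _ 0]) (auto simp: Op_Mul real_op_def)
    next
      case 2
      then show ?thesis using mem ab by (intro bexI[of _ "exp a"] bexI[of _ "exp b"]) (auto simp: Op_Mul real_op_def)
    next
      case 3
      then show ?thesis using mem ab by (intro bexI[of _ "- exp a"] bexI[of _ "exp b"]) (auto simp: Op_Mul real_op_def)
    qed
  next
    case Op_Div
    obtain a b where ab: "a \<in> F" "b \<in> F" "ln \<bar>z\<bar> = a - b" using sub by blast
    then have "z \<noteq> 0 \<Longrightarrow> \<bar>z\<bar> = exp a / exp b" by (metis exp_diff exp_ln zero_less_abs_iff)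
    then consider "z = 0 / exp b" | "z = exp a / exp b" | "z = - exp a / exp b" by fastforce
    then show ?thesis
    proof cases
      case 1
      then show ?thesis using mem ab by (intro bexI[of _ 0] bexI[of _ "exp b"]) (auto simp: Op_Div real_op_def)
    next
      case 2
      then show ?thesis using mem ab by (intro bexI[of _ "exp a"] bexI[of _ "exp b"]) (auto simp: Op_Div real_op_def)
    next
      case 3
      then show ?thesis using mem ab by (intro bexI[of _ "- exp a"] bexI[of _ "exp b"]) (auto simp: Op_Div real_op_def)
    qed
  qed
qed

lemma set_op_vec_power_eq_UNIV:
  assumes "\<And>z. \<exists>a\<in>T. \<exists>b\<in>T. z = real_op opr a b \<and> (opr = Op_Div \<longrightarrow> b \<noteq> 0)"
  shows "set_op opr (vec_power T) (vec_power T) = (UNIV :: (real ^ 'n) set)"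
proof (rule UNIV_eq_I[symmetric])
  fix z :: "real ^ 'n"
  have "\<exists>a b. a \<in> T \<and> b \<in> T \<and> z $ i = real_op opr a b \<and> (opr = Op_Div \<longrightarrow> b \<noteq> 0)" for i
    using assms[of "z $ i"] by blast
  then obtain a b where ab: "\<And>i. a i \<in> T \<and> b i \<in> T \<and> z $ i = real_op opr (a i) (b i) \<and> (opr = Op_Div \<longrightarrow> b i \<noteq> 0)"
    using assms by metis
  show "z \<in> set_op opr (vec_power T) (vec_power T)"
    unfolding set_op_eq mem_Collect_eq
    by (rule exI[of _ "\<chi> i. a i"], rule exI[of _ "\<chi> i. b i"]) (use ab in \<open>auto simp: vec_power_def vec_eq_iff\<close>)
qed

section \<open>The two building blocks on the line\<close>

definition liouville_like :: "real set" where
  "liouville_like = (\<Inter>n. dyadic_nbhd (\<lambda>i. (1 / 16) ^ i) n)"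

lemma liouville_like_sum:
  assumes "\<sigma> * \<sigma> = (1::real)"
  obtains x where "x \<in> liouville_like" "z + \<sigma> * x \<in> liouville_like"
proof -
  obtain x where x: "\<And>n. x \<in> dyadic_nbhd (\<lambda>i. (1 / 16) ^ i) n" "\<And>n. z + \<sigma> *\<^sub>R x \<in> dyadic_nbhd (\<lambda>i. (1 / 16) ^ i) n"
    by (rule comeagre_sum[of "dyadic_nbhd (\<lambda>i. (1 / 16) ^ i)" \<sigma> z])
       (use assms in \<open>auto simp: open_dyadic_nbhd closure_dyadic_nbhd\<close>)
  have "x \<in> liouville_like" unfolding liouville_like_def using x(1) by (rule INT_I)
  moreover have "z + \<sigma> * x \<in> liouville_like"
    unfolding liouville_like_def using x(2) unfolding real_scaleR_def by (rule INT_I)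
  ultimately show ?thesis by (rule that)
qed

definition base4_sum :: "nat set \<Rightarrow> real" where
  "base4_sum S = (\<Sum>k. of_bool (k \<in> S) * (1 / 4) ^ Suc k)"

text \<open>The factors 1 and 2 give expansions with digits 0, 1 and digits 0, 2, whose sums have
  all digits 0 to 3. The factor -2 does the same for differences.\<close>

definition base4_set :: "real set" where
  "base4_set = {of_int n + s * base4_sum S | n s S. s \<in> {1, 2, -2}}"

lemma base4_summable: "summable (\<lambda>k. of_bool (k \<in> S) * (1 / 4 :: real) ^ Suc k)"
  by (rule summable_comparison_test'[where g = "\<lambda>k. (1 / 4) ^ Suc k" and N = 0])
     (auto simp: summable_Suc_iff intro: summable_geometric)

lemma base4_expansion:
  obtains n S S' where "z = of_int n + base4_sum S + 2 * base4_sum S'"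
proof -
  define y where "y = frac z"
  define D where "D k = \<lfloor>4 ^ Suc k * y\<rfloor> - 4 * \<lfloor>4 ^ k * y\<rfloor>" for k :: nat
  have y: "0 \<le> y" "y < 1" by (auto simp: y_def frac_lt_1)
  have D: "D k \<in> {0..3}" for k
  proof -
    have "4 * \<lfloor>x\<rfloor> \<le> \<lfloor>4 * x\<rfloor> \<and> \<lfloor>4 * x\<rfloor> < 4 * \<lfloor>x\<rfloor> + 4" for x :: real by linarith
    from this[of "4 ^ k * y"] show ?thesis by (auto simp: D_def mult.assoc)
  qed
  have partial: "(\<Sum>k<n. of_int (D k) * (1 / 4 :: real) ^ Suc k) = of_int \<lfloor>4 ^ n * y\<rfloor> / 4 ^ n" for n
  proof (induction n)
    case 0
    then show ?case using y by (simp add: floor_eq_iff)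
  next
    case (Suc n)
    then show ?case by (simp add: D_def field_simps power_one_over)
  qed
  have "(\<lambda>n. of_int \<lfloor>4 ^ n * y\<rfloor> / 4 ^ n) \<longlonglongrightarrow> y"
  proof (rule LIMSEQ_I)
    fix r :: real assume "r > 0"
    obtain N where N: "(1 / 4 :: real) ^ N < r" using real_arch_pow_inv[OF \<open>r > 0\<close>, of "1 / 4"] by auto
    have "norm (of_int \<lfloor>4 ^ n * y\<rfloor> / 4 ^ n - y) < r" if "n \<ge> N" for n
    proof -
      have "\<bar>of_int \<lfloor>4 ^ n * y\<rfloor> - 4 ^ n * y\<bar> \<le> 1" by linarith
      moreover have "of_int \<lfloor>4 ^ n * y\<rfloor> / 4 ^ n - y = (of_int \<lfloor>4 ^ n * y\<rfloor> - 4 ^ n * y) / 4 ^ n"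
        by (simp add: diff_divide_distrib)
      ultimately have "\<bar>of_int \<lfloor>4 ^ n * y\<rfloor> / 4 ^ n - y\<bar> \<le> (1 / 4) ^ n"
        by (simp add: abs_divide power_one_over divide_right_mono)
      also have "\<dots> \<le> (1 / 4) ^ N" using that by (intro power_decreasing) auto
      finally show ?thesis using N by simp
    qed
    then show "\<exists>N. \<forall>n\<ge>N. norm (of_int \<lfloor>4 ^ n * y\<rfloor> / 4 ^ n - y) < r" by blast
  qed
  then have sums: "(\<lambda>k. of_int (D k) * (1 / 4) ^ Suc k) sums y"
    unfolding sums_def partial .
  \<comment> \<open>The two binary digits of each base 4 digit.\<close>
  define S where "S = {k. odd (D k)}"
  define S' where "S' = {k. D k \<ge> 2}"
  have split: "real_of_int (D k) = of_bool (k \<in> S) + 2 * of_bool (k \<in> S')" for k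
  proof -
    have "D k = 0 \<or> D k = 1 \<or> D k = 2 \<or> D k = 3" using D[of k] by auto
    then show ?thesis by (auto simp: S_def S'_def)
  qed
  have "(\<lambda>k. of_bool (k \<in> S) * (1 / 4) ^ Suc k + 2 * (of_bool (k \<in> S') * (1 / 4) ^ Suc k)) sums (base4_sum S + 2 * base4_sum S')"
    unfolding base4_sum_def by (intro sums_add sums_mult summable_sums base4_summable)
  then have "(\<lambda>k. of_int (D k) * (1 / 4) ^ Suc k) sums (base4_sum S + 2 * base4_sum S')"
    by (simp only: split distrib_right mult.assoc)
  then have "y = base4_sum S + 2 * base4_sum S'" by (rule sums_unique2[OF sums])
  then have "z = of_int \<lfloor>z\<rfloor> + base4_sum S + 2 * base4_sum S'" by (simp add: y_def frac_def)
  then show ?thesis by (rule that)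
qed

lemma base4_set_sum: "\<exists>a\<in>base4_set. \<exists>b\<in>base4_set. z = a + b" "\<exists>a\<in>base4_set. \<exists>b\<in>base4_set. z = a - b"
proof -
  obtain n S S' where z: "z = of_int n + base4_sum S + 2 * base4_sum S'" by (rule base4_expansion)
  have mem: "of_int n + s * base4_sum S \<in> base4_set" if "s \<in> {1, 2, -2}" for n s S
    using that unfolding base4_set_def by blast
  show "\<exists>a\<in>base4_set. \<exists>b\<in>base4_set. z = a + b"
    using mem[of 1 n S] mem[of 2 0 S'] z by (intro bexI[of _ "of_int n + 1 * base4_sum S"] bexI[of _ "of_int 0 + 2 * base4_sum S'"]) auto
  show "\<exists>a\<in>base4_set. \<exists>b\<in>base4_set. z = a - b"
    using mem[of 1 n S] mem[of "-2" 0 S'] z by (intro bexI[of _ "of_int n + 1 * base4_sum S"] bexI[of _ "of_int 0 + (-2) * base4_sum S'"]) auto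
qed

lemma base4_sum_truncate: "\<bar>base4_sum S - (\<Sum>k\<in>S \<inter> {..<2 * i}. (1 / 4) ^ Suc k)\<bar> \<le> (1 / 16) ^ i"
proof -
  let ?f = "\<lambda>k. of_bool (k \<in> S) * (1 / 4 :: real) ^ Suc k"
  have "(\<Sum>k\<in>S \<inter> {..<2 * i}. (1 / 4 :: real) ^ Suc k) = (\<Sum>k<2 * i. ?f k)"
    by (subst Int_commute, subst sum.inter_restrict) (auto intro!: sum.cong)
  then have diff: "base4_sum S - (\<Sum>k\<in>S \<inter> {..<2 * i}. (1 / 4) ^ Suc k) = (\<Sum>k. ?f (k + 2 * i))"
    unfolding base4_sum_def using suminf_split_initial_segment[OF base4_summable, of S "2 * i"] by simp
  have geo: "(\<lambda>k. (1 / 4 :: real) ^ k) sums (4 / 3)" using geometric_sums[of "1 / 4 :: real"] by simp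
  have "(\<Sum>k. ?f (k + 2 * i)) \<le> (\<Sum>k. (1 / 4) ^ (2 * i + 1) * (1 / 4) ^ k)"
  proof (rule suminf_le)
    show "summable (\<lambda>k. ?f (k + 2 * i))" by (rule summable_ignore_initial_segment[OF base4_summable])
    show "?f (k + 2 * i) \<le> (1 / 4) ^ (2 * i + 1) * (1 / 4) ^ k" for k
      by (simp add: power_add[symmetric] add.commute)
  qed (use geo in \<open>auto intro!: summable_mult sums_summable\<close>)
  also have "\<dots> = (1 / 4) ^ (2 * i + 1) * (4 / 3)"
    using sums_mult[OF geo, of "(1 / 4) ^ (2 * i + 1)"] by (rule sums_unique[symmetric])
  also have "\<dots> \<le> (1 / 16) ^ i"
  proof -
    have "(1 / 4 :: real) ^ (2 * i + 1) = (1 / 16) ^ i * (1 / 4)"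
      by (simp add: power_mult power2_eq_square)
    then show ?thesis using zero_le_power[of "1 / 16 :: real" i] by simp
  qed
  finally have "(\<Sum>k. ?f (k + 2 * i)) \<le> (1 / 16) ^ i" .
  moreover have "0 \<le> (\<Sum>k. ?f (k + 2 * i))"
    by (rule suminf_nonneg[OF summable_ignore_initial_segment[OF base4_summable]]) simp
  ultimately show ?thesis unfolding diff by simp
qed

text \<open>The scale \<open>16\<close> is chosen so that a Cantor set of dimension one half needs \<open>4 ^ i\<close> intervals and
  the dyadic rationals of level \<open>i\<close> are \<open>2 ^ i\<close> in number.\<close>
definition covered :: "real \<Rightarrow> real set \<Rightarrow> nat \<Rightarrow> real set \<Rightarrow> real \<Rightarrow> bool" where
  "covered b E i P C \<longleftrightarrow> finite P \<and> P \<subseteq> E \<and> real (card P) \<le> C * b ^ i"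

definition limsup_thin :: "real set \<Rightarrow> bool" where
  "limsup_thin E \<longleftrightarrow> (\<exists>C P. (\<forall>i. covered 2 E i (P i) C) \<and>
     (\<forall>x\<in>E. \<exists>\<^sub>\<infinity>i. \<exists>p\<in>P i. \<bar>x - p\<bar> \<le> C * (1 / 16) ^ i))"

definition uniformly_thin :: "real set \<Rightarrow> bool" where
  "uniformly_thin E \<longleftrightarrow> (\<exists>C P. (\<forall>i. covered 4 E i (P i) C) \<and>
     (\<forall>x\<in>E. \<forall>i. \<exists>p\<in>P i. \<bar>x - p\<bar> \<le> C * (1 / 16) ^ i))"

text \<open>Centres are moved into \<open>E\<close> at the price of doubling the radius, since the
  Lipschitz bounds applied to them later, above all for division, hold only on
  \<open>E\<close>.\<close>

lemma recentre:
  fixes P :: "real set"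
  assumes "finite P"
  obtains P' where "finite P'" "P' \<subseteq> E" "card P' \<le> card P"
    "\<And>x p. x \<in> E \<Longrightarrow> p \<in> P \<Longrightarrow> \<bar>x - p\<bar> \<le> \<rho> \<Longrightarrow> \<exists>p'\<in>P'. \<bar>x - p'\<bar> \<le> 2 * \<rho>"
proof -
  define Q where "Q = {p \<in> P. \<exists>x\<in>E. \<bar>x - p\<bar> \<le> \<rho>}"
  have "\<forall>p\<in>Q. \<exists>x. x \<in> E \<and> \<bar>x - p\<bar> \<le> \<rho>" by (auto simp: Q_def)
  then obtain h where h: "\<And>p. p \<in> Q \<Longrightarrow> h p \<in> E \<and> \<bar>h p - p\<bar> \<le> \<rho>" by metis
  have Q: "finite Q" "Q \<subseteq> P" using assms by (auto simp: Q_def)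
  show ?thesis
  proof (rule that)
    show "card (h ` Q) \<le> card P" using card_image_le[OF Q(1)] card_mono[OF assms Q(2)] order_trans by blast
    show "\<exists>p'\<in>h ` Q. \<bar>x - p'\<bar> \<le> 2 * \<rho>" if "x \<in> E" "p \<in> P" "\<bar>x - p\<bar> \<le> \<rho>" for x p
    proof
      have "p \<in> Q" using that by (auto simp: Q_def)
      then show "h p \<in> h ` Q" "\<bar>x - h p\<bar> \<le> 2 * \<rho>" using h[of p] that(3) by auto
    qed
  qed (use Q h in auto)
qed

lemma limsup_thin_liouville_like: "limsup_thin (liouville_like \<inter> {- real l..real l})"
proof -
  let ?E = "liouville_like \<inter> {- real l..real l}"
  \<comment> \<open>The approximants lie within distance 1 of points bounded by \<open>l\<close>,
    hence \<open>Suc l\<close>.\<close>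
  define R where "R i = (\<lambda>k::int. of_int k / 2 ^ i :: real) ` {- int (Suc l * 2 ^ i)..int (Suc l * 2 ^ i)}" for i :: nat
  have finR: "finite (R i)" for i by (simp add: R_def)
  have cardR: "real (card (R i)) \<le> (2 * real l + 3) * 2 ^ i" for i
  proof -
    have "card (R i) \<le> card {- int (Suc l * 2 ^ i)..int (Suc l * 2 ^ i)}" unfolding R_def by (intro card_image_le) simp
    also have "\<dots> = 2 * (Suc l * 2 ^ i) + 1" unfolding card_atLeastAtMost_int by linarith
    finally have "real (card (R i)) \<le> 2 * (Suc l * 2 ^ i) + 1" by linarith
    also have "\<dots> \<le> 2 * (real l + 1) * 2 ^ i + 2 ^ i"
      using one_le_power[of "2 :: real" i] by (simp add: algebra_simps)
    also have "\<dots> = (2 * real l + 3) * 2 ^ i" by (simp add: algebra_simps)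
    finally show ?thesis .
  qed
  have "\<forall>i. \<exists>P'. finite P' \<and> P' \<subseteq> ?E \<and> card P' \<le> card (R i) \<and>
      (\<forall>x p. x \<in> ?E \<longrightarrow> p \<in> R i \<longrightarrow> \<bar>x - p\<bar> \<le> (1 / 16) ^ i \<longrightarrow> (\<exists>p'\<in>P'. \<bar>x - p'\<bar> \<le> 2 * (1 / 16) ^ i))"
    by (meson recentre[OF finR])
  then obtain P where P: "\<And>i. finite (P i)" "\<And>i. P i \<subseteq> ?E" "\<And>i. card (P i) \<le> card (R i)"
      "\<And>i x p. x \<in> ?E \<Longrightarrow> p \<in> R i \<Longrightarrow> \<bar>x - p\<bar> \<le> (1 / 16) ^ i \<Longrightarrow> \<exists>p'\<in>P i. \<bar>x - p'\<bar> \<le> 2 * (1 / 16) ^ i"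
    by metis
  show ?thesis
    unfolding limsup_thin_def covered_def
  proof (intro exI[of _ "2 * real l + 3"] exI[of _ P] conjI allI ballI)
    show "real (card (P i)) \<le> (2 * real l + 3) * 2 ^ i" for i
      using P(3)[of i] cardR[of i] by linarith
    fix x assume x: "x \<in> ?E"
    show "\<exists>\<^sub>\<infinity>i. \<exists>p\<in>P i. \<bar>x - p\<bar> \<le> (2 * real l + 3) * (1 / 16) ^ i"
      unfolding INFM_nat_le
    proof
      fix n
      have "x \<in> dyadic_nbhd (\<lambda>i. (1 / 16) ^ i) n" using x by (auto simp: liouville_like_def)
      then obtain i and p :: "real \<Rightarrow> int" where i: "i \<ge> n" "dist (of_int (p 1) / 2 ^ i) x < (1 / 16) ^ i"
        by (auto simp: dyadic_nbhd_def dyadic_point_def)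
      define k where "k = p (1::real)"
      have xk: "\<bar>x - of_int k / 2 ^ i\<bar> \<le> (1 / 16) ^ i" using i(2) by (simp add: dist_real_def k_def abs_minus_commute)
      have "(1 / 16 :: real) ^ i \<le> 1" by (intro power_le_one) auto
      then have "\<bar>of_int k / 2 ^ i\<bar> \<le> real (Suc l)" using xk x by auto
      then have "\<bar>real_of_int k\<bar> \<le> real (Suc l) * 2 ^ i" by (simp add: abs_divide divide_le_eq)
      also have "\<dots> = real_of_int (int (Suc l * 2 ^ i))" by (simp add: distrib_right)
      finally have "\<bar>k\<bar> \<le> int (Suc l * 2 ^ i)" by linarith
      then have "of_int k / 2 ^ i \<in> R i" unfolding R_def by (intro imageI) auto
      from P(4)[OF x this xk] obtain p' where "p' \<in> P i" "\<bar>x - p'\<bar> \<le> 2 * (1 / 16) ^ i" by blast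
      moreover have "2 * (1 / 16) ^ i \<le> (2 * real l + 3) * (1 / 16 :: real) ^ i" by (intro mult_right_mono) auto
      ultimately show "\<exists>i\<ge>n. \<exists>p\<in>P i. \<bar>x - p\<bar> \<le> (2 * real l + 3) * (1 / 16) ^ i"
        using i(1) by (meson order_trans)
    qed
  qed (use P in auto)
qed

lemma uniformly_thin_base4_set:
  assumes E: "E \<subseteq> base4_set \<inter> {- real l..real l}"
  shows "uniformly_thin E"
proof -
  \<comment> \<open>The fractional part contributes at most 2 in absolute value, so the integer part
    is bounded by \<open>l + 2\<close>.\<close>
  define I where "I = {- int (l + 2)..int (l + 2)} \<times> {1, 2, -2 :: real}"
  \<comment> \<open>Keeping \<open>2 * i\<close> digits in base 4 gives \<open>4 ^ i\<close> digit
    sets and accuracy of order \<open>(1 / 16) ^ i\<close>.\<close>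
  define R where "R i = (\<lambda>((n, s), S). of_int n + s * (\<Sum>k\<in>S. (1 / 4) ^ Suc k)) ` (I \<times> Pow {..<2 * i})" for i :: nat
  have finR: "finite (R i)" for i by (simp add: R_def I_def)
  define c where "c = real (card I)"
  have cardR: "real (card (R i)) \<le> c * 4 ^ i" for i
  proof -
    have "card (R i) \<le> card (I \<times> Pow {..<2 * i})" unfolding R_def by (intro card_image_le) (simp add: I_def)
    also have "\<dots> = card I * 4 ^ i" by (simp add: card_cartesian_product card_Pow power_mult)
    finally have "real (card (R i)) \<le> real (card I * 4 ^ i)" by (simp only: of_nat_le_iff)
    then show ?thesis by (simp add: c_def)
  qed
  have "\<forall>i. \<exists>P'. finite P' \<and> P' \<subseteq> E \<and> card P' \<le> card (R i) \<and>
      (\<forall>x p. x \<in> E \<longrightarrow> p \<in> R i \<longrightarrow> \<bar>x - p\<bar> \<le> 2 * (1 / 16) ^ i \<longrightarrow> (\<exists>p'\<in>P'. \<bar>x - p'\<bar> \<le> 2 * (2 * (1 / 16) ^ i)))"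
    by (meson recentre[OF finR])
  then obtain P where P: "\<And>i. finite (P i)" "\<And>i. P i \<subseteq> E" "\<And>i. card (P i) \<le> card (R i)"
      "\<And>i x p. x \<in> E \<Longrightarrow> p \<in> R i \<Longrightarrow> \<bar>x - p\<bar> \<le> 2 * (1 / 16) ^ i \<Longrightarrow> \<exists>p'\<in>P i. \<bar>x - p'\<bar> \<le> 2 * (2 * (1 / 16) ^ i)"
    by metis
  show ?thesis
    unfolding uniformly_thin_def covered_def
  proof (intro exI[of _ "c + 4"] exI[of _ P] conjI allI ballI)
    show "real (card (P i)) \<le> (c + 4) * 4 ^ i" for i
    proof -
      have "c * 4 ^ i \<le> (c + 4) * 4 ^ i" by (intro mult_right_mono) auto
      then show ?thesis using P(3)[of i] cardR[of i] by linarith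
    qed
    fix x i assume x: "x \<in> E"
    then obtain n s S where nsS: "x = of_int n + s * base4_sum S" "s \<in> {1, 2, -2}"
      using E unfolding base4_set_def by blast
    have s2: "\<bar>s\<bar> \<le> 2" using nsS(2) by auto
    define p where "p = of_int n + s * (\<Sum>k\<in>S \<inter> {..<2 * i}. (1 / 4) ^ Suc k)"
    have "\<bar>x - p\<bar> = \<bar>s\<bar> * \<bar>base4_sum S - (\<Sum>k\<in>S \<inter> {..<2 * i}. (1 / 4) ^ Suc k)\<bar>"
      by (simp add: nsS p_def abs_mult[symmetric] right_diff_distrib)
    also have "\<dots> \<le> 2 * (1 / 16) ^ i" by (intro mult_mono s2 base4_sum_truncate) auto
    finally have xp: "\<bar>x - p\<bar> \<le> 2 * (1 / 16) ^ i" .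
    have "\<bar>base4_sum S\<bar> \<le> 1" using base4_sum_truncate[of S 0] by simp
    then have "\<bar>s * base4_sum S\<bar> \<le> 2 * 1" unfolding abs_mult using s2 by (intro mult_mono) auto
    moreover have "x \<in> {- real l..real l}" using x E by blast
    then have "\<bar>x\<bar> \<le> real l" by auto
    ultimately have "\<bar>real_of_int n\<bar> \<le> real (l + 2)" using nsS(1) by simp
    then have "\<bar>n\<bar> \<le> int (l + 2)" by linarith
    then have "(n, s) \<in> I" using nsS(2) by (auto simp: I_def)
    then have "p \<in> R i" unfolding R_def p_def by (intro image_eqI[of _ _ "((n, s), S \<inter> {..<2 * i})"]) auto
    from P(4)[OF x this xp] obtain p' where p': "p' \<in> P i" "\<bar>x - p'\<bar> \<le> 2 * (2 * (1 / 16) ^ i)" by blast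
    then have "\<bar>x - p'\<bar> \<le> 4 * (1 / 16) ^ i" by simp
    also have "4 * (1 / 16) ^ i \<le> (c + 4) * (1 / 16 :: real) ^ i" by (intro mult_right_mono) (auto simp: c_def)
    finally show "\<exists>p\<in>P i. \<bar>x - p\<bar> \<le> (c + 4) * (1 / 16) ^ i" using p'(1) by (rule bexI)
  qed (use P in auto)
qed

text \<open>At scale \<open>(1 / 16) ^ i\<close>, coordinate \<open>k\<close> needs about
  \<open>2 ^ i * 4 ^ i = 8 ^ i\<close> values infinitely often, and the other coordinates a full
  grid. This corresponds to dimension \<open>m - 1/4\<close>, and \<open>m - 1/8\<close> lies
  strictly above it.\<close>

lemma slab_null:
  fixes f :: "real \<Rightarrow> real \<Rightarrow> real" and k :: "'n::finite"
  assumes E1: "limsup_thin E1" and E2: "uniformly_thin E2"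
    and K: "K \<ge> 0" "\<And>a a' b b'. a \<in> E1 \<Longrightarrow> a' \<in> E1 \<Longrightarrow> b \<in> E2 \<Longrightarrow> b' \<in> E2 \<Longrightarrow>
      \<bar>f a b - f a' b'\<bar> \<le> K * (\<bar>a - a'\<bar> + \<bar>b - b'\<bar>)"
  shows "hausdorff_measure (real CARD('n) - 1 / 8)
    {z :: real ^ 'n. (\<forall>i. \<bar>z $ i\<bar> \<le> real l) \<and> (\<exists>a\<in>E1. \<exists>b\<in>E2. z $ k = f a b)} = 0"
proof -
  define m where "m = CARD('n)"
  have m: "m \<ge> 1" by (simp add: m_def Suc_leI)
  obtain C1 P1 where cov1: "\<forall>i. covered 2 E1 i (P1 i) C1"
    and near1: "\<forall>x\<in>E1. \<exists>\<^sub>\<infinity>i. \<exists>p\<in>P1 i. \<bar>x - p\<bar> \<le> C1 * (1 / 16) ^ i"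
    using E1 unfolding limsup_thin_def by (elim exE conjE)
  obtain C2 P2 where cov2: "\<forall>i. covered 4 E2 i (P2 i) C2"
    and near2: "\<forall>x\<in>E2. \<forall>i. \<exists>p\<in>P2 i. \<bar>x - p\<bar> \<le> C2 * (1 / 16) ^ i"
    using E2 unfolding uniformly_thin_def by (elim exE conjE)
  have P1: "finite (P1 i)" "P1 i \<subseteq> E1" "real (card (P1 i)) \<le> C1 * 2 ^ i" for i
    using cov1 unfolding covered_def by blast+
  have P2: "finite (P2 i)" "P2 i \<subseteq> E2" "real (card (P2 i)) \<le> C2 * 4 ^ i" for i
    using cov2 unfolding covered_def by blast+
  have C0: "C1 \<ge> 0" "C2 \<ge> 0"
    using order_trans[OF of_nat_0_le_iff P1(3)[of 0]] order_trans[OF of_nat_0_le_iff P2(3)[of 0]] by simp_all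
  define J where "J i = {- int (Suc l * 16 ^ i)..int (Suc l * 16 ^ i)}" for i :: nat
  define grid where "grid i = PiE (UNIV - {k}) (\<lambda>_. J i)" for i :: nat
  define pt where "pt i = (\<lambda>((a, b), g :: 'n \<Rightarrow> int). (\<chi> j. if j = k then f a b else of_int (g j) / 16 ^ i) :: real ^ 'n)" for i :: nat
  define P where "P i = pt i ` ((P1 i \<times> P2 i) \<times> grid i)" for i
  define c where "c = 2 * real l + 3"
  have fingrid: "finite (grid i)" for i unfolding grid_def J_def by (intro finite_PiE) auto
  have cardgrid: "real (card (grid i)) \<le> (c * 16 ^ i) ^ (m - 1)" for i
  proof -
    have "card (J i) = 2 * (Suc l * 16 ^ i) + 1" unfolding J_def card_atLeastAtMost_int by linarith
    then have "real (card (J i)) = 2 * (real l + 1) * 16 ^ i + 1" by (simp add: algebra_simps)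
    also have "\<dots> \<le> c * 16 ^ i" using one_le_power[of "16 :: real" i] by (simp add: c_def algebra_simps)
    finally have "real (card (J i)) \<le> c * 16 ^ i" .
    moreover have "card (grid i) = card (J i) ^ (m - 1)"
      unfolding grid_def by (simp add: card_PiE m_def card_Diff_singleton)
    ultimately show ?thesis by (simp add: power_mono)
  qed
  \<comment> \<open>\<open>K * (C1 + C2)\<close> bounds the error in coordinate \<open>k\<close> and
    1 the error in the grid coordinates.\<close>
  define B where "B = K * (C1 + C2) + 1"
  have B: "B > 0" using K C0 by (simp add: B_def add_nonneg_pos)
  define t where "t = real m - 1 / 8"
  have t: "t > 0" using m by (simp add: t_def)
  define r where "r i = m * B * (1 / 16) ^ i" for i
  define M where "M = C1 * C2 * c ^ (m - 1) * (2 * (m * B)) powr t"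
  have M: "M \<ge> 0" using C0 by (simp add: M_def c_def)
  have bound: "real (card (P i)) * (2 * r i) powr t \<le> M * (1 / sqrt 2) ^ i" for i
  proof -
    have "card (P i) \<le> card (P1 i) * card (P2 i) * card (grid i)"
      unfolding P_def using card_image_le[of "(P1 i \<times> P2 i) \<times> grid i" "pt i"] P1(1) P2(1) fingrid
      by (simp add: card_cartesian_product)
    then have "real (card (P i)) \<le> real (card (P1 i)) * real (card (P2 i)) * real (card (grid i))"
      by (metis of_nat_le_iff of_nat_mult)
    also have "\<dots> \<le> (C1 * 2 ^ i) * (C2 * 4 ^ i) * (c * 16 ^ i) ^ (m - 1)"
      using C0 by (intro mult_mono P1 P2 cardgrid) auto
    also have "\<dots> = C1 * C2 * c ^ (m - 1) * (8 ^ i * 16 ^ (i * (m - 1)))"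
      using power_mult_distrib[of "2 :: real" 4 i] by (simp add: power_mult_distrib power_mult)
    finally have card: "real (card (P i)) \<le> C1 * C2 * c ^ (m - 1) * (8 ^ i * 16 ^ (i * (m - 1)))" .
    have "2 * r i = (2 * (m * B)) * (1 / 16) ^ i" by (simp add: r_def)
    then have "(2 * r i) powr t = (2 * (m * B)) powr t * ((1 / 16) ^ i) powr t"
      using B by (simp add: powr_mult)
    also have "((1 / 16 :: real) ^ i) powr t = (16 powr (- t)) ^ i"
    proof -
      have "((1 / 16 :: real) ^ i) powr t = (16 powr (- real i)) powr t"
        by (simp add: powr_minus powr_realpow power_one_over inverse_eq_divide)
      also have "\<dots> = (16 powr (- t)) ^ i" by (simp add: powr_powr powr_realpow[symmetric] mult.commute)
      finally show ?thesis .
    qed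
    finally have "real (card (P i)) * (2 * r i) powr t \<le>
        C1 * C2 * c ^ (m - 1) * (8 ^ i * 16 ^ (i * (m - 1))) * ((2 * (m * B)) powr t * (16 powr (- t)) ^ i)"
      using card by (simp only:) (intro mult_right_mono, auto)
    also have "\<dots> = M * (8 * (16 ^ (m - 1) * 16 powr (- t))) ^ i"
    proof -
      have "(16 :: real) ^ (i * (m - 1)) = (16 ^ (m - 1)) ^ i"
        by (simp only: power_mult[symmetric] mult.commute)
      then show ?thesis by (simp only: M_def power_mult_distrib mult_ac)
    qed
    \<comment> \<open>The exponents of 2 are \<open>3 - 4 * (7/8) = - 1/2\<close>.\<close>
    also have "8 * (16 ^ (m - 1) * 16 powr (- t)) = 1 / sqrt (2 :: real)"
    proof -
      have "(16 :: real) ^ (m - 1) * 16 powr (- t) = 16 powr (real (m - 1) - t)"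
        by (simp add: powr_realpow[symmetric] powr_add[symmetric])
      also have "real (m - 1) - t = - 7 / 8" using m by (simp add: t_def of_nat_diff)
      also have "(16 :: real) powr (- 7 / 8) = (2 powr 4) powr (- 7 / 8)" by simp
      also have "\<dots> = 2 powr (- 3 - 1 / 2)" unfolding powr_powr by simp
      also have "\<dots> = 2 powr (- 3) / 2 powr (1 / 2)" by (rule powr_diff)
      finally show ?thesis by (simp add: powr_half_sqrt powr_minus_divide)
    qed
    finally show ?thesis .
  qed
  have "hausdorff_measure t {z :: real ^ 'n. (\<forall>i. \<bar>z $ i\<bar> \<le> real l) \<and> (\<exists>a\<in>E1. \<exists>b\<in>E2. z $ k = f a b)} = 0"
  proof (rule hausdorff_measure_limsup_null[OF t])
    show "finite (P i)" for i unfolding P_def using P1(1) P2(1) fingrid by auto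
    show "r i > 0" for i using B m by (simp add: r_def)
    have "(\<lambda>i. real m * B * (1 / 16) ^ i) \<longlonglongrightarrow> real m * B * 0"
      by (intro tendsto_mult_left LIMSEQ_power_zero) auto
    then show "r \<longlonglongrightarrow> 0" by (simp add: r_def[abs_def])
    show "summable (\<lambda>i. real (card (P i)) * (2 * r i) powr t)"
      by (rule summable_comparison_test'[where g = "\<lambda>i. M * (1 / sqrt 2) ^ i"])
         (use bound in \<open>auto intro!: summable_mult summable_geometric\<close>)
    fix z :: "real ^ 'n" assume "z \<in> {z. (\<forall>i. \<bar>z $ i\<bar> \<le> real l) \<and> (\<exists>a\<in>E1. \<exists>b\<in>E2. z $ k = f a b)}"
    then obtain a b where z: "\<And>i. \<bar>z $ i\<bar> \<le> real l" and a: "a \<in> E1" and b: "b \<in> E2" and zk: "z $ k = f a b" by blast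
    have "\<exists>p\<in>P i. dist z p \<le> r i" if i: "\<exists>p\<in>P1 i. \<bar>a - p\<bar> \<le> C1 * (1 / 16) ^ i" for i
    proof -
      obtain a' where a': "a' \<in> P1 i" "\<bar>a - a'\<bar> \<le> C1 * (1 / 16) ^ i" using i by blast
      obtain b' where b': "b' \<in> P2 i" "\<bar>b - b'\<bar> \<le> C2 * (1 / 16) ^ i" using near2 b by blast
      define g where "g = (\<lambda>j\<in>UNIV - {k}. \<lfloor>z $ j * 16 ^ i\<rfloor>)"
      have "\<lfloor>z $ j * 16 ^ i\<rfloor> \<in> J i" for j
      proof -
        have "\<bar>z $ j * 16 ^ i\<bar> \<le> real l * 16 ^ i" using z[of j] by (simp add: abs_mult)
        moreover have "real_of_int (int (Suc l * 16 ^ i)) = real l * 16 ^ i + 16 ^ i" by (simp add: distrib_right)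
        moreover have "(16 :: real) ^ i \<ge> 1" by simp
        ultimately show ?thesis unfolding J_def atLeastAtMost_iff by linarith
      qed
      then have "g \<in> grid i" by (auto simp: g_def grid_def)
      then have mem: "pt i ((a', b'), g) \<in> P i" unfolding P_def using a' b' by blast
      have "\<bar>(z - pt i ((a', b'), g)) $ j\<bar> \<le> B * (1 / 16) ^ i" for j
      proof (cases "j = k")
        case True
        have "\<bar>f a b - f a' b'\<bar> \<le> K * (\<bar>a - a'\<bar> + \<bar>b - b'\<bar>)"
          using a b a' b' P1(2) P2(2) by (intro K) auto
        also have "\<dots> \<le> K * (C1 * (1 / 16) ^ i + C2 * (1 / 16) ^ i)"
          using K a' b' by (intro mult_left_mono add_mono) auto
        also have "\<dots> \<le> B * (1 / 16) ^ i" by (simp add: B_def algebra_simps)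
        finally show ?thesis using True by (simp add: pt_def zk)
      next
        case False
        have "\<bar>z $ j * 16 ^ i - of_int \<lfloor>z $ j * 16 ^ i\<rfloor>\<bar> \<le> 1" by linarith
        moreover have "z $ j - of_int \<lfloor>z $ j * 16 ^ i\<rfloor> / 16 ^ i = (z $ j * 16 ^ i - of_int \<lfloor>z $ j * 16 ^ i\<rfloor>) / 16 ^ i"
          by (simp add: diff_divide_distrib)
        ultimately have "\<bar>z $ j - of_int \<lfloor>z $ j * 16 ^ i\<rfloor> / 16 ^ i\<bar> \<le> 1 * (1 / 16) ^ i"
          by (simp add: abs_divide power_one_over divide_right_mono)
        also have "\<dots> \<le> B * (1 / 16) ^ i" using K C0 by (intro mult_right_mono) (auto simp: B_def)
        finally show ?thesis using False by (simp add: pt_def g_def)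
      qed
      then have "norm (z - pt i ((a', b'), g)) \<le> (\<Sum>j\<in>(UNIV :: 'n set). B * (1 / 16) ^ i)"
        by (intro order_trans[OF norm_le_l1_cart] sum_mono) auto
      then have "dist z (pt i ((a', b'), g)) \<le> r i" by (simp add: dist_norm r_def m_def)
      then show ?thesis using mem by blast
    qed
    then show "\<exists>\<^sub>\<infinity>i. \<exists>p\<in>P i. dist z p \<le> r i"
      by (rule INFM_mono[OF near1[rule_format, OF a]])
  qed
  then show ?thesis by (simp add: t_def m_def)
qed

section \<open>Lipschitz bounds for the branches and the operations\<close>

lemma exp_branch_bounded_lipschitz:
  assumes "g \<in> exp_branches" "\<bar>a\<bar> \<le> l" "\<bar>a'\<bar> \<le> l"
  shows "\<bar>g a\<bar> \<le> exp l" "\<bar>g a - g a'\<bar> \<le> exp l * \<bar>a - a'\<bar>"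
proof -
  have l: "l \<ge> 0" using assms(2) by linarith
  have el: "exp l \<ge> 1" "exp l \<ge> l" using l exp_ge_add_one_self[of l] by linarith+
  \<comment> \<open>The mean value estimate, read off from \<open>1 + y \<le> exp y\<close> at
    \<open>y = v - u\<close>.\<close>
  have mono: "exp u - exp v \<le> exp l * (u - v)" if "v \<le> u" "u \<le> l" for u v :: real
  proof -
    have "1 - exp (v - u) \<le> u - v" using exp_ge_add_one_self[of "v - u"] by linarith
    moreover have "exp u - exp v = exp u * (1 - exp (v - u))" by (simp add: right_diff_distrib flip: exp_add)
    moreover have "exp u * (1 - exp (v - u)) \<le> exp l * (u - v)"
      using that calculation(1) by (intro mult_mono) auto
    ultimately show ?thesis by simp
  qed
  have elip: "\<bar>exp a - exp a'\<bar> \<le> exp l * \<bar>a - a'\<bar>"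
    using mono[of a a'] mono[of a' a] assms(2,3) by (cases "a \<le> a'") auto
  have "\<bar>a - a'\<bar> \<le> exp l * \<bar>a - a'\<bar>" using mult_right_mono[OF el(1), of "\<bar>a - a'\<bar>"] by simp
  then show "\<bar>g a - g a'\<bar> \<le> exp l * \<bar>a - a'\<bar>"
    using assms(1) elip by (auto simp: exp_branches_def abs_minus_commute)
  show "\<bar>g a\<bar> \<le> exp l" using assms el by (auto simp: exp_branches_def)
qed

text \<open>The cube is the worst case, division: one factor \<open>M\<close> from the product and
  two from the reciprocals.\<close>

lemma real_op_lipschitz:
  assumes M: "M \<ge> 1" "\<bar>x\<bar> \<le> M" "\<bar>x'\<bar> \<le> M" "\<bar>y\<bar> \<le> M" "\<bar>y'\<bar> \<le> M"
    and away: "opr = Op_Div \<Longrightarrow> 1 / M \<le> \<bar>y\<bar> \<and> 1 / M \<le> \<bar>y'\<bar>"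
  shows "\<bar>real_op opr x y - real_op opr x' y'\<bar> \<le> M ^ 3 * (\<bar>x - x'\<bar> + \<bar>y - y'\<bar>)"
proof -
  let ?s = "\<bar>x - x'\<bar> + \<bar>y - y'\<bar>"
  have M3: "M ^ 3 \<ge> 1" "M ^ 3 \<ge> M" using M(1) one_le_power[of M 3] power_increasing[of 1 3 M] by auto
  have s: "?s \<le> M ^ 3 * ?s" using mult_right_mono[OF M3(1), of ?s] by simp
  have mul: "\<bar>x * u - x' * u'\<bar> \<le> M * (\<bar>x - x'\<bar> + \<bar>u - u'\<bar>)" if "\<bar>u\<bar> \<le> M" for u u'
  proof -
    have "x * u - x' * u' = (x - x') * u + x' * (u - u')" by (simp add: algebra_simps)
    then have "\<bar>x * u - x' * u'\<bar> \<le> \<bar>x - x'\<bar> * \<bar>u\<bar> + \<bar>x'\<bar> * \<bar>u - u'\<bar>"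
      using abs_triangle_ineq[of "(x - x') * u" "x' * (u - u')"] by (simp add: abs_mult)
    also have "\<dots> \<le> \<bar>x - x'\<bar> * M + M * \<bar>u - u'\<bar>"
      using that M by (intro add_mono mult_left_mono mult_right_mono) auto
    finally show ?thesis by (simp add: algebra_simps)
  qed
  show ?thesis
  proof (cases opr)
    case Op_Add
    then show ?thesis using s by (simp add: real_op_def)
  next
    case Op_Sub
    then show ?thesis using s by (simp add: real_op_def)
  next
    case Op_Mul
    have "M * ?s \<le> M ^ 3 * ?s" using M3 by (intro mult_right_mono) auto
    then show ?thesis using mul[OF M(4), of y'] Op_Mul by (simp add: real_op_def)
  next
    case Op_Div
    have pos: "1 / M > 0" using M(1) by simp
    have y: "\<bar>y\<bar> \<ge> 1 / M" "\<bar>y'\<bar> \<ge> 1 / M" using away[OF Op_Div] by auto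
    have y0: "y \<noteq> 0" "y' \<noteq> 0" using y pos by auto
    have inv: "1 / \<bar>y\<bar> \<le> M" "1 / \<bar>y'\<bar> \<le> M" using y y0 M(1) by (auto simp: field_simps)
    have "1 / y - 1 / y' = (1 / y) * (1 / y') * (y' - y)" using y0 by (simp add: field_simps)
    then have "\<bar>1 / y - 1 / y'\<bar> = (1 / \<bar>y\<bar>) * (1 / \<bar>y'\<bar>) * \<bar>y - y'\<bar>" by (simp add: abs_mult abs_minus_commute)
    also have "\<dots> \<le> M * M * \<bar>y - y'\<bar>" using inv M(1) by (intro mult_mono) auto
    finally have d: "\<bar>1 / y - 1 / y'\<bar> \<le> M * M * \<bar>y - y'\<bar>" .
    have MM: "M * M \<ge> 1" using mult_mono[OF M(1) M(1)] M(1) by simp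
    have "\<bar>x * (1 / y) - x' * (1 / y')\<bar> \<le> M * (\<bar>x - x'\<bar> + \<bar>1 / y - 1 / y'\<bar>)"
      using inv by (intro mul) simp
    also have "\<dots> \<le> M * (M * M * \<bar>x - x'\<bar> + M * M * \<bar>y - y'\<bar>)"
      using M(1) d mult_right_mono[OF MM, of "\<bar>x - x'\<bar>"] by (intro mult_left_mono add_mono) auto
    also have "\<dots> = M ^ 3 * ?s" by (simp add: power3_eq_cube algebra_simps)
    finally show ?thesis by (simp add: Op_Div real_op_def)
  qed
qed

text \<open>Constraining one arbitrary coordinate is enough. Countably many slabs, indexed by a
  bound and two branches, cover the set, and on each of them the operation is Lipschitz.\<close>

lemma hausdorff_dim_set_op_exp_closures:
  "hausdorff_dim (set_op opr (vec_power (exp_closure liouville_like)) (vec_power (exp_closure base4_set)) :: (real ^ 'n) set)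
    < ereal (real CARD('n))"
proof -
  fix k :: 'n
  define t where "t = real CARD('n) - 1 / 8"
  define E1 where "E1 l = liouville_like \<inter> {- real l..real l}" for l
  \<comment> \<open>For division the divisor is kept at least \<open>1 / exp l\<close> away from 0,
    so \<open>exp l\<close> can serve as the constant \<open>M\<close> of
    \<open>real_op_lipschitz\<close>.\<close>
  define E2 where "E2 h l = {b \<in> base4_set \<inter> {- real l..real l}. opr = Op_Div \<longrightarrow> 1 / exp (real l) \<le> \<bar>h b\<bar>}" for h :: "real \<Rightarrow> real" and l
  define X where "X = (\<lambda>(l, g, h). {z :: real ^ 'n. (\<forall>i. \<bar>z $ i\<bar> \<le> real l) \<and>
      (\<exists>a\<in>E1 l. \<exists>b\<in>E2 h l. z $ k = real_op opr (g a) (h b))})"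
  have "CARD('n) \<ge> 1" by (simp add: Suc_leI)
  then have "real CARD('n) \<ge> 1" by linarith
  then have t: "t \<ge> 0" unfolding t_def by linarith
  have "hausdorff_measure t (set_op opr (vec_power (exp_closure liouville_like)) (vec_power (exp_closure base4_set)) :: (real ^ 'n) set) = 0"
  proof (rule hausdorff_measure_countable_Union_null)
    show "countable ((UNIV :: nat set) \<times> exp_branches \<times> exp_branches)"
      by (intro countable_SIGMA) (auto simp: exp_branches_def)
    fix p assume "p \<in> (UNIV :: nat set) \<times> exp_branches \<times> exp_branches"
    then obtain l g h where p: "p = (l, g, h)" and gh: "g \<in> exp_branches" "h \<in> exp_branches" by auto
    have "hausdorff_measure (real CARD('n) - 1 / 8) {z :: real ^ 'n. (\<forall>i. \<bar>z $ i\<bar> \<le> real l) \<and>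
      (\<exists>a\<in>E1 l. \<exists>b\<in>E2 h l. z $ k = real_op opr (g a) (h b))} = 0"
    proof (rule slab_null)
      show "limsup_thin (E1 l)" unfolding E1_def by (rule limsup_thin_liouville_like)
      show "uniformly_thin (E2 h l)" by (rule uniformly_thin_base4_set[of _ l]) (auto simp: E2_def)
      show "0 \<le> exp (real l) ^ 3 * exp (real l)" by simp
      fix a a' b b' assume mem: "a \<in> E1 l" "a' \<in> E1 l" "b \<in> E2 h l" "b' \<in> E2 h l"
      have abs: "\<bar>a\<bar> \<le> real l" "\<bar>a'\<bar> \<le> real l" "\<bar>b\<bar> \<le> real l" "\<bar>b'\<bar> \<le> real l"
        using mem by (auto simp: E1_def E2_def)
      note g = exp_branch_bounded_lipschitz[OF gh(1)] and h = exp_branch_bounded_lipschitz[OF gh(2)]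
      have "\<bar>real_op opr (g a) (h b) - real_op opr (g a') (h b')\<bar> \<le> exp (real l) ^ 3 * (\<bar>g a - g a'\<bar> + \<bar>h b - h b'\<bar>)"
        using mem abs by (intro real_op_lipschitz g h) (auto simp: E2_def)
      also have "\<dots> \<le> exp (real l) ^ 3 * (exp (real l) * \<bar>a - a'\<bar> + exp (real l) * \<bar>b - b'\<bar>)"
        using abs by (intro mult_left_mono add_mono g h) auto
      also have "\<dots> = exp (real l) ^ 3 * exp (real l) * (\<bar>a - a'\<bar> + \<bar>b - b'\<bar>)" by (simp add: algebra_simps)
      finally show "\<bar>real_op opr (g a) (h b) - real_op opr (g a') (h b')\<bar> \<le> exp (real l) ^ 3 * exp (real l) * (\<bar>a - a'\<bar> + \<bar>b - b'\<bar>)" .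
    qed
    then show "hausdorff_measure t (X p) = 0" by (simp add: X_def p t_def)
  next
    show "set_op opr (vec_power (exp_closure liouville_like)) (vec_power (exp_closure base4_set)) \<subseteq>
        (\<Union>p\<in>UNIV \<times> exp_branches \<times> exp_branches. X p)"
    proof
      fix z :: "real ^ 'n"
      assume "z \<in> set_op opr (vec_power (exp_closure liouville_like)) (vec_power (exp_closure base4_set))"
      then obtain u v where z: "z = (\<chi> i. real_op opr (u $ i) (v $ i))"
        and u: "u $ k \<in> exp_closure liouville_like" and v: "v $ k \<in> exp_closure base4_set"
        and v0: "opr = Op_Div \<Longrightarrow> v $ k \<noteq> 0"
        unfolding set_op_eq vec_power_def by blast
      obtain g a where g: "g \<in> exp_branches" "a \<in> liouville_like" "u $ k = g a"
        using u by (auto simp: exp_closure_def)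
      obtain h b where h: "h \<in> exp_branches" "b \<in> base4_set" "v $ k = h b"
        using v by (auto simp: exp_closure_def)
      \<comment> \<open>If \<open>h b = 0\<close>, possible only when the operation is not division,
        the term \<open>1 / \<bar>h b\<bar>\<close> is 0 and harmless.\<close>
      obtain l :: nat where l: "real l \<ge> max (max (norm z) (1 / \<bar>h b\<bar>)) (max \<bar>a\<bar> \<bar>b\<bar>)"
        using real_arch_simple by blast
      have "1 / exp (real l) \<le> \<bar>h b\<bar>" if "opr = Op_Div"
      proof -
        have "h b \<noteq> 0" using v0[OF that] h by simp
        have "1 / \<bar>h b\<bar> \<le> exp (real l)" using l exp_ge_add_one_self[of "real l"] by linarith
        then show ?thesis using \<open>h b \<noteq> 0\<close> by (simp add: field_simps)
      qed
      then have "b \<in> E2 h l" using h l by (auto simp: E2_def)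
      moreover have "a \<in> E1 l" using g l by (auto simp: E1_def)
      moreover have "\<bar>z $ i\<bar> \<le> real l" for i using component_le_norm_cart[of z i] l by simp
      moreover have "z $ k = real_op opr (g a) (h b)" using z g h by simp
      ultimately have "z \<in> X (l, g, h)" unfolding X_def by auto
      then show "z \<in> (\<Union>p\<in>UNIV \<times> exp_branches \<times> exp_branches. X p)" using g h by blast
    qed
  qed
  then have "hausdorff_dim (set_op opr (vec_power (exp_closure liouville_like)) (vec_power (exp_closure base4_set)) :: (real ^ 'n) set) \<le> ereal t"
    using t by (rule hausdorff_dim_le[rotated])
  also have "\<dots> < ereal (real CARD('n))" by (simp add: t_def)
  finally show ?thesis .
qed

section \<open>Assembling both claims\<close>

lemma liouville_like_add_sub:
  "\<exists>a\<in>liouville_like. \<exists>b\<in>liouville_like. z = a + b" "\<exists>a\<in>liouville_like. \<exists>b\<in>liouville_like. z = a - b"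
proof -
  obtain x where "x \<in> liouville_like" "z + (- 1) * x \<in> liouville_like" by (rule liouville_like_sum[of "- 1" z]) auto
  then show "\<exists>a\<in>liouville_like. \<exists>b\<in>liouville_like. z = a + b" by (intro bexI[of _ x] bexI[of _ "z + (- 1) * x"]) auto
  obtain x where "x \<in> liouville_like" "z + 1 * x \<in> liouville_like" by (rule liouville_like_sum[of 1 z]) auto
  then show "\<exists>a\<in>liouville_like. \<exists>b\<in>liouville_like. z = a - b" by (intro bexI[of _ x] bexI[of _ "z + 1 * x"]) auto
qed

lemma set_op_add_sub_eq:
  "set_op Op_Add A B = {x + 1 *\<^sub>R y | x y. x \<in> A \<and> y \<in> B}"
  "set_op Op_Sub A B = {x + (- 1) *\<^sub>R y | x y. x \<in> A \<and> y \<in> B}"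
  by (auto simp: vec_eq_iff)

theorem theorem3p10:
  fixes N :: "real ^ 'n \<Rightarrow> real"
  assumes "is_norm N"
  shows "(\<exists>A B :: (real ^ 'n) set. \<forall>opr.
            set_op opr A A = UNIV \<and> set_op opr B B = UNIV \<and>
            hausdorff_dim (set_op opr A B) < ereal (real CARD('n))) \<and>
         (5 \<le> CARD('n) \<longrightarrow>
            (\<forall>opr \<in> {Op_Add, Op_Sub}.
               set_op opr (W_infty N) (W_infty N) = UNIV \<and>
               set_op opr (singular_set N) (singular_set N) = UNIV \<and>
               hausdorff_dim (set_op opr (W_infty N) (singular_set N)) < ereal (real CARD('n))))"
proof (intro conjI impI ballI)
  show "\<exists>A B :: (real ^ 'n) set. \<forall>opr. set_op opr A A = UNIV \<and> set_op opr B B = UNIV \<and>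
      hausdorff_dim (set_op opr A B) < ereal (real CARD('n))"
    using set_op_vec_power_eq_UNIV[OF exp_closure_op_surj[OF liouville_like_add_sub]]
      set_op_vec_power_eq_UNIV[OF exp_closure_op_surj[OF base4_set_sum]]
      hausdorff_dim_set_op_exp_closures by blast
next
  have W: "\<exists>x y. z = x + \<tau> *\<^sub>R y \<and> x \<in> W_infty N \<and> y \<in> W_infty N" if \<tau>: "\<tau> \<in> {1, -1}" for \<tau> z
  proof -
    \<comment> \<open>With the opposite sign,
      \<open>z = (z + (- \<tau>) *\<^sub>R x) + \<tau> *\<^sub>R x\<close> is the required
      decomposition.\<close>
    obtain x where "x \<in> W_infty N" "z + (- \<tau>) *\<^sub>R x \<in> W_infty N"
      by (rule W_infty_sum[OF assms, of "- \<tau>" z]) (use \<tau> in auto)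
    then show ?thesis by (intro exI[of _ "z + (- \<tau>) *\<^sub>R x"] exI[of _ x]) auto
  qed
  assume "5 \<le> CARD('n)"
  then have card: "CARD('n) \<ge> 2" by simp
  have S: "\<exists>x y. z = x + \<tau> *\<^sub>R y \<and> x \<in> singular_set N \<and> y \<in> singular_set N" if \<tau>: "\<tau> \<in> {1, -1}" for \<tau> z
  proof -
    obtain x where "x \<in> singular_set N" "z + (- \<tau>) *\<^sub>R x \<in> singular_set N"
      by (rule singular_set_sum[OF assms card, of "- \<tau>" z]) (use \<tau> in auto)
    then show ?thesis by (intro exI[of _ "z + (- \<tau>) *\<^sub>R x"] exI[of _ x]) auto
  qed
  fix opr assume "opr \<in> {Op_Add, Op_Sub}"
  then obtain \<tau> :: real where \<tau>: "\<tau> \<in> {1, -1}"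
    and eq: "\<And>A B :: (real ^ 'n) set. set_op opr A B = {x + \<tau> *\<^sub>R y | x y. x \<in> A \<and> y \<in> B}"
    using set_op_add_sub_eq by blast
  show "set_op opr (W_infty N) (W_infty N) = UNIV"
    unfolding eq using W[OF \<tau>] by blast
  show "set_op opr (singular_set N) (singular_set N) = UNIV"
    unfolding eq using S[OF \<tau>] by blast
  show "hausdorff_dim (set_op opr (W_infty N) (singular_set N)) < ereal (real CARD('n))"
    unfolding eq by (rule hausdorff_dim_W_infty_plus_singular[OF assms]) (use \<tau> in auto)
qed

end
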